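(* Let $(X,d,m)$ be a $\mathrm{CD}(K,N')$ space, $K\in\mathbb R$, $N'\in(1,\infty)$, and let $\Omega\subset X$ be open with $m(\Omega)<+\infty$. Assume furthermore that for some $N\in(1,\infty)$ and $C_{\rm Isop}>0$ the isoperimetric inequality $$\mathrm{Per}(E)\ge C_{\rm Isop}\,m(E)^{\frac{N-1}{N}},\qquad\forall E\subset\Omega\text{ Borel},$$ holds. Then for any $1<p<+\infty$ the Euclidean rearrangement $u\mapsto u^*_{0,N}$ maps (nonnegative functions in) $W^{1,p}_0(\Omega)$ to $W^{1,p}(\Omega^*,|\cdot|,m_{0,N})$. Moreover for any (nonnegative) $u\in W^{1,p}_0(\Omega)$ it holds $$\int_\Omega|Du|^p\,dm\ge\Big(\frac{C_{\rm Isop}}{N\omega_N^{1/N}}\Big)^p\int_{\Omega^*}|Du^*_{0,N}|^p\,dm_{0,N}.$$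
   Context: A metric measure space $(X,d,m)$ is a complete separable metric space with a nonzero, nonnegative Borel measure $m$ finite on bounded sets; it is assumed that $\mathrm{supp}(m)=X$. Sobolev spaces: for locally Lipschitz $f$, $\mathrm{lip} f(x):=\limsup_{y\to x}\frac{|f(y)-f(x)|}{d(x,y)}$ ($0$ at isolated points). For $p\in(1,\infty)$, $\mathrm{Ch}_p(f):=\inf\{\liminf_n\int(\mathrm{lip} f_n)^p\,dm: f_n\in L^p(m)\cap \mathrm{LIP}(X),\ f_n\to f\text{ in }L^p(m)\}$, $W^{1,p}(X):=\{f\in L^p(m):\mathrm{Ch}_p(f)<\infty\}$ with norm $\|f\|^p_{W^{1,p}}=\|f\|^p_{L^p}+\mathrm{Ch}_p(f)$, and $|Df|\in L^p(m)$ is the minimal $p$-weak upper gradient, with $\mathrm{Ch}_p(f)=\int|Df|^p\,dm$. $W^{1,p}_0(\Omega)$ is the closure in $W^{1,p}(X)$ of the Lipschitz functions with compact support in $\Omega$. $W^{1,p}(\Omega^*,|\cdot|,m_{0,N})$ is the same notion on the metric measure space $(\Omega^*,|\cdot|,m_{0,N}|_{\Omega^*})$. Perimeter: $\mathrm{Per}(E):=\inf\{\liminf_n\int_X\mathrm{lip}\,u_n\,dm: u_n\in\mathrm{LIP}_{loc}(X),\ u_n\to\chi_E\text{ in }L^1_{loc}(m)\}$. $\mathrm{CD}(K,N)$ condition ($K\in\mathbb R$, $N\in[1,\infty)$): for $\theta\ge0$, $t\in[0,1]$ let $\sigma^{(t)}_{K,N}(\theta)$ be $+\infty$ if $K\theta^2\ge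 N\pi^2$ and $K\theta^2>0$; $\frac{\sin(t\theta\sqrt{K/N})}{\sin(\theta\sqrt{K/N})}$ if $0<K\theta^2<N\pi^2$; $t$ if $K\theta^2=0$, or if $K\theta^2<0$ and $N=0$; $\frac{\sinh(t\theta\sqrt{-K/N})}{\sinh(\theta\sqrt{-K/N})}$ if $K\theta^2<0$ and $N>0$. Let $\tau^{(t)}_{K,N}(\theta):=t^{1/N}\sigma^{(t)}_{K,N-1}(\theta)^{1-1/N}$ for $N>1$, and $\tau^{(t)}_{K,1}(\theta):=t$ if $K\le 0$, $+\infty$ if $K>0$. $(X,d,m)$ is $\mathrm{CD}(K,N)$ if for all $m$-absolutely continuous probability measures $\mu_0=\rho_0m,\mu_1=\rho_1m$ with bounded support there is an optimal dynamical plan $\pi$ (a probability measure on constant speed geodesics $\gamma:[0,1]\to X$ with $(e_0,e_1)_\sharp\pi$ a $W_2$-optimal coupling of $\mu_0,\mu_1$, where $e_t(\gamma)=\gamma_t$) such that for all $t\in[0,1]$, $M\ge N$ one has $(e_t)_\sharp\pi=\rho_t m$ and $$-\int\rho_t^{1-1/M}dm\le-\int\Big(\tau^{(1-t)}_{K,M}(d(\gamma_0,\gamma_1))\rho_0(\gamma_0)^{-1/M}+\tau^{(t)}_{K,M}(d(\gamma_0,\gamma_1))\rho_1(\gamma_1)^{-1/M}\Big)d\pi(\gamma).$$ Euclidean rearrangement: $\omega_N:=\frac{\pi^{N/2}}{\Gamma(N/2+1)}$ and $m_{0,N}:=N\omega_N t^{N-1}\,dt$ on $[0,\infty)$. For a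 nonnegative Borel $u:\Omega\to[0,\infty)$ let $\mu(t):=m(\{u>t\})$, $u^{\#}(0):=\mathrm{ess\,sup}\,u$, $u^\#(s):=\inf\{t:\mu(t)<s\}$ for $s>0$. Let $\Omega^*:=[0,r]$ with $m_{0,N}([0,r])=m(\Omega)$ (i.e. $\omega_Nr^N=m(\Omega)$) and $u^*_{0,N}(x):=u^\#(\omega_Nx^N)$, $x\in\Omega^*$. *)

theory Defs
  imports "HOL-Probability.Probability"
begin

section \<open>Metric measure spaces\<close>

text \<open>The space \<open>X\<close> is a Polish metric type and \<open>m\<close> is a Borel measure \<open>M\<close> on it. The Sobolev notions
  below are relative to the carrier \<^term>\<open>space M\<close>, so that they apply both to \<open>X\<close> and to the
  interval \<open>[0,r]\<close>, regarded as a metric space on its own.\<close>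

definition metric_measure_space :: "'a::polish_space measure \<Rightarrow> bool" where
  "metric_measure_space M \<longleftrightarrow>
     sets M = sets borel \<and>
     emeasure M UNIV \<noteq> 0 \<and>
     (\<forall>B\<in>sets M. bounded B \<longrightarrow> emeasure M B < \<infinity>) \<and>
     (\<forall>x. \<forall>r>0. emeasure M (ball x r) > 0)"

definition Lip :: "'a::metric_space measure \<Rightarrow> ('a \<Rightarrow> real) set" where
  "Lip M = {f. \<exists>L. L-lipschitz_on (space M) f}"

definition Lip_loc :: "'a::metric_space measure \<Rightarrow> ('a \<Rightarrow> real) set" where
  "Lip_loc M = {f. \<forall>x\<in>space M. \<exists>r>0. \<exists>L. L-lipschitz_on (ball x r \<inter> space M) f}"

text \<open>At an isolated point of the space the filter is trivial and the upper limit in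
  \<^typ>\<open>ennreal\<close> is the bottom element \<open>0\<close>. For locally Lipschitz functions the upper limit is finite,
  so that \<^const>\<open>enn2real\<close> loses nothing.\<close>

definition lip :: "'a::metric_space measure \<Rightarrow> ('a \<Rightarrow> real) \<Rightarrow> 'a \<Rightarrow> real" where
  "lip M f x =
     enn2real (Limsup (at x within space M) (\<lambda>y. ennreal (\<bar>f y - f x\<bar> / dist x y)))"

section \<open>Sobolev spaces\<close>

definition Lp :: "'a measure \<Rightarrow> real \<Rightarrow> ('a \<Rightarrow> real) set" where
  "Lp M p = {f \<in> borel_measurable M. (\<integral>\<^sup>+x. ennreal (\<bar>f x\<bar> powr p) \<partial>M) < \<infinity>}"

definition Lp_tendsto :: "'a measure \<Rightarrow> real \<Rightarrow> (nat \<Rightarrow> 'a \<Rightarrow> real) \<Rightarrow> ('a \<Rightarrow> real) \<Rightarrow> bool" where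
  "Lp_tendsto M p fs f \<longleftrightarrow> (\<lambda>n. \<integral>\<^sup>+x. ennreal (\<bar>fs n x - f x\<bar> powr p) \<partial>M) \<longlonglongrightarrow> 0"

definition Cheeger :: "'a::metric_space measure \<Rightarrow> real \<Rightarrow> ('a \<Rightarrow> real) \<Rightarrow> ennreal" where
  "Cheeger M p f =
     Inf {liminf (\<lambda>n. \<integral>\<^sup>+x. ennreal (lip M (fs n) x powr p) \<partial>M) | fs.
            (\<forall>n. fs n \<in> Lp M p \<inter> Lip M) \<and> Lp_tendsto M p fs f}"

definition W1p :: "'a::metric_space measure \<Rightarrow> real \<Rightarrow> ('a \<Rightarrow> real) set" where
  "W1p M p = {f \<in> Lp M p. Cheeger M p f < \<infinity>}"

text \<open>Meaningful for \<open>f \<in> W1p M p\<close>, where both summands are finite.\<close>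

definition W1p_norm :: "'a::metric_space measure \<Rightarrow> real \<Rightarrow> ('a \<Rightarrow> real) \<Rightarrow> real" where
  "W1p_norm M p f =
     enn2real ((\<integral>\<^sup>+x. ennreal (\<bar>f x\<bar> powr p) \<partial>M) + Cheeger M p f) powr (1 / p)"

text \<open>Weak upper gradients are taken in the relaxed sense of Cheeger and of Ambrosio, Gigli and
  Savare: up to enlarging it, such a function is an \<open>L\<^sup>p\<close> limit of the slopes of Lipschitz functions
  converging to \<open>f\<close>. The one of minimal \<open>L\<^sup>p\<close> norm is unique up to null sets (by strict convexity)
  and it is the density of the energy, \<open>Cheeger M p f = \<integral> \<bar>Df\<bar>\<^sup>p dm\<close>. It exists for every \<open>f\<close> in
  \<open>W1p M p\<close> when \<open>1 < p\<close>; the choice operator only selects a representative.\<close>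

definition weak_upper_gradient ::
    "'a::metric_space measure \<Rightarrow> real \<Rightarrow> ('a \<Rightarrow> real) \<Rightarrow> ('a \<Rightarrow> real) \<Rightarrow> bool" where
  "weak_upper_gradient M p f G \<longleftrightarrow>
     G \<in> Lp M p \<and> (\<forall>x. 0 \<le> G x) \<and>
     (\<exists>fs. \<exists>H\<in>Lp M p.
        (\<forall>n. fs n \<in> Lp M p \<inter> Lip M) \<and> Lp_tendsto M p fs f \<and>
        Lp_tendsto M p (\<lambda>n. lip M (fs n)) H \<and>
        (AE x in M. H x \<le> G x))"

definition minimal_weak_upper_gradient ::
    "'a::metric_space measure \<Rightarrow> real \<Rightarrow> ('a \<Rightarrow> real) \<Rightarrow> ('a \<Rightarrow> real)" where
  "minimal_weak_upper_gradient M p f =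
     (SOME G. weak_upper_gradient M p f G \<and>
        (\<forall>G'. weak_upper_gradient M p f G' \<longrightarrow>
           (\<integral>\<^sup>+x. ennreal (G x powr p) \<partial>M) \<le> (\<integral>\<^sup>+x. ennreal (G' x powr p) \<partial>M)))"

definition Lip_compact_supp :: "'a::metric_space measure \<Rightarrow> 'a set \<Rightarrow> ('a \<Rightarrow> real) set" where
  "Lip_compact_supp M \<Omega> =
     {f \<in> Lip M. compact (closure {x \<in> space M. f x \<noteq> 0}) \<and> closure {x \<in> space M. f x \<noteq> 0} \<subseteq> \<Omega>}"

definition W1p_0 :: "'a::metric_space measure \<Rightarrow> real \<Rightarrow> 'a set \<Rightarrow> ('a \<Rightarrow> real) set" where
  "W1p_0 M p \<Omega> =
     {f \<in> W1p M p. \<forall>\<epsilon>>0. \<exists>g\<in>Lip_compact_supp M \<Omega>. W1p_norm M p (\<lambda>x. f x - g x) < \<epsilon>}"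

section \<open>Perimeter\<close>

definition L1_loc_tendsto ::
    "'a::metric_space measure \<Rightarrow> (nat \<Rightarrow> 'a \<Rightarrow> real) \<Rightarrow> ('a \<Rightarrow> real) \<Rightarrow> bool" where
  "L1_loc_tendsto M us u \<longleftrightarrow>
     (\<forall>x\<in>space M. \<exists>r>0.
        (\<lambda>n. \<integral>\<^sup>+y\<in>ball x r. ennreal \<bar>us n y - u y\<bar> \<partial>M) \<longlonglongrightarrow> 0)"

definition Per :: "'a::metric_space measure \<Rightarrow> 'a set \<Rightarrow> ennreal" where
  "Per M E =
     Inf {liminf (\<lambda>n. \<integral>\<^sup>+x. ennreal (lip M (us n) x) \<partial>M) | us.
            (\<forall>n. us n \<in> Lip_loc M) \<and> L1_loc_tendsto M us (indicator E)}"

section \<open>The curvature-dimension condition\<close>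

definition sigma_coeff :: "real \<Rightarrow> real \<Rightarrow> real \<Rightarrow> real \<Rightarrow> ennreal" where
  "sigma_coeff K N t \<theta> =
     (if K * \<theta>\<^sup>2 \<ge> N * pi\<^sup>2 \<and> K * \<theta>\<^sup>2 > 0 then \<infinity>
      else if 0 < K * \<theta>\<^sup>2 \<and> K * \<theta>\<^sup>2 < N * pi\<^sup>2
        then ennreal (sin (t * \<theta> * sqrt (K / N)) / sin (\<theta> * sqrt (K / N)))
      else if K * \<theta>\<^sup>2 = 0 \<or> (K * \<theta>\<^sup>2 < 0 \<and> N = 0) then ennreal t
      else ennreal (sinh (t * \<theta> * sqrt (- K / N)) / sinh (\<theta> * sqrt (- K / N))))"

definition ennreal_powr :: "ennreal \<Rightarrow> real \<Rightarrow> ennreal" where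
  "ennreal_powr a s = (if a = \<infinity> then \<infinity> else ennreal (enn2real a powr s))"

text \<open>The exponent \<open>1 - 1 / N\<close> is positive, and \<open>0 * \<infinity> = 0\<close> (which is relevant for \<open>t = 0\<close>).\<close>

definition tau_coeff :: "real \<Rightarrow> real \<Rightarrow> real \<Rightarrow> real \<Rightarrow> ennreal" where
  "tau_coeff K N t \<theta> =
     (if N > 1
      then ennreal (t powr (1 / N)) * ennreal_powr (sigma_coeff K (N - 1) t \<theta>) (1 - 1 / N)
      else if K \<le> 0 then ennreal t else \<infinity>)"

text \<open>Curves are extensional functions on \<open>[0,1]\<close>. Since the space is separable, the trace of the
  product \<open>\<sigma>\<close>-algebra on the geodesics is the Borel \<open>\<sigma>\<close>-algebra of the supremum distance.\<close>

definition geodesics :: "(real \<Rightarrow> 'a::metric_space) set" where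
  "geodesics = {\<gamma> \<in> extensional {0..1}.
     \<forall>s\<in>{0..1}. \<forall>t\<in>{0..1}. dist (\<gamma> s) (\<gamma> t) = \<bar>s - t\<bar> * dist (\<gamma> 0) (\<gamma> 1)}"

definition geodesic_space :: "(real \<Rightarrow> 'a::metric_space) measure" where
  "geodesic_space = restrict_space (\<Pi>\<^sub>M t\<in>{0..1}. borel) geodesics"

definition is_coupling ::
    "'a::metric_space measure \<Rightarrow> 'a measure \<Rightarrow> ('a \<times> 'a) measure \<Rightarrow> bool" where
  "is_coupling \<mu> \<nu> q \<longleftrightarrow>
     prob_space q \<and> sets q = sets (borel \<Otimes>\<^sub>M borel) \<and>
     distr q borel fst = \<mu> \<and> distr q borel snd = \<nu>"

definition W2_optimal_coupling ::
    "'a::metric_space measure \<Rightarrow> 'a measure \<Rightarrow> ('a \<times> 'a) measure \<Rightarrow> bool" where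
  "W2_optimal_coupling \<mu> \<nu> q \<longleftrightarrow>
     is_coupling \<mu> \<nu> q \<and>
     (\<forall>q'. is_coupling \<mu> \<nu> q' \<longrightarrow>
        (\<integral>\<^sup>+z. ennreal ((dist (fst z) (snd z))\<^sup>2) \<partial>q) \<le> (\<integral>\<^sup>+z. ennreal ((dist (fst z) (snd z))\<^sup>2) \<partial>q'))"

definition optimal_dynamical_plan ::
    "'a::metric_space measure \<Rightarrow> 'a measure \<Rightarrow> (real \<Rightarrow> 'a) measure \<Rightarrow> bool" where
  "optimal_dynamical_plan \<mu> \<nu> P \<longleftrightarrow>
     prob_space P \<and> sets P = sets geodesic_space \<and>
     W2_optimal_coupling \<mu> \<nu> (distr P (borel \<Otimes>\<^sub>M borel) (\<lambda>\<gamma>. (\<gamma> 0, \<gamma> 1)))"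

definition prob_density :: "'a measure \<Rightarrow> ('a \<Rightarrow> real) \<Rightarrow> bool" where
  "prob_density M \<rho> \<longleftrightarrow>
     \<rho> \<in> borel_measurable M \<and> (\<forall>x. 0 \<le> \<rho> x) \<and> (\<integral>\<^sup>+x. ennreal (\<rho> x) \<partial>M) = 1"

text \<open>The convexity inequality is written with the sign reversed, between integrals of nonnegative
  functions. The plan charges only geodesics whose endpoints have positive density, so the value of
  \<open>\<rho> powr (- 1 / N')\<close> at \<open>\<rho> = 0\<close> is immaterial.\<close>

definition CD :: "real \<Rightarrow> real \<Rightarrow> 'a::polish_space measure \<Rightarrow> bool" where
  "CD K N M \<longleftrightarrow>
     (\<forall>\<rho>0 \<rho>1.
        prob_density M \<rho>0 \<and> prob_density M \<rho>1 \<and>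
        (\<exists>B. bounded B \<and> (AE x in M. x \<notin> B \<longrightarrow> \<rho>0 x = 0 \<and> \<rho>1 x = 0)) \<longrightarrow>
        (\<exists>P. optimal_dynamical_plan (density M \<rho>0) (density M \<rho>1) P \<and>
           (\<forall>t\<in>{0..1}. \<exists>\<rho>.
              prob_density M \<rho> \<and> distr P borel (\<lambda>\<gamma>. \<gamma> t) = density M \<rho> \<and>
              (\<forall>N'\<ge>N.
                 (\<integral>\<^sup>+\<gamma>. tau_coeff K N' (1 - t) (dist (\<gamma> 0) (\<gamma> 1)) * ennreal (\<rho>0 (\<gamma> 0) powr (- 1 / N'))
                       + tau_coeff K N' t (dist (\<gamma> 0) (\<gamma> 1)) * ennreal (\<rho>1 (\<gamma> 1) powr (- 1 / N')) \<partial>P)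
                 \<le> (\<integral>\<^sup>+x. ennreal (\<rho> x powr (1 - 1 / N')) \<partial>M)))))"

section \<open>Euclidean rearrangement\<close>

text \<open>\<^term>\<open>unit_ball_vol N\<close> is \<open>\<omega>\<^sub>N\<close>, for real \<open>N\<close>.\<close>

definition m0 :: "real \<Rightarrow> real measure" where
  "m0 N = density (restrict_space lborel {0..})
            (\<lambda>t. ennreal (N * unit_ball_vol N * t powr (N - 1)))"

text \<open>Extended values are needed at \<open>s = 0\<close>, when \<open>u\<close> is not essentially bounded.\<close>

definition decreasing_rearrangement ::
    "'a::metric_space measure \<Rightarrow> 'a set \<Rightarrow> ('a \<Rightarrow> real) \<Rightarrow> real \<Rightarrow> ereal" where
  "decreasing_rearrangement M \<Omega> u s =
     (if s = 0 then esssup (restrict_space M \<Omega>) (\<lambda>x. ereal (u x))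
      else Inf {ereal t | t. 0 \<le> t \<and> emeasure M {x \<in> \<Omega>. u x > t} < ennreal s})"

text \<open>A real function: a possible value \<open>\<infinity>\<close> at the single point \<open>0\<close>, a null set for \<^term>\<open>m0 N\<close>,
  is replaced by \<open>0\<close>.\<close>

definition euclidean_rearrangement ::
    "real \<Rightarrow> 'a::metric_space measure \<Rightarrow> 'a set \<Rightarrow> ('a \<Rightarrow> real) \<Rightarrow> real \<Rightarrow> real" where
  "euclidean_rearrangement N M \<Omega> u x =
     real_of_ereal (decreasing_rearrangement M \<Omega> u (unit_ball_vol N * x powr N))"

end

theory Submission
  imports Defs
begin

text \<open>A function \<open>u \<ge> 0\<close> in \<open>W\<^sub>0\<^sup>1\<^sup>,\<^sup>p(\<Omega>)\<close> is the \<open>L\<^sup>p\<close> limit of Lipschitz functions \<open>v\<close> that vanish outside \<open>\<Omega>\<close> and whose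
  slopes have energies converging to \<open>Cheeger M p u\<close>: cut off optimal approximations of \<open>u\<close> near the
  support of a compactly supported \<open>g\<close> close to \<open>u\<close>. For such a \<open>v\<close>, applying the isoperimetric inequality
  to the superlevel sets and testing the perimeter with \<open>min 1 (n (v - t)\<^sup>+)\<close> gives
  \<open>C \<integral>\<^sub>a\<^sup>b \<mu>(t)\<^bsup>(N - 1)/N\<^esup> dt \<le> \<integral> lip v\<close> over \<open>{a < v \<le> b}\<close>, where \<open>\<mu>(t)\<close> is the measure of \<open>{v > t}\<close>. Hence the measure
  \<open>C \<mu>\<^bsup>(N - 1)/N\<^esup> dt\<close> has a density \<open>f\<close> with respect to the distribution of \<open>v\<close>, and Young's inequality bounds
  the \<open>L\<^sup>p\<close> norm of \<open>f\<close> by that of \<open>lip v\<close>. On the interval the rearrangement \<open>v\<^sup>*\<close> has the same distribution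
  as \<open>v\<close> and is a primitive of \<open>- f(v\<^sup>*) / c\<close>, where \<open>c\<close> is the constant of the theorem; no differentiation
  theorem is needed. Finally the rearrangement is continuous in \<open>L\<^sup>p\<close>, the Cheeger energy is lower
  semicontinuous, and uniform convexity of \<open>L\<^sup>p\<close> identifies the energy with that of the minimal weak
  upper gradient and shows that the latter is carried by \<open>\<Omega>\<close>.\<close>

section \<open>Elementary inequalities\<close>

text \<open>Closeness in \<open>W1p_0\<close> controls relaxed energies only: the slope of a
  compactly supported Lipschitz \<open>g\<close> near \<open>u\<close> may be much larger than its
  minimal weak upper gradient. Hence optimal approximations of \<open>u\<close> are required, and
  these ignore \<Omega>. Cutting off costs little because the cutoff varies only where
  \<open>g = 0\<close>, while the functions cut off are close to \<open>g\<close> in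
  \<open>L\<^sup>p\<close>. The function \<open>\<mu>\<close> may jump and need not be the integral
  of its derivative. Comparing measures on the line of levels, instead of derivatives of
  \<open>\<mu>\<close>, treats all cases at once: plateaus of the rearrangement simply carry no
  density. The constant is a ratio of isoperimetric profiles. In the model interval the ball
  \<open>[0,y]\<close> has volume \<open>V = \<omega> y^N\<close> and boundary weight
  \<open>N \<omega> y^(N-1) = N \<omega>^(1/N) V^((N-1)/N)\<close>, so \<open>C V^((N-1)/N)\<close>
  is \<open>c\<close> times that weight.\<close>

lemma powr_add_le:
  fixes a b e p :: real
  assumes "0 \<le> a" "0 \<le> b" "0 < e" "0 < p"
  shows "(a + b) powr p \<le> (1 + e) powr p * a powr p + (1 + 1 / e) powr p * b powr p"
proof (cases "b \<le> e * a")
  case True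
  have "(a + b) powr p \<le> ((1 + e) * a) powr p"
    using assms True by (intro powr_mono2) (auto simp: algebra_simps)
  also have "\<dots> = (1 + e) powr p * a powr p"
    using assms by (simp add: powr_mult)
  finally show ?thesis
    by (smt (verit) mult_nonneg_nonneg powr_ge_zero)
next
  case False
  then have "a \<le> b / e" using assms by (simp add: field_simps)
  then have "(a + b) powr p \<le> ((1 + 1 / e) * b) powr p"
    using assms by (intro powr_mono2) (auto simp: algebra_simps)
  also have "\<dots> = (1 + 1 / e) powr p * b powr p"
    using assms by (simp add: powr_mult)
  finally show ?thesis
    by (smt (verit) mult_nonneg_nonneg powr_ge_zero)
qed

text \<open>Superadditivity of the p-th power on nonnegative numbers. It bounds an
  \<open>L\<^sup>p\<close> distance by the \<open>L\<^sup>1\<close> distance of the p-th powers,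
  which is the quantity that rearranging does not increase.\<close>

lemma powr_abs_diff_le:
  fixes a b p :: real
  assumes "0 \<le> a" "0 \<le> b" "1 \<le> p"
  shows "\<bar>a - b\<bar> powr p \<le> \<bar>a powr p - b powr p\<bar>"
proof -
  have super: "x powr p + y powr p \<le> (x + y) powr p" if "0 \<le> x" "0 \<le> y" for x y :: real
  proof -
    have split: "z powr p = z * z powr (p - 1)" if "0 \<le> z" for z :: real
      using that powr_mult_base[of z "p - 1"] by simp
    have "x * x powr (p - 1) \<le> x * (x + y) powr (p - 1)" "y * y powr (p - 1) \<le> y * (x + y) powr (p - 1)"
      using that assms by (intro mult_left_mono powr_mono2; simp)+
    then show ?thesis
      using that by (simp add: split distrib_right)
  qed
  show ?thesis
    using super[of "a - b" b] super[of "b - a" a] assms by (cases "b \<le> a") auto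
qed

text \<open>Apply \<open>powr_add_le\<close> with \<open>h\<close> so small that
  \<open>(1 + h) powr p < 1 + e\<close>. As \<open>K\<close> is uniform in \<open>a\<close> and
  \<open>b\<close>, the inequality can be integrated: first a small relative error \<open>e\<close>
  is fixed, then the distance is made small against \<open>K\<close>.\<close>

lemma powr_diff_bound:
  fixes e p :: real
  assumes "0 < e" "0 < p"
  obtains K where "0 < K"
    "\<And>a b. 0 \<le> a \<Longrightarrow> 0 \<le> b \<Longrightarrow> \<bar>a powr p - b powr p\<bar> \<le> e * b powr p + K * \<bar>a - b\<bar> powr p"
proof -
  have "((\<lambda>h. (1 + h) powr p) \<longlongrightarrow> (1 + 0) powr p) (at_right (0::real))"
    by (intro tendsto_intros) auto
  then have "\<forall>\<^sub>F h in at_right (0::real). (1 + h) powr p < 1 + e"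
    using assms by (intro order_tendstoD(2)) auto
  then obtain h :: real where h: "0 < h" "(1 + h) powr p < 1 + e"
    by (auto simp: eventually_at_right_field dest: dense)
  show thesis
  proof (rule that[of "(1 + 1 / h) powr p"])
    show "0 < (1 + 1 / h) powr p" using h
      by (smt (verit) divide_pos_pos powr_gt_zero)
    fix a b :: real assume ab: "0 \<le> a" "0 \<le> b"
    have *: "x powr p - y powr p \<le> e * y powr p + (1 + 1 / h) powr p * \<bar>x - y\<bar> powr p"
      if "0 \<le> x" "0 \<le> y" for x y
    proof -
      have "x powr p \<le> (y + \<bar>x - y\<bar>) powr p"
        using that assms by (intro powr_mono2) auto
      also have "\<dots> \<le> (1 + h) powr p * y powr p + (1 + 1 / h) powr p * \<bar>x - y\<bar> powr p"
        using that assms h by (intro powr_add_le) auto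
      also have "(1 + h) powr p * y powr p \<le> (1 + e) * y powr p"
        using h by (intro mult_right_mono) auto
      finally show ?thesis by (simp add: algebra_simps)
    qed
    show "\<bar>a powr p - b powr p\<bar> \<le> e * b powr p + (1 + 1 / h) powr p * \<bar>a - b\<bar> powr p"
    proof (cases "b \<le> a")
      case True
      then show ?thesis using *[of a b] ab powr_mono2[of p b a] assms by auto
    next
      case False
      then have mono: "a powr p \<le> b powr p"
        using ab assms by (intro powr_mono2) auto
      then have "e * a powr p \<le> e * b powr p"
        using assms by (intro mult_left_mono) auto
      then show ?thesis
        using *[OF ab(2,1)] mono by (simp only: abs_minus_commute[of b a])
    qed
  qed
qed

text \<open>The secant slopes over the two halves of \<open>[s,1]\<close> are values of the strictly
  increasing derivative \<open>p * z powr (p - 1)\<close> at two ordered points. The derivative is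
  taken at positive points only, so \<open>s = 0\<close> is covered.\<close>

lemma powr_midpoint_less:
  fixes s p :: real
  assumes "0 \<le> s" "s < 1" "1 < p"
  shows "((1 + s) / 2) powr p < (1 + s powr p) / 2"
proof -
  define m where "m = (1 + s) / 2"
  have m: "s < m" "m < 1" "m - s = 1 - m" using assms by (auto simp: m_def field_simps)
  have cont: "continuous_on {x..y} (\<lambda>z::real. z powr p)" if "0 \<le> x" for x y
    using that assms by (intro continuous_on_powr') (auto intro!: continuous_intros)
  have der: "((\<lambda>z. z powr p) has_real_derivative p * z powr (p - 1)) (at z)" if "0 < z" for z :: real
    using that by (rule has_real_derivative_powr)
  have diff: "(\<lambda>z. z powr p) differentiable (at z)" if "0 < z" for z :: real
    using der[OF that] by (auto simp: real_differentiable_def)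
  have "0 \<le> m" using m assms by linarith
  have "\<exists>l z. s < z \<and> z < m \<and> DERIV (\<lambda>z. z powr p) z :> l \<and> m powr p - s powr p = (m - s) * l"
    using assms by (intro MVT m cont diff) auto
  then obtain l x where x: "s < x" "x < m" "DERIV (\<lambda>z. z powr p) x :> l" "m powr p - s powr p = (m - s) * l"
    by blast
  have "\<exists>l z. m < z \<and> z < 1 \<and> DERIV (\<lambda>z. z powr p) z :> l \<and> 1 powr p - m powr p = (1 - m) * l"
    using \<open>0 \<le> m\<close> by (intro MVT m cont diff) auto
  then obtain l' y where y: "m < y" "y < 1" "DERIV (\<lambda>z. z powr p) y :> l'" "1 powr p - m powr p = (1 - m) * l'"
    by blast
  have l: "l = p * x powr (p - 1)" "l' = p * y powr (p - 1)"
    using DERIV_unique[OF x(3) der] DERIV_unique[OF y(3) der] x y assms m by auto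
  have "x powr (p - 1) < y powr (p - 1)"
    using x y assms m by (intro powr_less_mono2) auto
  then have "m powr p - s powr p < 1 powr p - m powr p"
    unfolding x y m(3) l using m assms by (intro mult_strict_left_mono) auto
  then show ?thesis by (simp add: m_def field_simps)
qed

text \<open>By homogeneity it is enough to take \<open>a = 1\<close> and \<open>b = s\<close> in
  \<open>[0,1]\<close>. Where \<open>(1 - s) powr p < e\<close> the first term suffices. The
  remaining set \<open>S\<close> is compact and does not contain 1, so strict convexity gives the
  gap \<open>\<phi>\<close> a positive lower bound \<open>d\<close> there, and
  \<open>K = 1 / d\<close> works.\<close>

lemma powr_uniform_convex:
  fixes e p :: real
  assumes "0 < e" "1 < p"
  obtains K where "0 \<le> K"
    "\<And>a b. 0 \<le> a \<Longrightarrow> 0 \<le> b \<Longrightarrow>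
       \<bar>a - b\<bar> powr p \<le> e * (a powr p + b powr p) + K * ((a powr p + b powr p) / 2 - ((a + b) / 2) powr p)"
proof -
  define \<phi> where "\<phi> s = (1 + s powr p) / 2 - ((1 + s) / 2) powr p" for s :: real
  define S where "S = {s\<in>{0..1}. e \<le> (1 - s) powr p}"
  have contp: "continuous_on {0..1} (\<lambda>s::real. f s powr p)" if "continuous_on {0..1} f"
      "\<And>s. s\<in>{0..1} \<Longrightarrow> 0 \<le> f s" for f
    using that assms by (intro continuous_on_powr') (auto intro!: continuous_intros)
  have cont: "continuous_on {0..1} \<phi>"
    unfolding \<phi>_def by (intro continuous_intros contp) auto
  have "closed S"
    unfolding S_def by (intro continuous_on_closed_Collect_le continuous_intros contp) auto
  then have comp: "compact S"
    using compact_Int_closed[OF compact_Icc[of "0::real" 1], of S] by (auto simp: S_def Int_def conj_ac)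
  have pos: "0 < \<phi> s" if "s \<in> S" for s
    using that powr_midpoint_less[of s p] assms by (cases "s = 1") (auto simp: S_def \<phi>_def)
  have nonneg: "0 \<le> \<phi> s" if "s \<in> {0..1}" for s
    using that powr_midpoint_less[of s p] assms by (cases "s = 1") (auto simp: \<phi>_def)
  have "\<exists>d>0. \<forall>s\<in>S. d \<le> \<phi> s"
  proof (cases "S = {}")
    case True then show ?thesis by (auto intro: exI[of _ 1])
  next
    case False
    obtain s where "s \<in> S" "\<forall>t\<in>S. \<phi> s \<le> \<phi> t"
      using continuous_attains_inf[OF comp False continuous_on_subset[OF cont]]
      by (metis (no_types, lifting) S_def mem_Collect_eq subsetI)
    then show ?thesis using pos by blast
  qed
  then obtain d where d: "0 < d" "\<And>s. s \<in> S \<Longrightarrow> d \<le> \<phi> s" by blast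
  have unit: "(1 - s) powr p \<le> e + 1 / d * \<phi> s" if "s \<in> {0..1}" for s
  proof (cases "s \<in> S")
    case True
    have "(1 - s) powr p \<le> 1 powr p"
      using that assms by (intro powr_mono2) auto
    moreover have "1 \<le> 1 / d * \<phi> s"
      using d(2)[OF True] d(1) by (simp add: field_simps)
    ultimately show ?thesis using assms by simp
  next
    case False
    then show ?thesis using that nonneg[OF that] d
      by (auto simp: S_def intro: order_trans[of _ e])
  qed
  have ordered: "\<bar>a - b\<bar> powr p \<le> e * (a powr p + b powr p) + 1 / d * ((a powr p + b powr p) / 2 - ((a + b) / 2) powr p)"
    if ab: "0 \<le> b" "b \<le> a" for a b :: real
  proof (cases "a = 0")
    case True then show ?thesis using that by simp
  next
    case False
    define s where "s = b / a"
    have s: "s \<in> {0..1}" "b = s * a" using False ab by (auto simp: s_def field_simps)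
    have "\<bar>a - b\<bar> powr p = ((1 - s) * a) powr p"
      using s ab by (simp add: algebra_simps)
    also have "\<dots> = (1 - s) powr p * a powr p"
      using s ab False by (simp add: powr_mult)
    also have "\<dots> \<le> (e + 1 / d * \<phi> s) * a powr p"
      by (intro mult_right_mono unit s) auto
    also have "\<dots> = e * a powr p + 1 / d * (\<phi> s * a powr p)"
      by (simp add: algebra_simps)
    also have "\<phi> s * a powr p = (a powr p + b powr p) / 2 - ((a + b) / 2) powr p"
    proof -
      have "((a + b) / 2) powr p = ((1 + s) / 2 * a) powr p"
        using s by (simp add: algebra_simps)
      then show ?thesis
        unfolding \<phi>_def s(2) using s(1) ab False by (simp only: powr_mult) (simp add: algebra_simps)
    qed
    also have "e * a powr p \<le> e * (a powr p + b powr p)"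
      using assms by (intro mult_left_mono) auto
    finally show ?thesis by simp
  qed
  show thesis
  proof (rule that[of "1 / d"])
    show "0 \<le> 1 / d" using d by simp
    fix a b :: real assume "0 \<le> a" "0 \<le> b"
    then show "\<bar>a - b\<bar> powr p \<le> e * (a powr p + b powr p) + 1 / d * ((a powr p + b powr p) / 2 - ((a + b) / 2) powr p)"
      using ordered[of b a] ordered[of a b] by (cases "b \<le> a") (auto simp: algebra_simps abs_minus_commute)
  qed
qed

lemma powr_young:
  fixes a b p :: real
  assumes "0 \<le> a" "0 \<le> b" "1 < p"
  shows "a powr (p - 1) * b \<le> (1 - 1 / p) * a powr p + 1 / p * b powr p"
proof -
  define q where "q = p / (p - 1)"
  have q: "1 < q" "1 / p + 1 / q = 1" "(p - 1) * q = p" "1 / q = 1 - 1 / p"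
    using assms by (auto simp: q_def field_simps)
  show ?thesis
    using Youngs_inequality[OF assms(3) q(1,2) assms(2), of "a powr (p - 1)"] q(3,4)
    by (simp add: powr_powr mult.commute flip: q(4))
qed

section \<open>Slopes of Lipschitz functions\<close>

lemma lip_nonneg [simp]: "0 \<le> lip M f x"
  by (simp add: lip_def)

lemma lip_le:
  assumes "0 \<le> c" "\<forall>\<^sub>F y in at x within space M. \<bar>f y - f x\<bar> \<le> c * dist x y"
  shows "lip M f x \<le> c"
proof -
  have "\<forall>\<^sub>F y in at x within space M. ennreal (\<bar>f y - f x\<bar> / dist x y) \<le> ennreal c"
    using assms(2) eventually_neq_at_within[of x x "space M"]
    by eventually_elim (auto simp: field_simps intro!: ennreal_leI)
  then have "Limsup (at x within space M) (\<lambda>y. ennreal (\<bar>f y - f x\<bar> / dist x y)) \<le> ennreal c"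
    by (rule Limsup_bounded)
  then show ?thesis
    unfolding lip_def using assms(1) enn2real_mono by fastforce
qed

lemma lip_eq_0:
  assumes "\<forall>\<^sub>F y in at x within space M. f y = f x"
  shows "lip M f x = 0"
proof -
  have "lip M f x \<le> 0"
    using assms by (intro lip_le) (auto elim!: eventually_mono)
  then show ?thesis using lip_nonneg[of M f x] by linarith
qed

lemma Lip_I:
  assumes "\<And>x y. x \<in> space M \<Longrightarrow> y \<in> space M \<Longrightarrow> \<bar>f x - f y\<bar> \<le> L * dist x y"
  shows "f \<in> Lip M"
proof -
  have "(max L 0)-lipschitz_on (space M) f"
    by (rule lipschitz_onI)
      (auto simp: dist_real_def intro: order_trans[OF assms mult_right_mono[OF max.cobounded1 zero_le_dist]])
  then show ?thesis by (auto simp: Lip_def)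
qed

lemma Lip_E:
  assumes "f \<in> Lip M"
  obtains L where "0 \<le> L" "\<And>x y. x \<in> space M \<Longrightarrow> y \<in> space M \<Longrightarrow> \<bar>f x - f y\<bar> \<le> L * dist x y"
  using assms by (auto simp: Lip_def lipschitz_on_def dist_real_def)

lemma lip_le_Lipschitz:
  assumes "0 \<le> L" "\<And>x y. x \<in> space M \<Longrightarrow> y \<in> space M \<Longrightarrow> \<bar>f x - f y\<bar> \<le> L * dist x y" "x \<in> space M"
  shows "lip M f x \<le> L"
  using assms by (intro lip_le) (auto simp: eventually_at_filter dist_commute intro!: always_eventually)

text \<open>A converse of \<open>lip_le\<close>. Global Lipschitz continuity makes the upper limit
  finite; otherwise \<open>enn2real\<close> would turn an infinite slope into 0 and the bound would
  be false.\<close>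

lemma lip_eventually:
  assumes "f \<in> Lip M" "x \<in> space M" "lip M f x < c"
  shows "\<forall>\<^sub>F y in at x within space M. \<bar>f y - f x\<bar> \<le> c * dist x y"
proof -
  let ?L = "Limsup (at x within space M) (\<lambda>y. ennreal (\<bar>f y - f x\<bar> / dist x y))"
  obtain L where L: "0 \<le> L" "\<And>x y. x \<in> space M \<Longrightarrow> y \<in> space M \<Longrightarrow> \<bar>f x - f y\<bar> \<le> L * dist x y"
    using Lip_E[OF assms(1)] by blast
  have "\<forall>\<^sub>F y in at x within space M. ennreal (\<bar>f y - f x\<bar> / dist x y) \<le> ennreal L"
    unfolding eventually_at_filter
    by (rule always_eventually) (use L assms(2) in \<open>auto simp: field_simps dist_commute intro!: ennreal_leI\<close>)
  then have "?L \<le> ennreal L"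
    by (rule Limsup_bounded)
  then have "?L < \<infinity>"
    using order.strict_trans1 ennreal_less_top by (metis infinity_ennreal_def)
  then have "?L = ennreal (lip M f x)"
    unfolding lip_def by simp
  also have "\<dots> < ennreal c"
    using assms(3) by (intro ennreal_lessI) (auto intro: le_less_trans[OF lip_nonneg])
  finally have "\<forall>\<^sub>F y in at x within space M. ennreal (\<bar>f y - f x\<bar> / dist x y) < ennreal c"
    by (rule Limsup_lessD)
  then show ?thesis
    using eventually_neq_at_within[of x x "space M"]
  proof eventually_elim
    case (elim y)
    then have "\<bar>f y - f x\<bar> / dist x y < c"
      by (simp add: ennreal_less_iff)
    then show ?case using elim by (simp add: field_simps)
  qed
qed

text \<open>Only increments near \<open>x\<close> enter, and the coefficients may depend on
  \<open>x\<close>. So one statement serves midpoints, differences, truncations and, with the value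
  of one factor at \<open>x\<close> as a coefficient, products.\<close>

lemma lip_comb_le:
  assumes "f \<in> Lip M" "g \<in> Lip M" "x \<in> space M" "0 \<le> a" "0 \<le> b"
    and "\<forall>\<^sub>F y in at x within space M. \<bar>h y - h x\<bar> \<le> a * \<bar>f y - f x\<bar> + b * \<bar>g y - g x\<bar>"
  shows "lip M h x \<le> a * lip M f x + b * lip M g x"
proof (rule field_le_epsilon)
  fix e :: real assume "0 < e"
  define d where "d = e / (a + b + 1)"
  have d: "0 < d" "(a + b) * d \<le> e" using \<open>0 < e\<close> assms by (auto simp: d_def field_simps)
  have "lip M h x \<le> a * (lip M f x + d) + b * (lip M g x + d)"
  proof (rule lip_le)
    show "0 \<le> a * (lip M f x + d) + b * (lip M g x + d)"
      using assms d lip_nonneg by (intro add_nonneg_nonneg mult_nonneg_nonneg) auto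
    show "\<forall>\<^sub>F y in at x within space M. \<bar>h y - h x\<bar> \<le> (a * (lip M f x + d) + b * (lip M g x + d)) * dist x y"
      using assms(6) lip_eventually[OF assms(1,3) less_add_same_cancel1[THEN iffD2, OF d(1)]]
        lip_eventually[OF assms(2,3) less_add_same_cancel1[THEN iffD2, OF d(1)]]
    proof eventually_elim
      case (elim y)
      then have "a * \<bar>f y - f x\<bar> + b * \<bar>g y - g x\<bar> \<le> a * ((lip M f x + d) * dist x y) + b * ((lip M g x + d) * dist x y)"
        using assms by (intro add_mono mult_left_mono) auto
      then show ?case using elim(1) by (simp add: algebra_simps)
    qed
  qed
  also have "\<dots> \<le> a * lip M f x + b * lip M g x + e"
    using d by (simp add: algebra_simps)
  finally show "lip M h x \<le> a * lip M f x + b * lip M g x + e" .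
qed

lemma lip_scale_le:
  assumes "f \<in> Lip M" "x \<in> space M" "0 \<le> a"
    and "\<forall>\<^sub>F y in at x within space M. \<bar>h y - h x\<bar> \<le> a * \<bar>f y - f x\<bar>"
  shows "lip M h x \<le> a * lip M f x"
  using lip_comb_le[of f M f x a 0 h] assms by auto

lemma Lip_comb:
  assumes "f \<in> Lip M" "g \<in> Lip M" "0 \<le> a" "0 \<le> b"
    and "\<And>x y. x \<in> space M \<Longrightarrow> y \<in> space M \<Longrightarrow> \<bar>h x - h y\<bar> \<le> a * \<bar>f x - f y\<bar> + b * \<bar>g x - g y\<bar>"
  shows "h \<in> Lip M"
proof -
  obtain L where L: "0 \<le> L" "\<And>x y. x \<in> space M \<Longrightarrow> y \<in> space M \<Longrightarrow> \<bar>f x - f y\<bar> \<le> L * dist x y"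
    using Lip_E[OF assms(1)] by blast
  obtain K where K: "0 \<le> K" "\<And>x y. x \<in> space M \<Longrightarrow> y \<in> space M \<Longrightarrow> \<bar>g x - g y\<bar> \<le> K * dist x y"
    using Lip_E[OF assms(2)] by blast
  show ?thesis
  proof (rule Lip_I)
    fix x y assume xy: "x \<in> space M" "y \<in> space M"
    have "a * \<bar>f x - f y\<bar> + b * \<bar>g x - g y\<bar> \<le> a * (L * dist x y) + b * (K * dist x y)"
      using assms L K xy by (intro add_mono mult_left_mono) auto
    then show "\<bar>h x - h y\<bar> \<le> (a * L + b * K) * dist x y"
      using assms(5)[OF xy] by (simp add: algebra_simps)
  qed
qed

text \<open>Both the Polish space and the interval \<open>[0,r]\<close> with the weighted measure
  are instances, so the theory of slopes and energies is developed once for the two sides of the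
  inequality.\<close>

locale borel_carrier =
  fixes M :: "'a::metric_space measure"
  assumes sets_eq: "sets M = sets (restrict_space borel (space M))"
begin

lemma openin_sets: "openin (top_of_set (space M)) U \<Longrightarrow> U \<in> sets M"
  unfolding sets_eq sets_restrict_space by (auto simp: openin_open)

lemma Lip_continuous: "f \<in> Lip M \<Longrightarrow> continuous_on (space M) f"
  by (auto simp: Lip_def intro: lipschitz_on_continuous_on)

lemma Lip_measurable: "f \<in> Lip M \<Longrightarrow> f \<in> borel_measurable M"
  using borel_measurable_continuous_on_restrict[OF Lip_continuous, of f]
  by (simp add: measurable_cong_sets[OF sets_eq refl])

text \<open>The supremum \<open>Q n\<close> of the difference quotients over a punctured ball of
  radius \<open>1 / Suc n\<close> is lower semicontinuous in the centre: for a fixed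
  \<open>y\<close>, exceeding a constant is an open condition on \<open>x\<close>. The upper limit
  is the infimum of these countably many functions.\<close>

lemma lip_measurable:
  assumes "f \<in> Lip M"
  shows "lip M f \<in> borel_measurable M"
proof -
  let ?S = "space M"
  define q where "q x y = ennreal (\<bar>f y - f x\<bar> / dist x y)" for x y
  define Q where "Q n x = (SUP y\<in>?S \<inter> ball x (1 / Suc n) - {x}. q x y)" for n x
  have "Q n \<in> borel_measurable M" for n
  proof (rule borel_measurableI_greater)
    fix a :: ennreal
    show "{x \<in> space M. a < Q n x} \<in> sets M"
    proof (cases a)
      case top then show ?thesis by simp
    next
      case (real c)
      \<comment> \<open>The quotient condition multiplied out: this is continuous, and it vanishes
        at \<open>y = x\<close>, so the removed centre drops out of the open sets by itself.\<close>
      define h where "h y x = \<bar>f y - f x\<bar> - c * dist x y" for x y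
      have "openin (top_of_set ?S) (?S \<inter> h y -` {0<..})" for y
        unfolding h_def using Lip_continuous[OF assms]
        by (intro continuous_openin_preimage_gen continuous_intros) auto
      then have "openin (top_of_set ?S) (\<Union>y\<in>?S. (?S \<inter> h y -` {0<..}) \<inter> (?S \<inter> ball y (1 / Suc n)))"
        by (intro openin_Union openin_Int) (auto intro: openin_Int openin_open_Int)
      moreover have "a < q x y \<longleftrightarrow> 0 < h y x" if "x \<noteq> y" for x y
        using real that by (auto simp: q_def h_def ennreal_less_iff field_simps)
      then have "{x \<in> ?S. a < Q n x} = (\<Union>y\<in>?S. (?S \<inter> h y -` {0<..}) \<inter> (?S \<inter> ball y (1 / Suc n)))"
        unfolding Q_def less_SUP_iff by (auto simp: dist_commute h_def) (force simp: h_def dist_commute)+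
      ultimately show ?thesis using openin_sets by simp
    qed
  qed
  moreover have "Limsup (at x within ?S) (q x) = (INF n. Q n x)" for x
    unfolding Limsup_within Q_def
  proof (rule antisym)
    show "(INF e\<in>{0<..}. SUP y\<in>?S \<inter> ball x e - {x}. q x y) \<le> (INF n. SUP y\<in>?S \<inter> ball x (1 / real (Suc n)) - {x}. q x y)"
      by (rule INF_mono) (auto intro!: bexI[of _ "1 / real (Suc _)"])
    show "(INF n. SUP y\<in>?S \<inter> ball x (1 / real (Suc n)) - {x}. q x y) \<le> (INF e\<in>{0<..}. SUP y\<in>?S \<inter> ball x e - {x}. q x y)"
    proof (rule INF_mono)
      fix e :: real assume "e \<in> {0<..}"
      then obtain n where "1 / real (Suc n) < e" by (auto elim: nat_approx_posE)
      then show "\<exists>n\<in>UNIV. (SUP y\<in>?S \<inter> ball x (1 / real (Suc n)) - {x}. q x y) \<le> (SUP y\<in>?S \<inter> ball x e - {x}. q x y)"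
        by (intro bexI[of _ n] SUP_subset_mono) auto
    qed
  qed
  ultimately show ?thesis
    unfolding lip_def[abs_def] q_def[symmetric] by simp
qed

end

section \<open>\<open>L\<^sup>p\<close> convergence\<close>

definition Lp_integral :: "'a measure \<Rightarrow> real \<Rightarrow> ('a \<Rightarrow> real) \<Rightarrow> ennreal" where
  "Lp_integral M p f = (\<integral>\<^sup>+x. ennreal (\<bar>f x\<bar> powr p) \<partial>M)"

lemma Lp_iff: "f \<in> Lp M p \<longleftrightarrow> f \<in> borel_measurable M \<and> Lp_integral M p f < \<infinity>"
  by (simp add: Lp_def Lp_integral_def)

lemma Lp_tendsto_iff: "Lp_tendsto M p fs f \<longleftrightarrow> (\<lambda>n. Lp_integral M p (\<lambda>x. fs n x - f x)) \<longlonglongrightarrow> 0"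
  by (simp add: Lp_tendsto_def Lp_integral_def)

lemma Lp_integral_lip: "Lp_integral M p (lip M f) = (\<integral>\<^sup>+x. ennreal (lip M f x powr p) \<partial>M)"
  by (simp add: Lp_integral_def)

lemma Lp_integral_mono_AE:
  assumes "AE x in M. \<bar>f x\<bar> \<le> \<bar>g x\<bar>" "0 \<le> p"
  shows "Lp_integral M p f \<le> Lp_integral M p g"
  unfolding Lp_integral_def using assms
  by (intro nn_integral_mono_AE) (auto intro!: ennreal_leI powr_mono2)

lemma Lp_integral_mono:
  assumes "\<And>x. x \<in> space M \<Longrightarrow> \<bar>f x\<bar> \<le> \<bar>g x\<bar>" "0 \<le> p"
  shows "Lp_integral M p f \<le> Lp_integral M p g"
  using assms by (intro Lp_integral_mono_AE AE_I2) auto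

lemma Lp_integral_add_le:
  assumes [measurable]: "f \<in> borel_measurable M" "g \<in> borel_measurable M"
    and "0 < p" and "AE x in M. \<bar>h x\<bar> \<le> \<bar>f x\<bar> + \<bar>g x\<bar>"
  shows "Lp_integral M p h \<le> ennreal (2 powr p) * (Lp_integral M p f + Lp_integral M p g)"
proof -
  have "Lp_integral M p h \<le> (\<integral>\<^sup>+x. ennreal (2 powr p) * (ennreal (\<bar>f x\<bar> powr p) + ennreal (\<bar>g x\<bar> powr p)) \<partial>M)"
    unfolding Lp_integral_def using assms(4)
  proof (intro nn_integral_mono_AE, eventually_elim)
    case (elim x)
    have "\<bar>h x\<bar> powr p \<le> (\<bar>f x\<bar> + \<bar>g x\<bar>) powr p"
      using elim assms by (intro powr_mono2) auto
    also have "\<dots> \<le> 2 powr p * (\<bar>f x\<bar> powr p + \<bar>g x\<bar> powr p)"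
      using powr_add_le[of "\<bar>f x\<bar>" "\<bar>g x\<bar>" 1 p] assms by (simp add: distrib_left)
    finally show ?case
      by (simp add: ennreal_mult[symmetric] ennreal_plus[symmetric] ennreal_leI del: ennreal_plus)
  qed
  then show ?thesis
    by (simp add: Lp_integral_def nn_integral_add nn_integral_cmult)
qed

lemma Lp_integral_add_finite:
  assumes "f \<in> borel_measurable M" "g \<in> borel_measurable M"
    and "0 < p" and "AE x in M. \<bar>h x\<bar> \<le> \<bar>f x\<bar> + \<bar>g x\<bar>"
    and "Lp_integral M p f < \<infinity>" "Lp_integral M p g < \<infinity>"
  shows "Lp_integral M p h < \<infinity>"
  using Lp_integral_add_le[OF assms(1-4)] assms(5,6)
  by (auto simp: ennreal_mult_less_top ennreal_add_less_top intro: le_less_trans)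

lemma Lp_diff:
  assumes "f \<in> Lp M p" "g \<in> Lp M p" "0 < p"
  shows "(\<lambda>x. f x - g x) \<in> Lp M p"
  using assms Lp_integral_add_finite[of f M g p "\<lambda>x. f x - g x"] by (auto simp: Lp_iff)

lemma tendsto_0_ennreal_comb:
  fixes F G :: "nat \<Rightarrow> ennreal"
  assumes "F \<longlonglongrightarrow> 0" "G \<longlonglongrightarrow> 0"
  shows "(\<lambda>n. ennreal c * (F n + G n)) \<longlonglongrightarrow> 0"
  using ennreal_tendsto_cmult[OF _ tendsto_add[OF assms], of "ennreal c"] by simp

lemma Lp_tendsto_comb:
  assumes "Lp_tendsto M p fs f" "Lp_tendsto M p gs g" "0 < p"
    and [measurable]: "\<And>n. fs n \<in> borel_measurable M" "f \<in> borel_measurable M"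
      "\<And>n. gs n \<in> borel_measurable M" "g \<in> borel_measurable M"
    and "\<And>n. AE x in M. \<bar>hs n x - h x\<bar> \<le> \<bar>fs n x - f x\<bar> + \<bar>gs n x - g x\<bar>"
  shows "Lp_tendsto M p hs h"
  unfolding Lp_tendsto_iff
proof (rule tendsto_sandwich[OF _ _ tendsto_const])
  let ?B = "\<lambda>n. ennreal (2 powr p) * (Lp_integral M p (\<lambda>x. fs n x - f x) + Lp_integral M p (\<lambda>x. gs n x - g x))"
  show "?B \<longlonglongrightarrow> 0"
    using assms(1,2) unfolding Lp_tendsto_iff by (rule tendsto_0_ennreal_comb)
  show "\<forall>\<^sub>F n in sequentially. Lp_integral M p (\<lambda>x. hs n x - h x) \<le> ?B n"
    by (intro always_eventually allI Lp_integral_add_le assms) auto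
qed auto

lemma nn_integral_powr_diff_le:
  assumes [measurable]: "f \<in> borel_measurable M" "g \<in> borel_measurable M"
    and "\<And>x. x \<in> space M \<Longrightarrow> \<bar>\<bar>f x\<bar> powr p - \<bar>g x\<bar> powr p\<bar> \<le> e * \<bar>g x\<bar> powr p + K * \<bar>\<bar>f x\<bar> - \<bar>g x\<bar>\<bar> powr p"
    and "0 \<le> e" "0 \<le> K" "0 \<le> p"
  shows "(\<integral>\<^sup>+x. ennreal \<bar>\<bar>f x\<bar> powr p - \<bar>g x\<bar> powr p\<bar> \<partial>M)
    \<le> ennreal e * Lp_integral M p g + ennreal K * Lp_integral M p (\<lambda>x. f x - g x)"
proof -
  have "(\<integral>\<^sup>+x. ennreal \<bar>\<bar>f x\<bar> powr p - \<bar>g x\<bar> powr p\<bar> \<partial>M)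
      \<le> (\<integral>\<^sup>+x. ennreal e * ennreal (\<bar>g x\<bar> powr p) + ennreal K * ennreal (\<bar>f x - g x\<bar> powr p) \<partial>M)"
  proof (rule nn_integral_mono)
    fix x assume "x \<in> space M"
    moreover have "K * \<bar>\<bar>f x\<bar> - \<bar>g x\<bar>\<bar> powr p \<le> K * \<bar>f x - g x\<bar> powr p"
      using assms by (intro mult_left_mono powr_mono2) auto
    ultimately have "\<bar>\<bar>f x\<bar> powr p - \<bar>g x\<bar> powr p\<bar> \<le> e * \<bar>g x\<bar> powr p + K * \<bar>f x - g x\<bar> powr p"
      using assms(3)[of x] by linarith
    then show "ennreal \<bar>\<bar>f x\<bar> powr p - \<bar>g x\<bar> powr p\<bar> \<le> ennreal e * ennreal (\<bar>g x\<bar> powr p) + ennreal K * ennreal (\<bar>f x - g x\<bar> powr p)"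
      using assms by (simp add: ennreal_mult[symmetric] ennreal_plus[symmetric] ennreal_leI del: ennreal_plus)
  qed
  then show ?thesis
    by (simp add: Lp_integral_def nn_integral_add nn_integral_cmult)
qed

lemma ennreal_tendsto_0I:
  fixes F :: "nat \<Rightarrow> ennreal"
  assumes "\<And>e. 0 < e \<Longrightarrow> \<forall>\<^sub>F n in sequentially. F n \<le> ennreal e"
  shows "F \<longlonglongrightarrow> 0"
proof (rule order_tendstoI)
  fix a :: ennreal assume "0 < a"
  then obtain e where e: "0 < e" "ennreal e < a"
    by (metis dense ennreal_cases ennreal_0 ennreal_less_zero_iff less_ennreal.rep_eq not_less_iff_gr_or_eq top.not_eq_extremum)
  from assms[OF e(1)] show "\<forall>\<^sub>F n in sequentially. F n < a"
    by eventually_elim (use e in auto)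
qed auto

lemma ennreal_tendsto_0D:
  fixes F :: "nat \<Rightarrow> ennreal"
  assumes "F \<longlonglongrightarrow> 0" "0 < e"
  shows "\<forall>\<^sub>F n in sequentially. F n < ennreal e"
  using order_tendstoD(2)[OF assms(1), of "ennreal e"] assms(2) by simp

text \<open>This form, rather than convergence of norms alone, is what passes to rearrangements:
  \<open>rearr_contraction\<close> bounds the distance of two rearrangements by exactly such an
  integral.\<close>

lemma Lp_tendsto_powr_diff:
  assumes "Lp_tendsto M p fs f" "f \<in> Lp M p" "0 < p" "\<And>n. fs n \<in> borel_measurable M"
  shows "(\<lambda>n. \<integral>\<^sup>+x. ennreal \<bar>\<bar>fs n x\<bar> powr p - \<bar>f x\<bar> powr p\<bar> \<partial>M) \<longlonglongrightarrow> 0" (is "?F \<longlonglongrightarrow> 0")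
proof (rule ennreal_tendsto_0I)
  fix e :: real assume "0 < e"
  define P where "P = enn2real (Lp_integral M p f)"
  have P: "0 \<le> P" "Lp_integral M p f = ennreal P"
    using assms(2) by (auto simp: P_def Lp_iff)
  define d where "d = e / (2 * (P + 1))"
  have d: "0 < d" "d * P \<le> e / 2"
    using \<open>0 < e\<close> P by (auto simp: d_def field_simps)
  obtain K where K: "0 < K"
    "\<And>a b. 0 \<le> a \<Longrightarrow> 0 \<le> b \<Longrightarrow> \<bar>a powr p - b powr p\<bar> \<le> d * b powr p + K * \<bar>a - b\<bar> powr p"
    using powr_diff_bound[OF d(1) assms(3)] by blast
  have "\<forall>\<^sub>F n in sequentially. Lp_integral M p (\<lambda>x. fs n x - f x) < ennreal (e / (2 * K))"
    using assms(1) \<open>0 < e\<close> K by (intro ennreal_tendsto_0D) (auto simp: Lp_tendsto_iff)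
  then show "\<forall>\<^sub>F n in sequentially. ?F n \<le> ennreal e"
  proof eventually_elim
    case (elim n)
    have "?F n \<le> ennreal d * Lp_integral M p f + ennreal K * Lp_integral M p (\<lambda>x. fs n x - f x)"
      using assms K d by (intro nn_integral_powr_diff_le K) (auto simp: Lp_iff)
    also have "\<dots> \<le> ennreal d * ennreal P + ennreal K * ennreal (e / (2 * K))"
      using elim P by (intro add_mono mult_left_mono) auto
    also have "\<dots> = ennreal (d * P + e / 2)"
      using d P K \<open>0 < e\<close> by (simp add: ennreal_mult[symmetric] ennreal_plus[symmetric] del: ennreal_plus)
    also have "\<dots> \<le> ennreal e"
      using d by (intro ennreal_leI) simp
    finally show ?case .
  qed
qed

lemma Lp_tendsto_Lp_integral:
  assumes "Lp_tendsto M p fs f" "f \<in> Lp M p" "0 < p" "\<And>n. fs n \<in> borel_measurable M"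
  shows "(\<lambda>n. Lp_integral M p (fs n)) \<longlonglongrightarrow> Lp_integral M p f"
proof -
  let ?D = "\<lambda>n. \<integral>\<^sup>+x. ennreal \<bar>\<bar>fs n x\<bar> powr p - \<bar>f x\<bar> powr p\<bar> \<partial>M"
  have [measurable]: "f \<in> borel_measurable M" "\<And>n. fs n \<in> borel_measurable M"
    using assms by (auto simp: Lp_iff)
  have D: "?D \<longlonglongrightarrow> 0" by (rule Lp_tendsto_powr_diff[OF assms])
  have up: "Lp_integral M p (fs n) \<le> Lp_integral M p f + ?D n" for n
    unfolding Lp_integral_def
    by (subst nn_integral_add[symmetric]) (auto intro!: nn_integral_mono simp: ennreal_plus[symmetric] ennreal_leI simp del: ennreal_plus)
  have low: "Lp_integral M p f \<le> Lp_integral M p (fs n) + ?D n" for n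
    unfolding Lp_integral_def
    by (subst nn_integral_add[symmetric]) (auto intro!: nn_integral_mono simp: ennreal_plus[symmetric] ennreal_leI simp del: ennreal_plus)
  show ?thesis
  proof (rule tendsto_sandwich[of "\<lambda>n. Lp_integral M p f - ?D n" _ _ "\<lambda>n. Lp_integral M p f + ?D n"])
    show "(\<lambda>n. Lp_integral M p f + ?D n) \<longlonglongrightarrow> Lp_integral M p f"
      using tendsto_add[OF tendsto_const D, of "Lp_integral M p f"] by simp
    show "(\<lambda>n. Lp_integral M p f - ?D n) \<longlonglongrightarrow> Lp_integral M p f"
      using tendsto_diff_ennreal[OF tendsto_const D, of "Lp_integral M p f"] assms(2)
      by (auto simp: Lp_iff)
    show "\<forall>\<^sub>F n in sequentially. Lp_integral M p f - ?D n \<le> Lp_integral M p (fs n)"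
      using low assms(2) by (auto simp: ennreal_minus_le_iff add.commute Lp_iff intro!: always_eventually)
  qed (use up in \<open>auto intro!: always_eventually\<close>)
qed

lemma Lp_complete:
  assumes meas [measurable]: "\<And>n. h n \<in> borel_measurable M" and "0 < p"
    and Cauchy: "\<And>e. 0 < e \<Longrightarrow> \<exists>k. \<forall>m\<ge>k. \<forall>n\<ge>k. Lp_integral M p (\<lambda>x. h m x - h n x) \<le> ennreal e"
  obtains H where "H \<in> borel_measurable M" "Lp_tendsto M p h H"
proof -
  \<comment> \<open>Chebyshev weights: the increments along a subsequence get p-th power integrals
    at most \<open>c k * (1 / 2) ^ k\<close>, so the sum of
    \<open>\<bar>d k x\<bar> powr p / c k\<close> is integrable. Where it is finite,
    \<open>\<bar>d k x\<bar>\<close> is at most a constant times \<open>(1 / 2) ^ k\<close>, which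
    is summable.\<close>
  define c where "c k = ((1 / 2) ^ k) powr p" for k :: nat
  have c: "0 < c k" for k by (simp add: c_def)
  have "\<forall>k. \<exists>j. \<forall>m\<ge>j. \<forall>n\<ge>j. Lp_integral M p (\<lambda>x. h m x - h n x) \<le> ennreal (c k * (1 / 2) ^ k)"
    using Cauchy c by auto
  then obtain j where j: "\<And>k m n. j k \<le> m \<Longrightarrow> j k \<le> n \<Longrightarrow> Lp_integral M p (\<lambda>x. h m x - h n x) \<le> ennreal (c k * (1 / 2) ^ k)"
    by metis
  \<comment> \<open>The sum lies above \<open>j k\<close> both at \<open>k\<close> and at
    \<open>Suc k\<close>, so consecutive terms obey the bound for \<open>k\<close>; the summand
    \<open>k\<close> forces \<open>s\<close> to infinity.\<close>
  define s where "s k = (\<Sum>i\<le>k. j i) + k" for k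
  have sj: "j k \<le> s k" "j k \<le> s (Suc k)" "k \<le> s k" for k
    using member_le_sum[of k "{..k}" j] member_le_sum[of k "{..Suc k}" j] by (auto simp: s_def)
  define d where "d k x = h (s (Suc k)) x - h (s k) x" for k x
  define S where "S x = (\<Sum>k. ennreal (\<bar>d k x\<bar> powr p / c k))" for x
  have [measurable]: "d k \<in> borel_measurable M" for k unfolding d_def[abs_def] by measurable
  have "integral\<^sup>N M S = (\<Sum>k. \<integral>\<^sup>+x. ennreal (\<bar>d k x\<bar> powr p / c k) \<partial>M)"
    unfolding S_def by (rule nn_integral_suminf) simp
  also have "\<dots> \<le> (\<Sum>k. ennreal ((1 / 2) ^ k))"
  proof (intro suminf_le)
    fix k
    have "(\<integral>\<^sup>+x. ennreal (\<bar>d k x\<bar> powr p / c k) \<partial>M) = ennreal (1 / c k) * Lp_integral M p (d k)"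
      unfolding Lp_integral_def using c[of k]
      by (subst nn_integral_cmult[symmetric]) (auto simp: ennreal_mult[symmetric] intro!: nn_integral_cong)
    also have "\<dots> \<le> ennreal (1 / c k) * ennreal (c k * (1 / 2) ^ k)"
      unfolding d_def by (intro mult_left_mono j sj) auto
    also have "\<dots> = ennreal ((1 / 2) ^ k)"
      using c[of k] by (simp add: ennreal_mult[symmetric])
    finally show "(\<integral>\<^sup>+x. ennreal (\<bar>d k x\<bar> powr p / c k) \<partial>M) \<le> ennreal ((1 / 2) ^ k)" .
  qed auto
  also have "\<dots> < \<infinity>"
    by (subst suminf_ennreal2) (auto intro!: summable_geometric)
  finally have "AE x in M. S x \<noteq> \<infinity>"
    by (intro nn_integral_noteq_infinite) (auto simp: S_def[abs_def])
  then have conv: "AE x in M. convergent (\<lambda>k. h (s k) x)"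
  proof eventually_elim
    case (elim x)
    then obtain B where B: "0 \<le> B" "S x = ennreal B" by (cases "S x") auto
    have "\<bar>d k x\<bar> \<le> B powr (1 / p) * (1 / 2) ^ k" for k
    proof -
      have "ennreal (\<bar>d k x\<bar> powr p / c k) \<le> S x"
        unfolding S_def using sum_le_suminf[of "\<lambda>k. ennreal (\<bar>d k x\<bar> powr p / c k)" "{k}"] by auto
      then have "\<bar>d k x\<bar> powr p \<le> B * c k"
        using B c[of k] by (simp add: field_simps)
      then have "(\<bar>d k x\<bar> powr p) powr (1 / p) \<le> (B * c k) powr (1 / p)"
        using assms by (intro powr_mono2) auto
      then show ?thesis
        using assms B by (simp add: powr_powr powr_mult c_def)
    qed
    then have "summable (\<lambda>k. d k x)"
      by (intro summable_comparison_test'[OF summable_mult[OF summable_geometric[of "1 / 2 :: real"]]]) auto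
    then have "convergent (\<lambda>n. h (s 0) x + (\<Sum>k<n. d k x))"
      by (intro convergent_add convergent_const) (simp add: summable_iff_convergent)
    moreover have "h (s 0) x + (\<Sum>k<n. d k x) = h (s n) x" for n
      by (induction n) (auto simp: d_def)
    ultimately show ?case by simp
  qed
  define H where "H x = lim (\<lambda>k. h (s k) x)" for x
  have [measurable]: "H \<in> borel_measurable M" unfolding H_def[abs_def] by measurable
  show thesis
  proof (rule that)
    show "Lp_tendsto M p h H"
      unfolding Lp_tendsto_iff
    proof (rule ennreal_tendsto_0I)
      fix e :: real assume "0 < e"
      then obtain k where k: "\<And>m n. k \<le> m \<Longrightarrow> k \<le> n \<Longrightarrow> Lp_integral M p (\<lambda>x. h m x - h n x) \<le> ennreal e"
        using Cauchy by blast
      have "Lp_integral M p (\<lambda>x. h n x - H x) \<le> ennreal e" if "k \<le> n" for n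
      proof -
        \<comment> \<open>Fatou along the subsequence carries the Cauchy bound over to
          \<open>H\<close>, and thereby gives convergence of the whole sequence.\<close>
        have "Lp_integral M p (\<lambda>x. h n x - H x) = (\<integral>\<^sup>+x. liminf (\<lambda>i. ennreal (\<bar>h n x - h (s i) x\<bar> powr p)) \<partial>M)"
          unfolding Lp_integral_def using conv
        proof (intro nn_integral_cong_AE, eventually_elim)
          case (elim x)
          then have "(\<lambda>i. h (s i) x) \<longlonglongrightarrow> H x"
            by (simp add: H_def convergent_LIMSEQ_iff)
          then have "(\<lambda>i. ennreal (\<bar>h n x - h (s i) x\<bar> powr p)) \<longlonglongrightarrow> ennreal (\<bar>h n x - H x\<bar> powr p)"
            using assms by (intro tendsto_ennrealI tendsto_powr' tendsto_intros) auto
          then show ?case by (rule lim_imp_Liminf[OF sequentially_bot, symmetric])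
        qed
        also have "\<dots> \<le> liminf (\<lambda>i. Lp_integral M p (\<lambda>x. h n x - h (s i) x))"
          unfolding Lp_integral_def by (intro nn_integral_liminf) auto
        also have "\<dots> \<le> ennreal e"
        proof (rule Liminf_le)
          show "\<forall>\<^sub>F i in sequentially. Lp_integral M p (\<lambda>x. h n x - h (s i) x) \<le> ennreal e"
            using that sj(3) by (auto intro!: k eventually_sequentiallyI[of k] intro: order_trans)
        qed auto
        finally show ?thesis .
      qed
      then show "\<forall>\<^sub>F n in sequentially. Lp_integral M p (\<lambda>x. h n x - H x) \<le> ennreal e"
        by (auto simp: eventually_sequentially)
    qed
  qed simp
qed

section \<open>The Cheeger energy\<close>

text \<open>The energies have a genuine limit, not only a lower limit. The property therefore passes
  to subsequences, on which the Cauchy argument for the slopes relies.\<close>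

definition minimizing :: "'a::metric_space measure \<Rightarrow> real \<Rightarrow> (nat \<Rightarrow> 'a \<Rightarrow> real) \<Rightarrow> ('a \<Rightarrow> real) \<Rightarrow> bool" where
  "minimizing M p fs f \<longleftrightarrow> (\<forall>n. fs n \<in> Lp M p \<inter> Lip M) \<and> Lp_tendsto M p fs f \<and>
     (\<lambda>n. Lp_integral M p (lip M (fs n))) \<longlonglongrightarrow> Cheeger M p f"

lemma Cheeger_le_liminf:
  assumes "\<And>n. fs n \<in> Lp M p \<inter> Lip M" "Lp_tendsto M p fs f"
  shows "Cheeger M p f \<le> liminf (\<lambda>n. Lp_integral M p (lip M (fs n)))"
  unfolding Cheeger_def Lp_integral_lip using assms by (intro Inf_lower) auto

lemma Cheeger_approx:
  assumes "Cheeger M p f < \<infinity>" "0 < e"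
  obtains g where "g \<in> Lp M p \<inter> Lip M" "Lp_integral M p (\<lambda>x. g x - f x) < ennreal e"
    "Lp_integral M p (lip M g) < Cheeger M p f + ennreal e"
proof -
  have "Cheeger M p f < Cheeger M p f + ennreal e"
    using assms by (simp add: ennreal_add_left_cancel_less less_top)
  then have "\<exists>v\<in>{liminf (\<lambda>n. \<integral>\<^sup>+x. ennreal (lip M (fs n) x powr p) \<partial>M) | fs.
      (\<forall>n. fs n \<in> Lp M p \<inter> Lip M) \<and> Lp_tendsto M p fs f}. v < Cheeger M p f + ennreal e"
    by (subst (asm) (1) Cheeger_def) (simp only: Inf_less_iff)
  then obtain fs where fs: "\<forall>n. fs n \<in> Lp M p \<inter> Lip M" "Lp_tendsto M p fs f"
    "liminf (\<lambda>n. Lp_integral M p (lip M (fs n))) < Cheeger M p f + ennreal e"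
    unfolding Lp_integral_lip by blast
  \<comment> \<open>The lower limit makes the energy small for infinitely many indices only, while
    closeness to \<open>f\<close> holds for almost all; one index satisfies both.\<close>
  have "\<exists>\<^sub>F n in sequentially. Lp_integral M p (lip M (fs n)) < Cheeger M p f + ennreal e"
  proof (rule ccontr)
    assume "\<not> ?thesis"
    then have "\<forall>\<^sub>F n in sequentially. Cheeger M p f + ennreal e \<le> Lp_integral M p (lip M (fs n))"
      by (simp add: not_frequently not_less)
    from Liminf_bounded[OF this] fs(3) show False by simp
  qed
  moreover have "\<forall>\<^sub>F n in sequentially. Lp_integral M p (\<lambda>x. fs n x - f x) < ennreal e"
    using fs(2) assms(2) by (intro ennreal_tendsto_0D) (auto simp: Lp_tendsto_iff)
  ultimately have "\<exists>\<^sub>F n in sequentially. Lp_integral M p (lip M (fs n)) < Cheeger M p f + ennreal e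
    \<and> Lp_integral M p (\<lambda>x. fs n x - f x) < ennreal e"
    by (rule frequently_eventually_frequently)
  then obtain n where "Lp_integral M p (lip M (fs n)) < Cheeger M p f + ennreal e"
    "Lp_integral M p (\<lambda>x. fs n x - f x) < ennreal e"
    by (auto dest: frequently_ex)
  then show thesis using that fs(1) by blast
qed

text \<open>The matching lower bound is automatic, because \<open>Cheeger\<close> is an infimum of
  lower limits over all admissible sequences.\<close>

lemma minimizingI:
  assumes "\<And>n. fs n \<in> Lp M p \<inter> Lip M" "Lp_tendsto M p fs f" "Cheeger M p f < \<infinity>"
    and "\<And>e. 0 < e \<Longrightarrow> \<forall>\<^sub>F n in sequentially. Lp_integral M p (lip M (fs n)) \<le> Cheeger M p f + ennreal e"
  shows "minimizing M p fs f"
proof -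
  have "(\<lambda>n. Lp_integral M p (lip M (fs n))) \<longlonglongrightarrow> Cheeger M p f"
  proof (rule order_tendstoI)
    fix a assume "a < Cheeger M p f"
    then have "a < liminf (\<lambda>n. Lp_integral M p (lip M (fs n)))"
      using Cheeger_le_liminf[OF assms(1,2)] by simp
    then show "\<forall>\<^sub>F n in sequentially. a < Lp_integral M p (lip M (fs n))"
      by (rule less_LiminfD)
  next
    fix a assume a: "Cheeger M p f < a"
    obtain c where c: "0 \<le> c" "Cheeger M p f = ennreal c"
      using assms(3) by (cases "Cheeger M p f") auto
    obtain e where "0 < e" "Cheeger M p f + ennreal e < a"
    proof (cases a)
      case (real b)
      then have "c < b" using a c by (simp add: ennreal_less_iff)
      then show ?thesis using that[of "(b - c) / 2"] c real
        by (simp add: ennreal_plus[symmetric] ennreal_less_iff field_simps del: ennreal_plus)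
    next
      case top
      then show ?thesis using that[of 1] c by (simp add: less_top)
    qed
    then show "\<forall>\<^sub>F n in sequentially. Lp_integral M p (lip M (fs n)) < a"
      using assms(4)[of e] by (auto elim!: eventually_mono)
  qed
  then show ?thesis using assms by (auto simp: minimizing_def)
qed

lemma minimizing_exists:
  assumes "Cheeger M p f < \<infinity>"
  obtains fs where "minimizing M p fs f"
proof -
  have "\<forall>n. \<exists>g. g \<in> Lp M p \<inter> Lip M \<and> Lp_integral M p (\<lambda>x. g x - f x) < ennreal (1 / Suc n)
    \<and> Lp_integral M p (lip M g) < Cheeger M p f + ennreal (1 / Suc n)"
  proof
    fix n :: nat
    have "0 < 1 / real (Suc n)" by simp
    from Cheeger_approx[OF assms this] show "\<exists>g. g \<in> Lp M p \<inter> Lip M \<and> Lp_integral M p (\<lambda>x. g x - f x) < ennreal (1 / Suc n)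
        \<and> Lp_integral M p (lip M g) < Cheeger M p f + ennreal (1 / Suc n)"
      by metis
  qed
  then obtain fs where fs: "\<And>n. fs n \<in> Lp M p \<inter> Lip M"
    "\<And>n. Lp_integral M p (\<lambda>x. fs n x - f x) < ennreal (1 / Suc n)"
    "\<And>n. Lp_integral M p (lip M (fs n)) < Cheeger M p f + ennreal (1 / Suc n)"
    by metis
  have ev: "\<forall>\<^sub>F n in sequentially. ennreal (1 / Suc n) \<le> ennreal e" if "0 < e" for e
  proof -
    have "\<forall>\<^sub>F n in sequentially. 1 / real (Suc n) < e"
      using LIMSEQ_inverse_real_of_nat that by (intro order_tendstoD(2)) (auto simp: inverse_eq_divide)
    then show ?thesis by eventually_elim (auto intro: ennreal_leI)
  qed
  have "minimizing M p fs f"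
  proof (rule minimizingI)
    show "Lp_tendsto M p fs f"
      unfolding Lp_tendsto_iff
    proof (rule ennreal_tendsto_0I)
      fix e :: real assume "0 < e"
      from ev[OF this] show "\<forall>\<^sub>F n in sequentially. Lp_integral M p (\<lambda>x. fs n x - f x) \<le> ennreal e"
        by eventually_elim (rule order_trans[OF less_imp_le[OF fs(2)]])
    qed
    fix e :: real assume "0 < e"
    then show "\<forall>\<^sub>F n in sequentially. Lp_integral M p (lip M (fs n)) \<le> Cheeger M p f + ennreal e"
      by (intro eventually_mono[OF ev] order_trans[OF less_imp_le[OF fs(3)]] add_left_mono)
  qed (use fs assms in auto)
  then show thesis by (rule that)
qed

context borel_carrier
begin

text \<open>The slopes of the midpoints \<open>(fs n + gs n) / 2\<close> cannot have less energy in the limit, so the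
  uniform convexity of \<open>L\<^sup>p\<close> forces the slopes of the two sequences together.\<close>

lemma minimizing_lip_diff:
  assumes min: "minimizing M p fs f" "minimizing M p gs f"
    and "1 < p" "Cheeger M p f < \<infinity>" and [measurable]: "f \<in> borel_measurable M"
  shows "(\<lambda>n. Lp_integral M p (\<lambda>x. lip M (fs n) x - lip M (gs n) x)) \<longlonglongrightarrow> 0" (is "?D \<longlonglongrightarrow> 0")
proof -
  define c where "c = enn2real (Cheeger M p f)"
  have c: "0 \<le> c" "Cheeger M p f = ennreal c" using assms(4) by (auto simp: c_def)
  have fs: "fs n \<in> Lip M" "fs n \<in> Lp M p" and gs: "gs n \<in> Lip M" "gs n \<in> Lp M p" for n
    using min by (auto simp: minimizing_def)
  have [measurable]: "fs n \<in> borel_measurable M" "gs n \<in> borel_measurable M"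
    "lip M (fs n) \<in> borel_measurable M" "lip M (gs n) \<in> borel_measurable M" for n
    using fs gs by (auto intro: lip_measurable Lip_measurable)
  let ?A = "\<lambda>n. Lp_integral M p (lip M (fs n))" and ?B = "\<lambda>n. Lp_integral M p (lip M (gs n))"
  let ?Q = "\<lambda>n. Lp_integral M p (\<lambda>x. (lip M (fs n) x + lip M (gs n) x) / 2)"
  define ms where "ms n x = (fs n x + gs n x) / 2" for n x
  have mid: "\<bar>ms n x - ms n y\<bar> \<le> 1/2 * \<bar>fs n x - fs n y\<bar> + 1/2 * \<bar>gs n x - gs n y\<bar>" for n x y
    by (auto simp: ms_def abs_if field_simps)
  have ms: "ms n \<in> Lip M" for n
    by (rule Lip_comb[OF fs(1)[of n] gs(1)[of n] _ _ mid]) auto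
  have "ms n \<in> Lp M p" for n
  proof -
    have "Lp_integral M p (ms n) < \<infinity>"
      using fs(2)[of n] gs(2)[of n] assms(3)
      by (intro Lp_integral_add_finite[of "fs n" M "gs n" p "ms n"]) (auto simp: Lp_iff ms_def)
    then show ?thesis using ms Lip_measurable by (simp add: Lp_iff)
  qed
  moreover have "Lp_tendsto M p ms f"
  proof (rule Lp_tendsto_comb[of M p fs f gs f])
    fix n
    have "\<bar>ms n x - f x\<bar> \<le> \<bar>fs n x - f x\<bar> + \<bar>gs n x - f x\<bar>" for x
      by (auto simp: ms_def abs_if field_simps)
    then show "AE x in M. \<bar>ms n x - f x\<bar> \<le> \<bar>fs n x - f x\<bar> + \<bar>gs n x - f x\<bar>" by simp
  qed (use min assms(3) in \<open>simp_all add: minimizing_def\<close>)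
  ultimately have "Cheeger M p f \<le> liminf (\<lambda>n. Lp_integral M p (lip M (ms n)))"
    using ms by (intro Cheeger_le_liminf) auto
  moreover have "Lp_integral M p (lip M (ms n)) \<le> ?Q n" for n
  proof (rule Lp_integral_mono)
    fix x assume "x \<in> space M"
    then have "lip M (ms n) x \<le> 1/2 * lip M (fs n) x + 1/2 * lip M (gs n) x"
      by (intro lip_comb_le fs gs always_eventually allI mid) auto
    then show "\<bar>lip M (ms n) x\<bar> \<le> \<bar>(lip M (fs n) x + lip M (gs n) x) / 2\<bar>" by simp
  qed (use assms in auto)
  ultimately have Q: "ennreal c \<le> liminf ?Q"
    unfolding c(2) by (elim order_trans) (intro Liminf_mono always_eventually allI)
  show ?thesis
  proof (rule ennreal_tendsto_0I)
    fix \<eta> :: real assume \<eta>: "0 < \<eta>"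
    define e where "e = \<eta> / (4 * (c + 1))"
    have e: "0 < e" "2 * e * c \<le> \<eta> / 2" using c \<eta> by (auto simp: e_def field_simps)
    obtain K where K: "0 \<le> K" and conv: "\<And>a b. 0 \<le> a \<Longrightarrow> 0 \<le> b \<Longrightarrow>
       \<bar>a - b\<bar> powr p \<le> e * (a powr p + b powr p) + K * ((a powr p + b powr p) / 2 - ((a + b) / 2) powr p)"
      using powr_uniform_convex[OF e(1) assms(3)] by blast
    \<comment> \<open>The pointwise convexity inequality integrated, with the midpoint energy moved
      to the left so that nothing is subtracted in \<open>ennreal\<close>.\<close>
    have main: "?D n + ennreal K * ?Q n \<le> ennreal (e + K / 2) * (?A n + ?B n)" for n
    proof -
      have "?D n + ennreal K * ?Q n = (\<integral>\<^sup>+x. ennreal (\<bar>lip M (fs n) x - lip M (gs n) x\<bar> powr p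
          + K * ((lip M (fs n) x + lip M (gs n) x) / 2) powr p) \<partial>M)"
        unfolding Lp_integral_def using K
        by (simp add: nn_integral_add[symmetric] nn_integral_cmult[symmetric] ennreal_mult ennreal_plus)
      also have "\<dots> \<le> (\<integral>\<^sup>+x. ennreal ((e + K / 2) * (lip M (fs n) x powr p + lip M (gs n) x powr p)) \<partial>M)"
      proof (intro nn_integral_mono ennreal_leI)
        fix x
        show "\<bar>lip M (fs n) x - lip M (gs n) x\<bar> powr p + K * ((lip M (fs n) x + lip M (gs n) x) / 2) powr p
            \<le> (e + K / 2) * (lip M (fs n) x powr p + lip M (gs n) x powr p)"
          using conv[OF lip_nonneg lip_nonneg, of M "fs n" x M "gs n" x] by (simp add: field_simps)
      qed
      also have "\<dots> = ennreal (e + K / 2) * (?A n + ?B n)"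
        unfolding Lp_integral_def using K e
        by (simp add: nn_integral_add[symmetric] nn_integral_cmult[symmetric] ennreal_mult)
      finally show ?thesis .
    qed
    \<comment> \<open>With both energies below \<open>c + \<delta>\<close> and the midpoint energy
      at least \<open>c - \<delta>\<close>, the terms \<open>K * c\<close> cancel and
      \<open>2 * e * c + 2 * (e + K) * \<delta>\<close> remains. Since \<open>K\<close> depends on
      \<open>e\<close>, the choice of \<open>\<delta>\<close> comes last.\<close>
    define \<delta> where "\<delta> = \<eta> / (4 * (e + K))"
    have \<delta>: "0 < \<delta>" "2 * (e + K) * \<delta> \<le> \<eta> / 2" using e K \<eta> by (auto simp: \<delta>_def field_simps)
    have "\<forall>\<^sub>F n in sequentially. ?A n < ennreal (c + \<delta>)" "\<forall>\<^sub>F n in sequentially. ?B n < ennreal (c + \<delta>)"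
      using min c \<delta> by (auto simp: minimizing_def intro!: order_tendstoD(2) ennreal_lessI)
    moreover have "\<forall>\<^sub>F n in sequentially. ennreal (c - \<delta>) \<le> ?Q n"
    proof (cases "c - \<delta> < 0")
      case True then show ?thesis by (simp add: ennreal_neg)
    next
      case False
      then have "ennreal (c - \<delta>) < liminf ?Q"
        using \<delta> c by (intro less_le_trans[OF _ Q] ennreal_lessI) auto
      then show ?thesis by (auto dest!: less_LiminfD elim!: eventually_mono)
    qed
    ultimately show "\<forall>\<^sub>F n in sequentially. ?D n \<le> ennreal \<eta>"
    proof eventually_elim
      case (elim n)
      have "?D n + ennreal (K * (c - \<delta>)) \<le> ?D n + ennreal K * ?Q n"
        using elim K by (simp add: ennreal_mult' mult_left_mono)
      also have "\<dots> \<le> ennreal (e + K / 2) * (?A n + ?B n)" by (rule main)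
      also have "\<dots> \<le> ennreal (e + K / 2) * (ennreal (c + \<delta>) + ennreal (c + \<delta>))"
        using elim by (intro mult_left_mono add_mono) auto
      also have "\<dots> = ennreal ((e + K / 2) * (2 * (c + \<delta>)))"
        using c \<delta> e K by (simp add: ennreal_mult'[symmetric] ennreal_plus[symmetric] del: ennreal_plus)
      finally have le: "?D n + ennreal (K * (c - \<delta>)) \<le> ennreal ((e + K / 2) * (2 * (c + \<delta>)))" .
      moreover obtain D where D: "0 \<le> D" "?D n = ennreal D"
        using le by (cases "?D n") (auto simp: top_unique)
      moreover have "0 \<le> (e + K / 2) * (2 * (c + \<delta>))" using c \<delta> e K by simp
      ultimately have "D + K * (c - \<delta>) \<le> (e + K / 2) * (2 * (c + \<delta>))"
        by (cases "0 \<le> K * (c - \<delta>)") (auto simp: ennreal_plus[symmetric] ennreal_neg simp del: ennreal_plus)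
      then have "D \<le> 2 * e * c + 2 * (e + K) * \<delta>"
        by (simp add: algebra_simps)
      then show ?case using D e \<delta> by (auto intro!: ennreal_leI)
    qed
  qed
qed

lemma minimizing_subseq:
  assumes "minimizing M p fs f" "filterlim s at_top sequentially"
  shows "minimizing M p (\<lambda>n. fs (s n)) f"
  using assms filterlim_compose[OF _ assms(2), of "\<lambda>n. Lp_integral M p (lip M (fs n))"]
    filterlim_compose[OF _ assms(2), of "\<lambda>n. Lp_integral M p (\<lambda>x. fs n x - f x)"]
  by (auto simp: minimizing_def Lp_tendsto_iff)

text \<open>If the slopes were not Cauchy in \<open>L\<^sup>p\<close>, two subsequences would keep a
  fixed distance; but both are minimizing for the same \<open>f\<close>, so
  \<open>minimizing_lip_diff\<close> brings them together.\<close>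

lemma minimizing_lip_converges:
  assumes min: "minimizing M p fs f" and "1 < p" "Cheeger M p f < \<infinity>" and "f \<in> borel_measurable M"
  obtains H where "H \<in> Lp M p" "Lp_tendsto M p (\<lambda>n. lip M (fs n)) H" "Lp_integral M p H = Cheeger M p f"
proof -
  have fs: "fs n \<in> Lip M" for n using min by (auto simp: minimizing_def)
  have [measurable]: "lip M (fs n) \<in> borel_measurable M" for n
    using fs by (auto intro: lip_measurable)
  let ?I = "\<lambda>m n. Lp_integral M p (\<lambda>x. lip M (fs m) x - lip M (fs n) x)"
  have Cauchy: "\<exists>k. \<forall>m\<ge>k. \<forall>n\<ge>k. ?I m n \<le> ennreal e" if "0 < e" for e
  proof (rule ccontr)
    assume "\<not> ?thesis"
    then have "\<forall>k. \<exists>m n. k \<le> m \<and> k \<le> n \<and> ennreal e < ?I m n"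
      by (auto simp: not_le)
    then obtain s t where st: "\<And>k. k \<le> s k" "\<And>k. k \<le> t k" "\<And>k. ennreal e < ?I (s k) (t k)"
      by metis
    have "filterlim s at_top sequentially" "filterlim t at_top sequentially"
      by (rule filterlim_at_top_mono[OF filterlim_ident]; simp add: st)+
    then have "(\<lambda>k. ?I (s k) (t k)) \<longlonglongrightarrow> 0"
      by (intro minimizing_lip_diff[OF minimizing_subseq[OF min] minimizing_subseq[OF min]] assms)
    from eventually_happens'[OF sequentially_bot ennreal_tendsto_0D[OF this that]]
    obtain k where "?I (s k) (t k) < ennreal e" ..
    with st(3)[of k] show False by simp
  qed
  obtain H where H: "H \<in> borel_measurable M" "Lp_tendsto M p (\<lambda>n. lip M (fs n)) H"
    using Lp_complete[of "\<lambda>n. lip M (fs n)" M p, OF _ _ Cauchy] assms(2) by auto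
  have energy: "(\<lambda>n. Lp_integral M p (lip M (fs n))) \<longlonglongrightarrow> Cheeger M p f"
    using min by (simp add: minimizing_def)
  have "H \<in> Lp M p"
  proof -
    have "\<forall>\<^sub>F n in sequentially. Lp_integral M p (lip M (fs n)) < \<infinity>"
      using energy assms(3) by (intro order_tendstoD(2)) auto
    moreover have "\<forall>\<^sub>F n in sequentially. Lp_integral M p (\<lambda>x. lip M (fs n) x - H x) < ennreal 1"
      using H(2) by (intro ennreal_tendsto_0D) (auto simp: Lp_tendsto_iff)
    ultimately have "\<forall>\<^sub>F n in sequentially. Lp_integral M p H < \<infinity>"
    proof eventually_elim
      case (elim n)
      have "Lp_integral M p (\<lambda>x. lip M (fs n) x - H x) < \<infinity>"
        using less_trans[OF elim(2) ennreal_less_top] by simp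
      moreover have "\<bar>H x\<bar> \<le> \<bar>lip M (fs n) x\<bar> + \<bar>lip M (fs n) x - H x\<bar>" for x
        by linarith
      ultimately show ?case
        using Lp_integral_add_finite[of "lip M (fs n)" M "\<lambda>x. lip M (fs n) x - H x" p H] elim(1) H(1) assms(2)
        by simp
    qed
    then show ?thesis using H(1) by (simp add: Lp_iff)
  qed
  moreover from this have "(\<lambda>n. Lp_integral M p (lip M (fs n))) \<longlonglongrightarrow> Lp_integral M p H"
    using assms(2) H(2) by (intro Lp_tendsto_Lp_integral) auto
  ultimately show thesis using that[OF _ H(2)] LIMSEQ_unique[OF energy] by simp
qed

section \<open>Minimal weak upper gradients and their energy\<close>

lemma weak_upper_gradientD:
  assumes "weak_upper_gradient M p f G" "1 < p"
  obtains fs H where "\<And>n. fs n \<in> Lp M p \<inter> Lip M" "Lp_tendsto M p fs f"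
    "H \<in> Lp M p" "Lp_tendsto M p (\<lambda>n. lip M (fs n)) H" "AE x in M. \<bar>H x\<bar> \<le> G x"
    "(\<lambda>n. Lp_integral M p (lip M (fs n))) \<longlonglongrightarrow> Lp_integral M p H"
    "Cheeger M p f \<le> Lp_integral M p H"
proof -
  obtain fs H where fs: "\<And>n. fs n \<in> Lp M p \<inter> Lip M" "Lp_tendsto M p fs f" and
    H: "H \<in> Lp M p" "Lp_tendsto M p (\<lambda>n. lip M (fs n)) H" "AE x in M. H x \<le> G x" and G: "\<And>x. 0 \<le> G x"
    using assms(1) unfolding weak_upper_gradient_def by metis
  have [measurable]: "H \<in> borel_measurable M" "lip M (fs n) \<in> borel_measurable M" for n
    using H fs by (auto simp: Lp_iff intro: lip_measurable)
  \<comment> \<open>The definition bounds \<open>H\<close> only from above by \<open>G\<close>. The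
    positive part is still the limit of the nonnegative slopes, and its absolute value is bounded by
    \<open>G\<close>.\<close>
  define H' where "H' x = max (H x) 0" for x
  have [measurable]: "H' \<in> borel_measurable M" unfolding H'_def[abs_def] by measurable
  have H': "H' \<in> Lp M p"
    using H(1) le_less_trans[OF Lp_integral_mono[of M H' H p]] assms(2) by (simp add: Lp_iff H'_def)
  have conv: "Lp_tendsto M p (\<lambda>n. lip M (fs n)) H'"
  proof (rule Lp_tendsto_comb[OF H(2) H(2)])
    fix n
    have "\<bar>lip M (fs n) x - H' x\<bar> \<le> \<bar>lip M (fs n) x - H x\<bar> + \<bar>lip M (fs n) x - H x\<bar>" for x
      using lip_nonneg[of M "fs n" x] unfolding H'_def max_def
      by (cases "H x \<le> 0"; simp only: if_True if_False; linarith)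
    then show "AE x in M. \<bar>lip M (fs n) x - H' x\<bar> \<le> \<bar>lip M (fs n) x - H x\<bar> + \<bar>lip M (fs n) x - H x\<bar>"
      by simp
  qed (use assms(2) in simp_all)
  have lim: "(\<lambda>n. Lp_integral M p (lip M (fs n))) \<longlonglongrightarrow> Lp_integral M p H'"
    using assms H' conv by (intro Lp_tendsto_Lp_integral) auto
  have "AE x in M. \<bar>H' x\<bar> \<le> G x"
    using H(3) by eventually_elim (use G in \<open>auto simp: H'_def\<close>)
  moreover have "Cheeger M p f \<le> Lp_integral M p H'"
    using Cheeger_le_liminf[OF fs] lim_imp_Liminf[OF sequentially_bot lim] by simp
  ultimately show thesis
    using that[OF fs H' conv _ lim] by simp
qed

text \<open>Every weak upper gradient has energy at least \<open>Cheeger M p f\<close>, by lower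
  semicontinuity along its own sequence. The limit of the slopes of a minimizing sequence attains
  this bound, so the choice operator has a witness and every minimizer has this energy.\<close>

lemma minimal_weak_upper_gradient:
  assumes "f \<in> W1p M p" "1 < p"
  defines "G \<equiv> minimal_weak_upper_gradient M p f"
  shows "weak_upper_gradient M p f G" "Lp_integral M p G = Cheeger M p f"
proof -
  have f: "f \<in> borel_measurable M" "Cheeger M p f < \<infinity>"
    using assms by (auto simp: W1p_def Lp_iff)
  have eq: "(\<integral>\<^sup>+x. ennreal (G' x powr p) \<partial>M) = Lp_integral M p G'" if "weak_upper_gradient M p f G'" for G'
    using that by (simp add: weak_upper_gradient_def Lp_integral_def)
  have low: "Cheeger M p f \<le> Lp_integral M p G'" if G': "weak_upper_gradient M p f G'" for G'
  proof -
    obtain H where H: "Cheeger M p f \<le> Lp_integral M p H" "AE x in M. \<bar>H x\<bar> \<le> G' x"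
      by (rule weak_upper_gradientD[OF G' assms(2)])
    have "Lp_integral M p H \<le> Lp_integral M p G'"
      using H(2) assms by (intro Lp_integral_mono_AE) auto
    then show ?thesis using H by simp
  qed
  obtain fs where min: "minimizing M p fs f" using minimizing_exists[OF f(2)] .
  obtain H where H: "H \<in> Lp M p" "Lp_tendsto M p (\<lambda>n. lip M (fs n)) H" "Lp_integral M p H = Cheeger M p f"
    using minimizing_lip_converges[OF min assms(2) f(2,1)] .
  have wug: "weak_upper_gradient M p f (\<lambda>x. \<bar>H x\<bar>)"
    unfolding weak_upper_gradient_def using H min
    by (auto simp: Lp_iff minimizing_def Lp_integral_def intro!: exI[of _ fs] bexI[of _ H])
  have val: "Lp_integral M p (\<lambda>x. \<bar>H x\<bar>) = Cheeger M p f"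
    using H(3) by (simp add: Lp_integral_def)
  have "weak_upper_gradient M p f G \<and> (\<forall>G'. weak_upper_gradient M p f G' \<longrightarrow>
           (\<integral>\<^sup>+x. ennreal (G x powr p) \<partial>M) \<le> (\<integral>\<^sup>+x. ennreal (G' x powr p) \<partial>M))"
    unfolding G_def minimal_weak_upper_gradient_def
    by (rule someI[of _ "\<lambda>x. \<bar>H x\<bar>"]) (use wug val low eq in auto)
  then show "weak_upper_gradient M p f G" "Lp_integral M p G = Cheeger M p f"
    using wug val low eq by (auto intro!: antisym)
qed

text \<open>The Lipschitz sequence behind the minimal gradient turns out to be minimizing as well.
  By \<open>minimizing_lip_diff\<close> its slopes have the same limit \<open>H\<close> as those of
  \<open>fs\<close>, which vanish off \<open>A\<close>. So \<open>H\<close> is carried by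
  \<open>A\<close>, has the full energy and lies below the gradient.\<close>

lemma minimal_weak_upper_gradient_local:
  assumes "f \<in> W1p M p" "1 < p" "minimizing M p fs f" "A \<in> sets M"
    and zero: "\<And>n x. x \<in> space M - A \<Longrightarrow> lip M (fs n) x = 0"
  shows "Cheeger M p f \<le> (\<integral>\<^sup>+x\<in>A. ennreal (minimal_weak_upper_gradient M p f x powr p) \<partial>M)"
proof -
  define G where "G = minimal_weak_upper_gradient M p f"
  have f [measurable]: "f \<in> borel_measurable M" and fin: "Cheeger M p f < \<infinity>"
    using assms by (auto simp: W1p_def Lp_iff)
  note G = minimal_weak_upper_gradient[OF assms(1,2), folded G_def]
  obtain gs H where gs: "\<And>n. gs n \<in> Lp M p \<inter> Lip M" "Lp_tendsto M p gs f" and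
    H: "H \<in> Lp M p" "Lp_tendsto M p (\<lambda>n. lip M (gs n)) H" "AE x in M. \<bar>H x\<bar> \<le> G x"
    "(\<lambda>n. Lp_integral M p (lip M (gs n))) \<longlonglongrightarrow> Lp_integral M p H" "Cheeger M p f \<le> Lp_integral M p H"
    by (rule weak_upper_gradientD[OF G(1) assms(2)], rule that, assumption+)
  have fs: "fs n \<in> Lp M p \<inter> Lip M" for n using assms by (auto simp: minimizing_def)
  have [measurable]: "H \<in> borel_measurable M" "lip M (fs n) \<in> borel_measurable M" "lip M (gs n) \<in> borel_measurable M"
     "G \<in> borel_measurable M" for n
    using H(1) fs gs(1) G(1) by (auto simp: Lp_iff weak_upper_gradient_def intro: lip_measurable)
  note [measurable] = assms(4)
  have "Lp_integral M p H \<le> Lp_integral M p G"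
    using H(3) assms by (intro Lp_integral_mono_AE) auto
  then have eqH: "Lp_integral M p H = Cheeger M p f"
    using H(5) G(2) by simp
  then have "minimizing M p gs f"
    using gs H by (auto simp: minimizing_def)
  then have "Lp_tendsto M p (\<lambda>n x. lip M (gs n) x - lip M (fs n) x) (\<lambda>x. 0)"
    using minimizing_lip_diff[OF _ assms(3,2) fin f] by (auto simp: Lp_tendsto_iff)
  from this H(2) have "Lp_tendsto M p (\<lambda>n. lip M (fs n)) H"
    by (rule Lp_tendsto_comb) (use assms(2) in auto)
  then have lim: "(\<lambda>n. Lp_integral M p (\<lambda>x. lip M (fs n) x - H x)) \<longlonglongrightarrow> 0"
    by (simp add: Lp_tendsto_iff)
  let ?R = "\<integral>\<^sup>+x\<in>space M - A. ennreal (\<bar>H x\<bar> powr p) \<partial>M"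
  have "?R \<le> Lp_integral M p (\<lambda>x. lip M (fs n) x - H x)" for n
    unfolding Lp_integral_def by (intro nn_integral_mono) (auto simp: zero indicator_def)
  then have R: "?R = 0"
    using LIMSEQ_le_const[OF lim, of ?R] by auto
  have "Cheeger M p f = (\<integral>\<^sup>+x. ennreal (\<bar>H x\<bar> powr p) * indicator A x + ennreal (\<bar>H x\<bar> powr p) * indicator (space M - A) x \<partial>M)"
    unfolding eqH[symmetric] Lp_integral_def by (intro nn_integral_cong) (auto simp: indicator_def)
  also have "\<dots> = (\<integral>\<^sup>+x\<in>A. ennreal (\<bar>H x\<bar> powr p) \<partial>M)"
    by (subst nn_integral_add) (auto simp: R)
  also have "\<dots> \<le> (\<integral>\<^sup>+x\<in>A. ennreal (G x powr p) \<partial>M)"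
  proof (intro nn_integral_mono_AE, use H(3) in eventually_elim)
    case (elim x)
    then have "\<bar>H x\<bar> powr p \<le> G x powr p" using assms(2) by (intro powr_mono2) auto
    then show ?case by (intro mult_right_mono ennreal_leI) auto
  qed
  finally show ?thesis by (simp add: G_def)
qed

end

section \<open>Approximation by Lipschitz functions supported in the domain\<close>

text \<open>The factor of the main term stays close to 1, so that the energy of an optimal
  approximation survives the cutoff in the limit; the crude factor \<open>2 powr p\<close> of
  \<open>Lp_integral_add_le\<close> would spoil the sharp constant.\<close>

lemma Lp_integral_perturb:
  assumes "0 < e" "0 < p"
  obtains K where "0 < K"
    "\<And>f g h. f \<in> borel_measurable M \<Longrightarrow> g \<in> borel_measurable M \<Longrightarrow>
       (\<And>x. x \<in> space M \<Longrightarrow> \<bar>h x\<bar> \<le> \<bar>f x\<bar> + \<bar>g x\<bar>) \<Longrightarrow>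
       Lp_integral M p h \<le> ennreal (1 + e) * Lp_integral M p f + ennreal K * Lp_integral M p g"
proof -
  obtain K where K: "0 < K"
    "\<And>a b. 0 \<le> a \<Longrightarrow> 0 \<le> b \<Longrightarrow> \<bar>a powr p - b powr p\<bar> \<le> e * b powr p + K * \<bar>a - b\<bar> powr p"
    using powr_diff_bound[OF assms] by blast
  show thesis
  proof (rule that[OF K(1)])
    fix f g h :: "'a \<Rightarrow> real"
    assume [measurable]: "f \<in> borel_measurable M" "g \<in> borel_measurable M"
      and le: "\<And>x. x \<in> space M \<Longrightarrow> \<bar>h x\<bar> \<le> \<bar>f x\<bar> + \<bar>g x\<bar>"
    have "Lp_integral M p h \<le> (\<integral>\<^sup>+x. ennreal (1 + e) * ennreal (\<bar>f x\<bar> powr p) + ennreal K * ennreal (\<bar>g x\<bar> powr p) \<partial>M)"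
      unfolding Lp_integral_def
    proof (rule nn_integral_mono)
      fix x assume x: "x \<in> space M"
      have "\<bar>h x\<bar> powr p \<le> (\<bar>f x\<bar> + \<bar>g x\<bar>) powr p"
        using le[OF x] assms by (intro powr_mono2) auto
      also have "\<dots> \<le> (1 + e) * \<bar>f x\<bar> powr p + K * \<bar>g x\<bar> powr p"
        using K(2)[of "\<bar>f x\<bar> + \<bar>g x\<bar>" "\<bar>f x\<bar>"] by (simp add: algebra_simps abs_le_iff)
      finally show "ennreal (\<bar>h x\<bar> powr p) \<le> ennreal (1 + e) * ennreal (\<bar>f x\<bar> powr p) + ennreal K * ennreal (\<bar>g x\<bar> powr p)"
        using assms K(1) by (simp add: ennreal_mult[symmetric] ennreal_plus[symmetric] ennreal_leI del: ennreal_plus)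
    qed
    then show "Lp_integral M p h \<le> ennreal (1 + e) * Lp_integral M p f + ennreal K * Lp_integral M p g"
      by (simp add: Lp_integral_def nn_integral_add nn_integral_cmult)
  qed
qed

lemma Lipschitz_cutoff:
  fixes F \<Omega> :: "'a::metric_space set"
  assumes "compact F" "open \<Omega>" "F \<subseteq> \<Omega>"
  shows "\<exists>\<psi> L. 0 \<le> L \<and> (\<forall>x y. \<bar>\<psi> x - \<psi> y\<bar> \<le> L * dist x y) \<and> (\<forall>x. 0 \<le> \<psi> x \<and> \<psi> x \<le> (1::real)) \<and>
    (\<forall>x\<in>F. \<forall>\<^sub>F y in nhds x. \<psi> y = 1) \<and> (\<forall>x. x \<notin> \<Omega> \<longrightarrow> (\<forall>\<^sub>F y in nhds x. \<psi> y = 0))"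
proof (cases "F = {}")
  case True
  then show ?thesis by (intro exI[of _ "\<lambda>_. 0"] exI[of _ 0]) auto
next
  case False
  obtain e where e: "0 < e" "(\<Union>x\<in>F. ball x e) \<subseteq> \<Omega>"
    using compact_subset_open_imp_ball_epsilon_subset[OF assms] by auto
  \<comment> \<open>The value is 1 up to distance \<open>e / 3\<close> from \<open>F\<close> and 0
    from distance \<open>2 * e / 3\<close> on. The margins make the cutoff locally constant at
    points of \<open>F\<close> and off \<Omega>, so that slopes and not only values are under
    control there.\<close>
  define \<psi> where "\<psi> x = min 1 (max 0 (2 - 3 / e * infdist x F))" for x
  have lim: "((\<lambda>y. infdist y F) \<longlongrightarrow> infdist x F) (nhds x)" for x
    by (intro tendsto_infdist filterlim_ident)
  show ?thesis
  proof (intro exI[of _ \<psi>] exI[of _ "3 / e"] conjI allI ballI impI)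
    fix x y
    have "\<bar>infdist x F - infdist y F\<bar> \<le> dist x y"
      using infdist_triangle[of x F y] infdist_triangle[of y F x] by (simp add: dist_commute)
    then have "3 / e * \<bar>infdist x F - infdist y F\<bar> \<le> 3 / e * dist x y"
      using e by (intro mult_left_mono) auto
    moreover have "3 / e * \<bar>infdist x F - infdist y F\<bar> = \<bar>3 / e * infdist x F - 3 / e * infdist y F\<bar>"
      using e by (simp add: abs_mult right_diff_distrib[symmetric] del: times_divide_eq_left)
    ultimately show "\<bar>\<psi> x - \<psi> y\<bar> \<le> 3 / e * dist x y"
      unfolding \<psi>_def by linarith
  next
    fix x assume "x \<in> F"
    then have "infdist x F = 0" by simp
    then have "\<forall>\<^sub>F y in nhds x. infdist y F < e / 3"
      using e by (intro order_tendstoD(2)[OF lim]) auto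
    then show "\<forall>\<^sub>F y in nhds x. \<psi> y = 1"
      by eventually_elim (use e in \<open>auto simp: \<psi>_def field_simps\<close>)
  next
    fix x assume "x \<notin> \<Omega>"
    then have "e \<le> dist x a" if "a \<in> F" for a
      using e that by (force simp: dist_commute)
    then have "e \<le> infdist x F"
      using False by (auto simp: infdist_def intro!: cINF_greatest)
    then have "\<forall>\<^sub>F y in nhds x. 2 * e / 3 < infdist y F"
      using e by (intro order_tendstoD(1)[OF lim]) auto
    then show "\<forall>\<^sub>F y in nhds x. \<psi> y = 0"
      by eventually_elim (use e in \<open>auto simp: \<psi>_def field_simps\<close>)
  qed (use e in \<open>auto simp: \<psi>_def\<close>)
qed

context borel_carrier
begin

lemma minimizing_diff:
  assumes "minimizing M p fs f" "minimizing M p gs g" "1 < p"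
    and [measurable]: "f \<in> borel_measurable M" "g \<in> borel_measurable M"
  shows "(\<lambda>x. fs n x - gs n x) \<in> Lp M p \<inter> Lip M"
    and "Lp_tendsto M p (\<lambda>n x. fs n x - gs n x) (\<lambda>x. f x - g x)"
    and "x \<in> space M \<Longrightarrow> lip M (\<lambda>x. fs n x - gs n x) x \<le> lip M (fs n) x + lip M (gs n) x"
proof -
  have fs: "fs n \<in> Lp M p" "fs n \<in> Lip M" and gs: "gs n \<in> Lp M p" "gs n \<in> Lip M" for n
    using assms(1,2) by (simp_all add: minimizing_def)
  have [measurable]: "fs n \<in> borel_measurable M" "gs n \<in> borel_measurable M" for n
    using fs gs by (simp_all add: Lp_iff)
  have diff: "\<bar>(fs n x - gs n x) - (fs n y - gs n y)\<bar> \<le> 1 * \<bar>fs n x - fs n y\<bar> + 1 * \<bar>gs n x - gs n y\<bar>" for n x y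
    by (auto simp: abs_if)
  show "(\<lambda>x. fs n x - gs n x) \<in> Lp M p \<inter> Lip M"
    using Lp_diff[OF fs(1)[of n] gs(1)[of n]] Lip_comb[OF fs(2)[of n] gs(2)[of n] _ _ diff] assms(3) by simp
  show "lip M (\<lambda>x. fs n x - gs n x) x \<le> lip M (fs n) x + lip M (gs n) x" if "x \<in> space M"
    using lip_comb_le[OF fs(2)[of n] gs(2)[of n] that, of 1 1 "\<lambda>x. fs n x - gs n x"] diff by simp
  show "Lp_tendsto M p (\<lambda>n x. fs n x - gs n x) (\<lambda>x. f x - g x)"
  proof (rule Lp_tendsto_comb[of M p fs f gs g])
    fix n
    have "\<bar>fs n x - gs n x - (f x - g x)\<bar> \<le> \<bar>fs n x - f x\<bar> + \<bar>gs n x - g x\<bar>" for x by linarith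
    then show "AE x in M. \<bar>fs n x - gs n x - (f x - g x)\<bar> \<le> \<bar>fs n x - f x\<bar> + \<bar>gs n x - g x\<bar>" by simp
  qed (use assms in \<open>simp_all add: minimizing_def\<close>)
qed

text \<open>It makes \<open>W1p_norm\<close> of the difference \<open>u - g\<close> meaningful: an
  infinite energy would be mapped to 0 by \<open>enn2real\<close>, and a small norm would then say
  nothing.\<close>

lemma Cheeger_diff_finite:
  assumes "Cheeger M p f < \<infinity>" "Cheeger M p g < \<infinity>" "1 < p" "f \<in> borel_measurable M" "g \<in> borel_measurable M"
  shows "Cheeger M p (\<lambda>x. f x - g x) < \<infinity>"
proof -
  obtain fs where fs: "minimizing M p fs f" using minimizing_exists[OF assms(1)] .
  obtain gs where gs: "minimizing M p gs g" using minimizing_exists[OF assms(2)] .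
  note diff = minimizing_diff[OF fs gs assms(3-5)]
  have [measurable]: "lip M (fs n) \<in> borel_measurable M" "lip M (gs n) \<in> borel_measurable M" for n
    using fs gs by (auto simp: minimizing_def intro: lip_measurable)
  let ?E = "\<lambda>n. ennreal (2 powr p) * (Lp_integral M p (lip M (fs n)) + Lp_integral M p (lip M (gs n)))"
  have "Lp_integral M p (lip M (\<lambda>x. fs n x - gs n x)) \<le> ?E n" for n
    using assms(3) diff(3) by (intro Lp_integral_add_le AE_I2) auto
  then have "Cheeger M p (\<lambda>x. f x - g x) \<le> liminf ?E"
    by (intro order_trans[OF Cheeger_le_liminf[OF diff(1,2)]] Liminf_mono always_eventually allI)
  also have "?E \<longlonglongrightarrow> ennreal (2 powr p) * (Cheeger M p f + Cheeger M p g)"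
    using fs gs by (intro ennreal_tendsto_cmult tendsto_add) (auto simp: minimizing_def)
  then have "liminf ?E = ennreal (2 powr p) * (Cheeger M p f + Cheeger M p g)"
    by (rule lim_imp_Liminf[OF sequentially_bot])
  also have "\<dots> < \<infinity>"
    using assms(1,2) by (simp add: ennreal_mult_less_top)
  finally show ?thesis .
qed

end

locale metric_measure =
  fixes M :: "'a::polish_space measure"
  assumes mms: "metric_measure_space M"
begin

lemma sets_M: "sets M = sets borel" and space_M [simp]: "space M = UNIV"
  using mms sets_eq_imp_space_eq[of M borel] by (auto simp: metric_measure_space_def)

sublocale borel_carrier M
  by standard (simp add: sets_M)

lemma finite_bounded: "B \<in> sets M \<Longrightarrow> bounded B \<Longrightarrow> emeasure M B < \<infinity>"
  using mms by (auto simp: metric_measure_space_def)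

text \<open>The support is compact, hence bounded and of finite measure, so bounded functions
  carried by it are integrable. Off the support \<open>g\<close> vanishes locally, so its slope is 0
  there too.\<close>

lemma Lip_compact_supp_W1p:
  assumes "g \<in> Lip_compact_supp M \<Omega>" "1 < p"
  shows "g \<in> W1p M p"
proof -
  define F where "F = closure {x. g x \<noteq> 0}"
  have g: "g \<in> Lip M" "compact F" using assms by (auto simp: Lip_compact_supp_def F_def)
  note [measurable] = Lip_measurable[OF g(1)] lip_measurable[OF g(1)]
  have F [measurable]: "F \<in> sets M" unfolding sets_M using g by (simp add: compact_imp_closed borel_closed)
  have fin: "emeasure M F < \<infinity>" using g F by (intro finite_bounded) (auto simp: compact_imp_bounded)
  have supp: "g x = 0" "lip M g x = 0" if "x \<notin> F" for x
  proof -
    show 0: "g x = 0" using that closure_subset[of "{x. g x \<noteq> 0}"] by (auto simp: F_def)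
    have "\<forall>\<^sub>F y in at x. y \<in> - F"
      using that by (intro eventually_at_in_open') (auto simp: F_def)
    then show "lip M g x = 0"
      unfolding space_M[symmetric]
      by (intro lip_eq_0, eventually_elim) (use 0 closure_subset[of "{x. g x \<noteq> 0}"] in \<open>auto simp: F_def\<close>)
  qed
  have bound: "Lp_integral M p h < \<infinity>" if "\<And>x. x \<notin> F \<Longrightarrow> h x = 0" "\<And>x. x \<in> F \<Longrightarrow> \<bar>h x\<bar> \<le> B" for h B
  proof -
    have "Lp_integral M p h \<le> (\<integral>\<^sup>+x. ennreal (B powr p) * indicator F x \<partial>M)"
      unfolding Lp_integral_def
      by (intro nn_integral_mono) (use that assms(2) in \<open>auto simp: indicator_def intro!: ennreal_leI powr_mono2\<close>)
    also have "\<dots> < \<infinity>"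
      using fin by (simp add: nn_integral_cmult_indicator ennreal_mult_less_top)
    finally show ?thesis .
  qed
  obtain L where L: "0 \<le> L" "\<And>x y. x \<in> space M \<Longrightarrow> y \<in> space M \<Longrightarrow> \<bar>g x - g y\<bar> \<le> L * dist x y"
    using Lip_E[OF g(1)] by blast
  have "bounded (g ` F)"
    using g(2) Lip_continuous[OF g(1)]
    by (intro compact_imp_bounded compact_continuous_image) (auto intro: continuous_on_subset)
  then obtain B where "\<And>x. x \<in> F \<Longrightarrow> \<bar>g x\<bar> \<le> B"
    by (auto simp: bounded_iff)
  then have gp: "g \<in> Lp M p" using bound[of g B] supp by (simp add: Lp_iff)
  have "Lp_integral M p (lip M g) < \<infinity>"
    using supp lip_le_Lipschitz[OF L] by (intro bound[of _ L]) auto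
  moreover have "Cheeger M p g \<le> Lp_integral M p (lip M g)"
    using Cheeger_le_liminf[of "\<lambda>_. g" M p g] gp g assms(2)
    by (simp add: Lp_tendsto_iff Lp_integral_def Liminf_const)
  ultimately show ?thesis using gp by (simp add: W1p_def)
qed

lemma W1p_0_approx:
  assumes "u \<in> W1p_0 M p \<Omega>" "1 < p" "0 < \<delta>"
  obtains g where "g \<in> Lip_compact_supp M \<Omega>" "g \<in> W1p M p"
    "Lp_integral M p (\<lambda>x. u x - g x) < ennreal \<delta>" "Cheeger M p (\<lambda>x. u x - g x) < ennreal \<delta>"
proof -
  obtain g where g: "g \<in> Lip_compact_supp M \<Omega>" "W1p_norm M p (\<lambda>x. u x - g x) < \<delta> powr (1 / p)"
    using assms by (auto simp: W1p_0_def dest!: spec[of _ "\<delta> powr (1 / p)"])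
  have gW: "g \<in> W1p M p" by (rule Lip_compact_supp_W1p[OF g(1) assms(2)])
  have u: "u \<in> W1p M p" using assms by (simp add: W1p_0_def)
  have "(\<lambda>x. u x - g x) \<in> Lp M p" "Cheeger M p (\<lambda>x. u x - g x) < \<infinity>"
    using u gW assms(2) Lp_diff[of u M p g] Cheeger_diff_finite[of p u g] by (simp_all add: W1p_def Lp_iff)
  then obtain a b where ab: "0 \<le> a" "0 \<le> b" "Lp_integral M p (\<lambda>x. u x - g x) = ennreal a" "Cheeger M p (\<lambda>x. u x - g x) = ennreal b"
    unfolding Lp_iff by (cases "Lp_integral M p (\<lambda>x. u x - g x)"; cases "Cheeger M p (\<lambda>x. u x - g x)") auto
  have "(a + b) powr (1 / p) < \<delta> powr (1 / p)"
    using g(2) ab unfolding W1p_norm_def Lp_integral_def[symmetric] by (simp add: ennreal_plus[symmetric] del: ennreal_plus)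
  then have "a + b < \<delta>"
    using powr_less_cancel_iff assms(2,3) powr_mono2[of "1 / p" \<delta> "a + b"] by (cases "a + b < \<delta>") auto
  then show thesis using that[OF g(1) gW] ab by (simp add: ennreal_less_iff)
qed

text \<open>Let \<open>fs\<close> be minimizing for \<open>u\<close> and \<open>hs\<close> for
  \<open>u - g\<close>. Their difference \<open>q\<close> tends to \<open>g\<close>, and its slope
  exceeds that of \<open>fs\<close> at most by that of \<open>hs\<close>, whose energy is small. Now
  \<open>q n\<close> is truncated and multiplied by a cutoff which is 1 near the support
  \<open>F\<close> of \<open>g\<close>. Off \<open>F\<close> one has \<open>g = 0\<close>, so the
  extra term of the product rule is at most \<open>L * \<bar>q n x - g x\<bar>\<close>, an
  approximation error.\<close>

lemma W1p_0_Lipschitz_approx: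
  assumes u: "u \<in> W1p_0 M p \<Omega>" and nonneg: "AE x in M. 0 \<le> u x" and "open \<Omega>" "1 < p" "0 < \<epsilon>"
  obtains v S where "v \<in> Lip M" "\<And>x. 0 \<le> v x" "\<And>x. v x \<le> S" "\<And>x. x \<notin> \<Omega> \<Longrightarrow> v x = 0"
    "\<And>x. x \<notin> \<Omega> \<Longrightarrow> lip M v x = 0" "Lp_integral M p (\<lambda>x. v x - u x) \<le> ennreal \<epsilon>"
    "Lp_integral M p (lip M v) \<le> Cheeger M p u + ennreal \<epsilon>"
proof -
  have p0: "0 < p" using assms(4) by simp
  have uW: "u \<in> W1p M p" using u by (simp add: W1p_0_def)
  then have [measurable]: "u \<in> borel_measurable M" and uC: "Cheeger M p u < \<infinity>"
    by (auto simp: W1p_def Lp_iff)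
  obtain c where c: "0 \<le> c" "Cheeger M p u = ennreal c" using uC by (cases "Cheeger M p u") auto
  define e where "e = \<epsilon> / (4 * (c + 1))"
  have e: "0 < e" "e * c \<le> \<epsilon> / 4" using c assms by (auto simp: e_def field_simps)
  obtain K where K: "0 < K"
    "\<And>f g h. f \<in> borel_measurable M \<Longrightarrow> g \<in> borel_measurable M \<Longrightarrow>
       (\<And>x. x \<in> space M \<Longrightarrow> \<bar>h x\<bar> \<le> \<bar>f x\<bar> + \<bar>g x\<bar>) \<Longrightarrow>
       Lp_integral M p h \<le> ennreal (1 + e) * Lp_integral M p f + ennreal K * Lp_integral M p g"
    using Lp_integral_perturb[OF e(1) p0, where M = M] by blast
  define T where "T = 2 powr p"
  have T: "0 < T" by (simp add: T_def)
  define \<delta> where "\<delta> = min (\<epsilon> / (4 * (K * T))) (\<epsilon> / (2 * T))"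
  have \<delta>: "0 < \<delta>" using K T assms by (simp add: \<delta>_def)
  have \<delta>1: "K * T * \<delta> \<le> \<epsilon> / 4" "T * \<delta> \<le> \<epsilon> / 2"
  proof -
    have "K * T * \<delta> \<le> K * T * (\<epsilon> / (4 * (K * T)))" "T * \<delta> \<le> T * (\<epsilon> / (2 * T))"
      using K T by (intro mult_left_mono; simp add: \<delta>_def)+
    then show "K * T * \<delta> \<le> \<epsilon> / 4" "T * \<delta> \<le> \<epsilon> / 2" using K T by auto
  qed
  obtain g where g: "g \<in> Lip_compact_supp M \<Omega>" and gW: "g \<in> W1p M p" and
    gu: "Lp_integral M p (\<lambda>x. u x - g x) < ennreal \<delta>" "Cheeger M p (\<lambda>x. u x - g x) < ennreal \<delta>"
    using W1p_0_approx[OF u assms(4) \<delta>] .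
  have [measurable]: "g \<in> borel_measurable M" using gW by (simp add: W1p_def Lp_iff)
  define F where "F = closure {x. g x \<noteq> 0}"
  have F: "g \<in> Lip M" "compact F" "F \<subseteq> \<Omega>" using g by (auto simp: Lip_compact_supp_def F_def)
  have gF: "g x = 0" if "x \<notin> F" for x
    using that closure_subset[of "{x. g x \<noteq> 0}"] by (auto simp: F_def)
  have "bounded (g ` F)"
    using F(2) Lip_continuous[OF F(1)]
    by (intro compact_imp_bounded compact_continuous_image) (auto intro: continuous_on_subset)
  then obtain S0 where S0: "\<And>x. x \<in> F \<Longrightarrow> \<bar>g x\<bar> \<le> S0"
    by (auto simp: bounded_iff)
  define S where "S = max S0 0"
  have S: "0 \<le> S" "\<And>x. \<bar>g x\<bar> \<le> S"
  proof -
    show "0 \<le> S" by (simp add: S_def)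
    show "\<bar>g x\<bar> \<le> S" for x
      using S0[of x] gF[of x] by (cases "x \<in> F") (auto simp: S_def)
  qed
  obtain \<psi> L where \<psi>_all: "0 \<le> L \<and> (\<forall>x y. \<bar>\<psi> x - \<psi> y\<bar> \<le> L * dist x y) \<and> (\<forall>x. 0 \<le> \<psi> x \<and> \<psi> x \<le> (1::real)) \<and>
    (\<forall>x\<in>F. \<forall>\<^sub>F y in nhds x. \<psi> y = 1) \<and> (\<forall>x. x \<notin> \<Omega> \<longrightarrow> (\<forall>\<^sub>F y in nhds x. \<psi> y = 0))"
    using Lipschitz_cutoff[OF F(2) assms(3) F(3)] by (elim exE)
  then have L: "0 \<le> L" "\<And>x y. \<bar>\<psi> x - \<psi> y\<bar> \<le> L * dist x y"
    and \<psi>01: "\<And>x. 0 \<le> \<psi> x" "\<And>x. \<psi> x \<le> 1"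
    and \<psi>: "\<And>x. x \<in> F \<Longrightarrow> \<forall>\<^sub>F y in nhds x. \<psi> y = 1" "\<And>x. x \<notin> \<Omega> \<Longrightarrow> \<forall>\<^sub>F y in nhds x. \<psi> y = 0"
    by simp_all
  have \<psi>L: "\<psi> \<in> Lip M" using L by (intro Lip_I)
  have \<psi>F: "\<psi> x = 1" if "x \<in> F" for x using eventually_nhds_x_imp_x[OF \<psi>(1)[OF that]] .
  have \<psi>\<Omega>: "\<psi> x = 0" if "x \<notin> \<Omega>" for x using eventually_nhds_x_imp_x[OF \<psi>(2)[OF that]] .
  obtain fs where fs: "minimizing M p fs u" using minimizing_exists[OF uC] .
  have "Cheeger M p (\<lambda>x. u x - g x) < \<infinity>" using less_trans[OF gu(2) ennreal_less_top] by simp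
  then obtain hs where hs: "minimizing M p hs (\<lambda>x. u x - g x)" by (rule minimizing_exists)
  define q where "q n x = fs n x - hs n x" for n x
  have q: "q n \<in> Lp M p" "q n \<in> Lip M" and qlim: "Lp_tendsto M p q g"
    and lipq: "lip M (q n) x \<le> lip M (fs n) x + lip M (hs n) x" for n x
    using minimizing_diff[OF fs hs assms(4)] by (auto simp: q_def[abs_def])
  have fhL: "fs n \<in> Lip M" "hs n \<in> Lip M" for n using fs hs by (simp_all add: minimizing_def)
  note [measurable] = lip_measurable[OF fhL(1)] lip_measurable[OF fhL(2)] Lip_measurable[OF q(2)]
  \<comment> \<open>The Lipschitz constant \<open>L\<close> of the cutoff depends on
    \<open>g\<close>, hence on \<open>\<delta>\<close>. So the distance of \<open>q n\<close> to
    \<open>g\<close> is fixed only now, small enough to absorb the factor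
    \<open>L powr p\<close>.\<close>
  define \<delta>' where "\<delta>' = min \<delta> (\<delta> / (L powr p + 1))"
  have \<delta>': "0 < \<delta>'" "\<delta>' \<le> \<delta>" "L powr p * \<delta>' \<le> \<delta>"
  proof -
    show "0 < \<delta>'" "\<delta>' \<le> \<delta>" using \<delta> by (auto simp: \<delta>'_def add_nonneg_pos)
    have "L powr p * \<delta>' \<le> L powr p * (\<delta> / (L powr p + 1))"
      by (intro mult_left_mono) (auto simp: \<delta>'_def)
    also have "\<dots> = \<delta> * (L powr p / (L powr p + 1))" by simp
    also have "\<dots> \<le> \<delta> * 1"
    proof (rule mult_left_mono)
      have "0 < L powr p + 1" using powr_ge_zero[of L p] by linarith
      then show "L powr p / (L powr p + 1) \<le> 1" by (simp add: divide_le_eq_1)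
    qed (use \<delta> in simp)
    also have "\<dots> = \<delta>" by simp
    finally show "L powr p * \<delta>' \<le> \<delta>" .
  qed
  have "\<forall>\<^sub>F n in sequentially. Lp_integral M p (lip M (fs n)) < ennreal (c + \<epsilon> / (4 * (1 + e)))"
    using fs c e assms(5) by (intro order_tendstoD(2)[of _ "ennreal c"]) (auto simp: minimizing_def intro!: ennreal_lessI)
  moreover have "\<forall>\<^sub>F n in sequentially. Lp_integral M p (lip M (hs n)) < ennreal \<delta>"
    using hs gu(2) by (intro order_tendstoD(2)[of _ "Cheeger M p (\<lambda>x. u x - g x)"]) (auto simp: minimizing_def)
  moreover have "\<forall>\<^sub>F n in sequentially. Lp_integral M p (\<lambda>x. q n x - g x) < ennreal \<delta>'"
    using qlim \<delta>'(1) by (intro ennreal_tendsto_0D) (auto simp: Lp_tendsto_iff)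
  ultimately have "\<forall>\<^sub>F n in sequentially. Lp_integral M p (lip M (fs n)) < ennreal (c + \<epsilon> / (4 * (1 + e))) \<and>
      Lp_integral M p (lip M (hs n)) < ennreal \<delta> \<and> Lp_integral M p (\<lambda>x. q n x - g x) < ennreal \<delta>'"
    by eventually_elim simp
  then obtain n where n: "Lp_integral M p (lip M (fs n)) < ennreal (c + \<epsilon> / (4 * (1 + e)))"
      "Lp_integral M p (lip M (hs n)) < ennreal \<delta>" "Lp_integral M p (\<lambda>x. q n x - g x) < ennreal \<delta>'"
    using eventually_happens'[OF sequentially_bot] by blast
  \<comment> \<open>Truncation at \<open>S\<close> makes the coefficient in the product rule
    bounded, so \<open>v\<close> is globally Lipschitz. As \<open>\<bar>g x\<bar> \<le> S\<close>,
    it does not increase the distance to the positive part of \<open>g\<close>.\<close>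
  define k where "k x = min S (max 0 (q n x))" for x
  define v where "v x = \<psi> x * k x" for x
  have k: "0 \<le> k x" "k x \<le> S" "k x \<le> \<bar>q n x\<bar>" "\<bar>k x - k y\<bar> \<le> \<bar>q n x - q n y\<bar>" for x y
    using S(1) by (auto simp: k_def min_def max_def abs_if)
  have prod: "\<bar>v x - v y\<bar> \<le> 1 * \<bar>q n x - q n y\<bar> + k y * \<bar>\<psi> x - \<psi> y\<bar>" for x y
  proof -
    \<comment> \<open>The product is split so that \<open>k\<close> is evaluated at the second point
      only. When the slope at that point is computed, the coefficient is constant.\<close>
    have "v x - v y = \<psi> x * (k x - k y) + k y * (\<psi> x - \<psi> y)"
      by (simp add: v_def algebra_simps)
    then have "\<bar>v x - v y\<bar> \<le> \<psi> x * \<bar>k x - k y\<bar> + k y * \<bar>\<psi> x - \<psi> y\<bar>"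
      using abs_triangle_ineq[of "\<psi> x * (k x - k y)" "k y * (\<psi> x - \<psi> y)"] \<psi>01(1) k(1)
      by (simp add: abs_mult)
    also have "\<psi> x * \<bar>k x - k y\<bar> \<le> 1 * \<bar>q n x - q n y\<bar>"
      using \<psi>01 k(4) by (intro mult_mono) auto
    finally show ?thesis by simp
  qed
  have vL: "v \<in> Lip M"
  proof (rule Lip_comb[OF q(2)[of n] \<psi>L, of 1 S])
    fix x y
    show "\<bar>v x - v y\<bar> \<le> 1 * \<bar>q n x - q n y\<bar> + S * \<bar>\<psi> x - \<psi> y\<bar>"
      using prod[of x y] k(2)[of y] by (elim order_trans) (intro add_left_mono mult_right_mono, auto)
  qed (use S in auto)
  \<comment> \<open>The comparison is with the positive part of \<open>g\<close>, which is at least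
    as close to \<open>u\<close> as \<open>g\<close> itself wherever \<open>u\<close> is
    nonnegative.\<close>
  have vg: "\<bar>v x - max 0 (g x)\<bar> \<le> \<bar>q n x - g x\<bar>" for x
  proof (cases "x \<in> F")
    case True
    then show ?thesis using \<psi>F[OF True] S(2)[of x] S(1) by (auto simp: v_def k_def min_def max_def abs_if)
  next
    case False
    have "v x \<le> 1 * \<bar>q n x\<bar>" "0 \<le> v x"
      unfolding v_def using \<psi>01 k by (intro mult_mono mult_nonneg_nonneg; auto)+
    then show ?thesis using gF[OF False] by simp
  qed
  have lipv: "lip M v x \<le> lip M (fs n) x + (lip M (hs n) x + L * \<bar>q n x - g x\<bar>)" for x
  proof (cases "x \<in> F")
    case True
    have "\<forall>\<^sub>F y in at x within space M. \<psi> y = 1"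
      using \<psi>(1)[OF True] by (simp add: eventually_at_filter eventually_mono)
    then have "\<forall>\<^sub>F y in at x within space M. \<bar>v y - v x\<bar> \<le> 1 * \<bar>q n y - q n x\<bar>"
      by eventually_elim (use k(4) \<psi>F[OF True] in \<open>simp add: v_def\<close>)
    then have "lip M v x \<le> 1 * lip M (q n) x" using q(2) by (intro lip_scale_le) auto
    also have "\<dots> \<le> lip M (fs n) x + lip M (hs n) x" using lipq by simp
    also have "\<dots> \<le> lip M (fs n) x + (lip M (hs n) x + L * \<bar>q n x - g x\<bar>)" using L by simp
    finally show ?thesis .
  next
    case False
    have "lip M v x \<le> 1 * lip M (q n) x + k x * lip M \<psi> x"
      using q(2) \<psi>L k(1) prod by (intro lip_comb_le always_eventually) auto
    also have "\<dots> \<le> (lip M (fs n) x + lip M (hs n) x) + \<bar>q n x\<bar> * L"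
      using lipq[of n x] k(3) lip_le_Lipschitz[OF L(1), of M \<psi> x] L(2) by (intro add_mono mult_mono) auto
    finally show ?thesis using gF[OF False] by (simp add: mult.commute)
  qed
  show thesis
  proof (rule that[of v S])
    show "v \<in> Lip M" by (rule vL)
    show "0 \<le> v x" for x using \<psi>01 k by (simp add: v_def)
    show "v x \<le> S" for x
      using mult_mono[OF \<psi>01(2) k(2), of x x] k(1) by (simp add: v_def)
    show v0: "v x = 0" if "x \<notin> \<Omega>" for x using \<psi>\<Omega>[OF that] by (simp add: v_def)
    show "lip M v x = 0" if "x \<notin> \<Omega>" for x
    proof -
      have "\<forall>\<^sub>F y in at x within space M. \<psi> y = 0"
        using \<psi>(2)[OF that] by (simp add: eventually_at_filter eventually_mono)
      then show ?thesis
        by (intro lip_eq_0, eventually_elim) (use \<psi>\<Omega>[OF that] in \<open>simp add: v_def\<close>)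
    qed
    have "Lp_integral M p (\<lambda>x. v x - u x) \<le> ennreal T * (Lp_integral M p (\<lambda>x. q n x - g x) + Lp_integral M p (\<lambda>x. u x - g x))"
      unfolding T_def
    proof (rule Lp_integral_add_le)
      show "AE x in M. \<bar>v x - u x\<bar> \<le> \<bar>q n x - g x\<bar> + \<bar>u x - g x\<bar>"
        using nonneg
      proof eventually_elim
        case (elim x)
        have "\<bar>v x - u x\<bar> \<le> \<bar>v x - max 0 (g x)\<bar> + \<bar>u x - max 0 (g x)\<bar>"
          using abs_triangle_ineq4[of "v x - max 0 (g x)" "u x - max 0 (g x)"] by simp
        also have "\<bar>u x - max 0 (g x)\<bar> \<le> \<bar>u x - g x\<bar>" using elim by (auto simp: max_def abs_if)
        finally show ?case using vg[of x] by linarith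
      qed
    qed (use assms(4) in auto)
    also have "\<dots> \<le> ennreal T * (ennreal \<delta> + ennreal \<delta>)"
      using n(3) gu(1) \<delta>'(2) by (intro mult_left_mono add_mono) (auto intro: order_trans[OF less_imp_le ennreal_leI])
    also have "\<dots> = ennreal (2 * (T * \<delta>))"
      using T \<delta> by (simp add: ennreal_mult'[symmetric] ennreal_plus[symmetric] algebra_simps del: ennreal_plus)
    also have "\<dots> \<le> ennreal \<epsilon>" using \<delta>1 by (intro ennreal_leI) simp
    finally show "Lp_integral M p (\<lambda>x. v x - u x) \<le> ennreal \<epsilon>" .
    let ?R = "\<lambda>x. lip M (hs n) x + L * \<bar>q n x - g x\<bar>"
    have "Lp_integral M p (lip M v) \<le> ennreal (1 + e) * Lp_integral M p (lip M (fs n)) + ennreal K * Lp_integral M p ?R"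
    proof (rule K(2))
      fix x
      show "\<bar>lip M v x\<bar> \<le> \<bar>lip M (fs n) x\<bar> + \<bar>?R x\<bar>"
        using lipv[of x] L(1) by simp
    qed auto
    also have "Lp_integral M p ?R \<le> ennreal T * (Lp_integral M p (lip M (hs n)) + Lp_integral M p (\<lambda>x. L * (q n x - g x)))"
      unfolding T_def using L(1) assms(4) by (intro Lp_integral_add_le AE_I2) (auto simp: abs_mult)
    also have "Lp_integral M p (\<lambda>x. L * (q n x - g x)) = ennreal (L powr p) * Lp_integral M p (\<lambda>x. q n x - g x)"
      unfolding Lp_integral_def using L(1)
      by (simp add: abs_mult powr_mult ennreal_mult nn_integral_cmult)
    also have "ennreal (1 + e) * Lp_integral M p (lip M (fs n)) + ennreal K * (ennreal T * (Lp_integral M p (lip M (hs n)) + ennreal (L powr p) * Lp_integral M p (\<lambda>x. q n x - g x)))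
        \<le> ennreal (1 + e) * ennreal (c + \<epsilon> / (4 * (1 + e))) + ennreal K * (ennreal T * (ennreal \<delta> + ennreal (L powr p) * ennreal \<delta>'))"
      using n by (intro mult_left_mono add_mono) auto
    also have "\<dots> = ennreal ((1 + e) * (c + \<epsilon> / (4 * (1 + e))) + K * (T * (\<delta> + L powr p * \<delta>')))"
      using c e K T \<delta> \<delta>' assms(5) by (simp add: ennreal_mult'[symmetric] ennreal_plus[symmetric] del: ennreal_plus)
    also have "\<dots> \<le> ennreal (c + \<epsilon>)"
    proof (rule ennreal_leI)
      have "(1 + e) * (c + \<epsilon> / (4 * (1 + e))) = c + e * c + \<epsilon> / 4" using e by (simp add: field_simps)
      moreover have "K * (T * (\<delta> + L powr p * \<delta>')) \<le> K * (T * (\<delta> + \<delta>))"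
        using K T \<delta>'(3) by (intro mult_left_mono add_left_mono) auto
      moreover have "K * (T * (\<delta> + \<delta>)) \<le> \<epsilon> / 2" using \<delta>1(1) by (simp add: algebra_simps)
      ultimately have "(1 + e) * (c + \<epsilon> / (4 * (1 + e))) + K * (T * (\<delta> + L powr p * \<delta>')) \<le> (c + \<epsilon> / 4 + \<epsilon> / 4) + \<epsilon> / 2"
        using e(2) by (intro add_mono) simp_all
      then show "(1 + e) * (c + \<epsilon> / (4 * (1 + e))) + K * (T * (\<delta> + L powr p * \<delta>')) \<le> c + \<epsilon>"
        by simp
    qed
    also have "\<dots> = Cheeger M p u + ennreal \<epsilon>" using c assms(5) by simp
    finally show "Lp_integral M p (lip M v) \<le> Cheeger M p u + ennreal \<epsilon>"
      by (simp add: add_left_mono mult_left_mono)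
  qed
qed

end

section \<open>Coarea inequality from isoperimetry\<close>

text \<open>The hypothesis says that the difference \<open>H\<close> of the two distribution
  functions is nondecreasing. It is also right continuous with limit 0 at minus infinity, so it
  generates a measure \<open>\<xi>\<close>, the missing summand in
  \<open>\<kappa> + \<xi> = \<nu>\<close>.\<close>

lemma emeasure_le_of_Ioc:
  fixes \<kappa> \<nu> :: "real measure"
  assumes "finite_borel_measure \<kappa>" "finite_borel_measure \<nu>"
    and le: "\<And>a b. a < b \<Longrightarrow> emeasure \<kappa> {a<..b} \<le> emeasure \<nu> {a<..b}"
    and A: "A \<in> sets borel"
  shows "emeasure \<kappa> A \<le> emeasure \<nu> A"
proof -
  interpret \<kappa>: finite_borel_measure \<kappa> by fact
  interpret \<nu>: finite_borel_measure \<nu> by fact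
  define H where "H t = cdf \<nu> t - cdf \<kappa> t" for t
  have mono: "H a \<le> H b" if "a \<le> b" for a b
  proof (cases "a = b")
    case False
    then have "a < b" using that by simp
    then have "measure \<kappa> {a<..b} \<le> measure \<nu> {a<..b}"
      using le by (simp add: \<kappa>.emeasure_eq_measure \<nu>.emeasure_eq_measure)
    then show ?thesis
      using \<kappa>.cdf_diff_eq[OF \<open>a < b\<close>] \<nu>.cdf_diff_eq[OF \<open>a < b\<close>] by (simp add: H_def)
  qed simp
  have rc: "continuous (at_right a) H" for a
    unfolding H_def by (intro continuous_intros \<kappa>.cdf_is_right_cont \<nu>.cdf_is_right_cont)
  have bot: "(H \<longlongrightarrow> 0) at_bot"
    unfolding H_def using tendsto_diff[OF \<nu>.cdf_lim_at_bot \<kappa>.cdf_lim_at_bot] by simp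
  have top: "(H \<longlongrightarrow> measure \<nu> (space \<nu>) - measure \<kappa> (space \<kappa>)) at_top"
    unfolding H_def by (intro tendsto_diff \<nu>.cdf_lim_at_top \<kappa>.cdf_lim_at_top)
  have m0: "0 \<le> measure \<nu> (space \<nu>) - measure \<kappa> (space \<kappa>)"
  proof (rule tendsto_lowerbound[OF top])
    have "0 \<le> H t" for t
      by (rule tendsto_upperbound[OF bot]) (auto intro: eventually_at_bot_linorderI[of t] mono)
    then show "\<forall>\<^sub>F t in at_top. 0 \<le> H t" by simp
  qed simp
  define \<xi> where "\<xi> = interval_measure H"
  interpret \<xi>: finite_borel_measure \<xi>
    unfolding \<xi>_def by (rule finite_borel_measure_interval_measure[OF mono rc bot top m0])
  have cdf\<xi>: "emeasure \<xi> {..t} = ennreal (H t)" for t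
    unfolding \<xi>_def by (rule emeasure_interval_measure_Iic[OF mono rc bot])
  \<comment> \<open>An identity and not an inequality, because only an identity survives complements
    in the Dynkin induction.\<close>
  have "measure \<kappa> A + measure \<xi> A = measure \<nu> A"
  proof -
    have gen: "A \<in> sigma_sets UNIV (range (\<lambda>t::real. {..t}))"
      using A by (simp add: borel_eq_atMost)
    have "Int_stable (range (\<lambda>t::real. {..t}))"
      by (auto simp: Int_stable_def)
    moreover have "range (\<lambda>t::real. {..t}) \<subseteq> Pow UNIV" by simp
    ultimately show ?thesis using gen
    proof (induct rule: sigma_sets_induct_disjoint)
      case (basic B)
      then obtain t where "B = {..t}" by auto
      moreover have "measure \<xi> {..t} = H t"
        using cdf\<xi>[of t] mono[of _ t] measure_nonneg[of \<xi>]
        by (metis \<xi>.emeasure_eq_measure bot cdf_interval_measure cdf_def mono rc \<xi>_def)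
      ultimately show ?case by (simp add: H_def cdf_def)
    next
      case empty then show ?case by simp
    next
      case (compl B)
      have B: "B \<in> sets borel" using compl(1) by (simp add: borel_eq_atMost)
      have UN: "measure \<kappa> UNIV + measure \<xi> UNIV = measure \<nu> UNIV"
        using interval_measure_UNIV[OF mono rc bot top m0] m0
        by (simp add: \<xi>_def[symmetric] \<xi>.emeasure_eq_measure \<kappa>.borel_UNIV \<nu>.borel_UNIV)
      show ?case
        using compl(2) UN \<kappa>.finite_measure_compl[of B] \<nu>.finite_measure_compl[of B] \<xi>.finite_measure_compl[of B] B
        by (simp add: \<kappa>.borel_UNIV \<nu>.borel_UNIV \<xi>.borel_UNIV \<kappa>.M_is_borel \<nu>.M_is_borel \<xi>.M_is_borel)
    next
      case (union B)
      have B: "range B \<subseteq> sets borel" using union(2) by (simp add: borel_eq_atMost)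
      have "(\<lambda>i. measure \<kappa> (B i) + measure \<xi> (B i)) sums (measure \<kappa> (\<Union>i. B i) + measure \<xi> (\<Union>i. B i))"
        using B union(1)
        by (intro sums_add \<kappa>.finite_measure_UNION \<xi>.finite_measure_UNION) (auto simp: \<kappa>.M_is_borel \<xi>.M_is_borel)
      moreover have "(\<lambda>i. measure \<nu> (B i)) sums measure \<nu> (\<Union>i. B i)"
        using B union(1) by (intro \<nu>.finite_measure_UNION) (auto simp: \<nu>.M_is_borel)
      ultimately show ?case using union(3) sums_unique2 by auto
    qed
  qed
  then have "measure \<kappa> A \<le> measure \<nu> A" using measure_nonneg[of \<xi> A] by linarith
  then show ?thesis by (simp add: \<kappa>.emeasure_eq_measure \<nu>.emeasure_eq_measure)
qed

definition level_measure :: "'a measure \<Rightarrow> 'a set \<Rightarrow> ('a \<Rightarrow> real) \<Rightarrow> real \<Rightarrow> real" where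
  "level_measure M \<Omega> u t = measure M {x \<in> \<Omega>. t < u x}"

locale isoperimetric = metric_measure M for M :: "'a::polish_space measure" +
  fixes \<Omega> :: "'a set" and N C :: real
  assumes open_\<Omega>: "open \<Omega>" and finite_\<Omega>: "emeasure M \<Omega> < \<infinity>" and N: "1 < N" and C: "0 < C"
    and isoperimetric_ineq:
      "\<And>E. E \<in> sets M \<Longrightarrow> E \<subseteq> \<Omega> \<Longrightarrow> ennreal (C * measure M E powr ((N - 1) / N)) \<le> Per M E"

locale isoperimetric_Lip = isoperimetric M \<Omega> N C for M :: "'a::polish_space measure" and \<Omega> N C +
  fixes v :: "'a \<Rightarrow> real" and S :: real
  assumes v_Lip: "v \<in> Lip M" and v_nonneg: "\<And>x. 0 \<le> v x" and v_le: "\<And>x. v x \<le> S"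
    and v_zero: "\<And>x. x \<notin> \<Omega> \<Longrightarrow> v x = 0"
begin

lemma v_measurable [measurable]: "v \<in> borel_measurable M"
  using v_Lip by (rule Lip_measurable)

lemma lip_v_measurable [measurable]: "lip M v \<in> borel_measurable M"
  using v_Lip by (rule lip_measurable)

lemma sigma_finite_M: "sigma_finite_measure M"
proof
  fix x0 :: 'a
  show "\<exists>A. countable A \<and> A \<subseteq> sets M \<and> \<Union> A = space M \<and> (\<forall>a\<in>A. emeasure M a \<noteq> \<infinity>)"
  proof (intro exI[of _ "range (\<lambda>n::nat. ball x0 (real n))"] conjI ballI)
    show "\<Union> (range (\<lambda>n. ball x0 (real n))) = space M"
      using reals_Archimedean2 by auto
    show "emeasure M a \<noteq> \<infinity>" if "a \<in> range (\<lambda>n. ball x0 (real n))" for a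
      using that finite_bounded[of a] by (auto simp: sets_M)
  qed (auto simp: sets_M)
qed

abbreviation superlevel :: "real \<Rightarrow> real" where
  "superlevel \<equiv> level_measure M \<Omega> v"

lemma superlevel_set:
  assumes "0 \<le> t"
  shows "{x. t < v x} \<in> sets M" "{x. t < v x} \<subseteq> \<Omega>" "superlevel t = measure M {x. t < v x}"
proof -
  have "{x \<in> space M. t < v x} \<in> sets M" by measurable
  then show "{x. t < v x} \<in> sets M" by simp
  show "{x. t < v x} \<subseteq> \<Omega>" using v_zero assms by force
  then have "{x \<in> \<Omega>. t < v x} = {x. t < v x}" by auto
  then show "superlevel t = measure M {x. t < v x}" by (simp add: level_measure_def)
qed

text \<open>The test functions rise from 0 to 1 while \<open>v\<close> rises from \<open>t\<close>
  to \<open>t + 1 / Suc n\<close>. They tend to the indicator of \<open>{v > t}\<close> pointwise,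
  hence in \<open>L\<^sup>1\<close> on balls, which have finite measure.\<close>

lemma isoperimetric_level:
  assumes "0 < t"
  shows "ennreal (C * superlevel t powr ((N - 1) / N)) \<le>
    liminf (\<lambda>n. \<integral>\<^sup>+x. ennreal (real (Suc n) * lip M v x) * indicator {x. t \<le> v x \<and> v x \<le> t + 1 / real (Suc n)} x \<partial>M)"
proof -
  let ?E = "{x. t < v x}"
  define us where "us n x = min 1 (max 0 (real (Suc n) * (v x - t)))" for n x
  have us_diff: "\<bar>us n x - us n y\<bar> \<le> real (Suc n) * \<bar>v x - v y\<bar>" for n x y
  proof -
    have "\<bar>min 1 (max 0 a) - min 1 (max 0 b)\<bar> \<le> \<bar>a - b\<bar>" for a b :: real
      by (simp add: min_def max_def abs_if)
    then have "\<bar>us n x - us n y\<bar> \<le> \<bar>real (Suc n) * (v x - t) - real (Suc n) * (v y - t)\<bar>"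
      unfolding us_def .
    also have "\<dots> = real (Suc n) * \<bar>v x - v y\<bar>"
      by (simp only: right_diff_distrib[symmetric] abs_mult) simp
    finally show ?thesis .
  qed
  have us_Lip: "us n \<in> Lip M" for n
    by (rule Lip_comb[OF v_Lip v_Lip, of "real (Suc n)" 0]) (use us_diff in auto)
  then have [measurable]: "us n \<in> borel_measurable M" for n by (rule Lip_measurable)
  have "Lip M \<subseteq> Lip_loc M"
  proof
    fix f assume "f \<in> Lip M"
    then obtain L where "L-lipschitz_on UNIV f" by (auto simp: Lip_def)
    then have "L-lipschitz_on (ball x 1 \<inter> space M) f" for x
      by (rule lipschitz_on_subset) simp
    then show "f \<in> Lip_loc M"
      unfolding Lip_loc_def using zero_less_one by blast
  qed
  moreover have "L1_loc_tendsto M us (indicator ?E)"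
    unfolding L1_loc_tendsto_def
  proof (intro ballI exI[of _ 1] conjI)
    fix x
    have lim: "(\<lambda>n. us n y) \<longlonglongrightarrow> indicator ?E y" for y
    proof (cases "t < v y")
      case True
      then have "0 < v y - t" by simp
      then have ev: "\<forall>\<^sub>F n in sequentially. 1 / real (Suc n) < v y - t"
        using LIMSEQ_inverse_real_of_nat by (intro order_tendstoD(2)) (auto simp: inverse_eq_divide)
      have "\<forall>\<^sub>F n in sequentially. us n y = indicator ?E y"
        using ev
      proof eventually_elim
        case (elim n)
        then have "1 < real (Suc n) * (v y - t)" by (simp add: field_simps)
        then show ?case using True by (simp add: us_def)
      qed
      then show ?thesis by (rule tendsto_eventually)
    next
      case False
      then have "us n y = indicator ?E y" for n
        using mult_nonneg_nonpos[of "real (Suc n)" "v y - t"] by (simp add: us_def del: of_nat_Suc)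
      then show ?thesis by simp
    qed
    have E [measurable]: "?E \<in> sets M" using superlevel_set[of t] assms by simp
    have B [measurable]: "ball x 1 \<in> sets M" by (simp add: sets_M)
    have "(\<lambda>n. \<integral>\<^sup>+y. ennreal \<bar>us n y - indicator ?E y\<bar> * indicator (ball x 1) y \<partial>M) \<longlonglongrightarrow> (\<integral>\<^sup>+y. 0 \<partial>M)"
    proof (rule nn_integral_dominated_convergence[where w = "\<lambda>y. indicator (ball x 1) y"])
      show "(\<integral>\<^sup>+y. indicator (ball x 1) y \<partial>M) < \<infinity>"
        using finite_bounded[OF B] by simp
      show "AE y in M. ennreal \<bar>us n y - indicator ?E y\<bar> * indicator (ball x 1) y \<le> indicator (ball x 1) y" for n
        by (intro AE_I2) (auto simp: us_def indicator_def abs_if)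
      show "AE y in M. (\<lambda>n. ennreal \<bar>us n y - indicator ?E y\<bar> * indicator (ball x 1) y) \<longlonglongrightarrow> 0"
      proof (intro AE_I2)
        fix y
        have "(\<lambda>n. ennreal \<bar>us n y - indicator ?E y\<bar>) \<longlonglongrightarrow> ennreal \<bar>indicator ?E y - indicator ?E y\<bar>"
          by (intro tendsto_ennrealI tendsto_intros lim)
        then have "(\<lambda>n. indicator (ball x 1) y * ennreal \<bar>us n y - indicator ?E y\<bar>) \<longlonglongrightarrow> indicator (ball x 1) y * 0"
          by (intro ennreal_tendsto_cmult) (auto simp: indicator_def)
        then show "(\<lambda>n. ennreal \<bar>us n y - indicator ?E y\<bar> * indicator (ball x 1) y) \<longlonglongrightarrow> 0"
          by (simp add: mult.commute)
      qed
    qed measurable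
    then show "(\<lambda>n. \<integral>\<^sup>+y\<in>ball x 1. ennreal \<bar>us n y - indicator ?E y\<bar> \<partial>M) \<longlonglongrightarrow> 0" by simp
  qed simp
  ultimately have "Per M ?E \<le> liminf (\<lambda>n. \<integral>\<^sup>+x. ennreal (lip M (us n) x) \<partial>M)"
    unfolding Per_def using us_Lip by (intro Inf_lower) auto
  moreover have "ennreal (lip M (us n) x) \<le>
      ennreal (real (Suc n) * lip M v x) * indicator {x. t \<le> v x \<and> v x \<le> t + 1 / real (Suc n)} x" for n x
  proof -
    have cont: "(v \<longlongrightarrow> v x) (at x)"
      using Lip_continuous[OF v_Lip] by (simp add: continuous_on_eq_continuous_at isCont_def)
    \<comment> \<open>Where \<open>v x\<close> is strictly outside the range of the ramp, continuity
      makes \<open>us n\<close> constant near \<open>x\<close>. At the two end values only the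
      Lipschitz bound is available, so the strip has to be closed.\<close>
    consider "v x < t" | "t + 1 / real (Suc n) < v x" | "t \<le> v x" "v x \<le> t + 1 / real (Suc n)" by linarith
    then show ?thesis
    proof cases
      case 1
      have zero: "us n y = 0" if "v y < t" for y
        using mult_nonneg_nonpos[of "real (Suc n)" "v y - t"] that by (simp add: us_def del: of_nat_Suc)
      have "\<forall>\<^sub>F y in at x. v y < t" using order_tendstoD(2)[OF cont 1] .
      then have "\<forall>\<^sub>F y in at x. us n y = us n x"
        by eventually_elim (simp add: zero 1)
      then show ?thesis by (simp add: lip_eq_0)
    next
      case 2
      have one: "us n y = 1" if "t + 1 / real (Suc n) < v y" for y
      proof -
        have "1 < real (Suc n) * (v y - t)" using that by (simp add: field_simps)
        then show ?thesis by (simp add: us_def)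
      qed
      have "\<forall>\<^sub>F y in at x. t + 1 / real (Suc n) < v y" using order_tendstoD(1)[OF cont 2] .
      then have "\<forall>\<^sub>F y in at x. us n y = us n x"
        by eventually_elim (simp only: one 2)
      then show ?thesis by (simp add: lip_eq_0)
    next
      case 3
      have "lip M (us n) x \<le> real (Suc n) * lip M v x"
        by (rule lip_scale_le[OF v_Lip]) (use us_diff in auto)
      then show ?thesis using 3 by (simp add: ennreal_leI)
    qed
  qed
  then have "(\<integral>\<^sup>+x. ennreal (lip M (us n) x) \<partial>M) \<le>
      (\<integral>\<^sup>+x. ennreal (real (Suc n) * lip M v x) * indicator {x. t \<le> v x \<and> v x \<le> t + 1 / real (Suc n)} x \<partial>M)" for n
    by (rule nn_integral_mono)
  then have "liminf (\<lambda>n. \<integral>\<^sup>+x. ennreal (lip M (us n) x) \<partial>M) \<le>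
    liminf (\<lambda>n. \<integral>\<^sup>+x. ennreal (real (Suc n) * lip M v x) * indicator {x. t \<le> v x \<and> v x \<le> t + 1 / real (Suc n)} x \<partial>M)"
    by (intro Liminf_mono always_eventually allI)
  moreover have "ennreal (C * superlevel t powr ((N - 1) / N)) \<le> Per M ?E"
    using assms superlevel_set[of t] by (simp add: isoperimetric_ineq)
  ultimately show ?thesis by (meson order_trans)
qed

text \<open>Fatou over the levels, then Tonelli: for a fixed \<open>x\<close> the levels
  \<open>t\<close> whose strip contains \<open>v x\<close> form a set of length at most
  \<open>1 / Suc n\<close>, which cancels the factor \<open>Suc n\<close>. The strips overshoot
  \<open>b\<close> by less than \<open>1 / Suc n\<close>, and in the limit this leaves the half-open
  range that suits a comparison of distribution functions.\<close>

lemma isoperimetric_coarea: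
  assumes "0 \<le> a" "a < b"
  shows "(\<integral>\<^sup>+t. ennreal (C * superlevel t powr ((N - 1) / N)) * indicator {a<..<b} t \<partial>lborel)
    \<le> (\<integral>\<^sup>+x. ennreal (lip M v x) * indicator {x. a < v x \<and> v x \<le> b} x \<partial>M)"
proof -
  interpret M: sigma_finite_measure M by (rule sigma_finite_M)
  interpret P: pair_sigma_finite lborel M ..
  define I where "I n t = (\<integral>\<^sup>+x. ennreal (real (Suc n) * lip M v x) * indicator {x. t \<le> v x \<and> v x \<le> t + 1 / real (Suc n)} x \<partial>M)" for n t
  define J where "J n x = ennreal (lip M v x) * indicator {x. a < v x \<and> v x < b + 1 / real (Suc n)} x" for n x
  have I_meas [measurable]: "I n \<in> borel_measurable lborel" for n
    unfolding I_def[abs_def] indicator_def by measurable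
  have J_meas [measurable]: "J n \<in> borel_measurable M" for n
    unfolding J_def[abs_def] indicator_def by measurable
  have step: "(\<integral>\<^sup>+t. I n t * indicator {a<..<b} t \<partial>lborel) \<le> (\<integral>\<^sup>+x. J n x \<partial>M)" for n
  proof -
    define h where "h t x = ennreal (real (Suc n) * lip M v x) * indicator {t \<in> {a<..<b}. t \<le> v x \<and> v x \<le> t + 1 / real (Suc n)} t" for t x
    have h_meas [measurable]: "(\<lambda>(t, x). h t x) \<in> borel_measurable (lborel \<Otimes>\<^sub>M M)"
      unfolding h_def indicator_def by measurable
    have "(\<integral>\<^sup>+t. I n t * indicator {a<..<b} t \<partial>lborel) = (\<integral>\<^sup>+t. (\<integral>\<^sup>+x. h t x \<partial>M) \<partial>lborel)"
    proof (rule nn_integral_cong)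
      fix t
      have [measurable]: "(\<lambda>x. ennreal (real (Suc n) * lip M v x) * indicator {x. t \<le> v x \<and> v x \<le> t + 1 / real (Suc n)} x) \<in> borel_measurable M"
        unfolding indicator_def by measurable
      show "I n t * indicator {a<..<b} t = (\<integral>\<^sup>+x. h t x \<partial>M)"
        unfolding I_def h_def by (subst nn_integral_multc[symmetric]) (auto intro!: nn_integral_cong simp: indicator_def)
    qed
    also have "\<dots> = (\<integral>\<^sup>+x. (\<integral>\<^sup>+t. h t x \<partial>lborel) \<partial>M)"
      using P.Fubini'[OF h_meas] by simp
    also have "\<dots> \<le> (\<integral>\<^sup>+x. J n x \<partial>M)"
    proof (rule nn_integral_mono)
      fix x
      have "(\<integral>\<^sup>+t. h t x \<partial>lborel) \<le> (\<integral>\<^sup>+t. (ennreal (real (Suc n)) * J n x) * indicator {v x - 1 / real (Suc n)..v x} t \<partial>lborel)"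
      proof (rule nn_integral_mono)
        fix t
        show "h t x \<le> (ennreal (real (Suc n)) * J n x) * indicator {v x - 1 / real (Suc n)..v x} t"
        proof (cases "t \<in> {a<..<b} \<and> t \<le> v x \<and> v x \<le> t + 1 / real (Suc n)")
          case True
          then have "a < v x" "v x < b + 1 / real (Suc n)" "t \<in> {v x - 1 / real (Suc n)..v x}" by auto
          then show ?thesis using True by (simp add: h_def J_def ennreal_mult')
        qed (auto simp: h_def)
      qed
      also have "\<dots> = (ennreal (real (Suc n)) * J n x) * ennreal (1 / real (Suc n))"
        by (simp add: nn_integral_cmult_indicator)
      also have "\<dots> = J n x * (ennreal (real (Suc n)) * ennreal (1 / real (Suc n)))"
        by (simp only: ac_simps)
      also have "ennreal (real (Suc n)) * ennreal (1 / real (Suc n)) = 1"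
        by (subst ennreal_mult[symmetric]) auto
      finally show "(\<integral>\<^sup>+t. h t x \<partial>lborel) \<le> J n x" by simp
    qed
    finally show ?thesis .
  qed
  obtain L where L: "0 \<le> L" "\<And>x y. x \<in> space M \<Longrightarrow> y \<in> space M \<Longrightarrow> \<bar>v x - v y\<bar> \<le> L * dist x y"
    using Lip_E[OF v_Lip] by blast
  have J_lim: "(\<lambda>n. \<integral>\<^sup>+x. J n x \<partial>M) \<longlonglongrightarrow> (\<integral>\<^sup>+x. ennreal (lip M v x) * indicator {x. a < v x \<and> v x \<le> b} x \<partial>M)"
  proof (rule nn_integral_dominated_convergence[where w = "\<lambda>x. ennreal L * indicator \<Omega> x"])
    have [measurable]: "\<Omega> \<in> sets M" using open_\<Omega> by (simp add: sets_M)
    show "(\<lambda>x. ennreal L * indicator \<Omega> x) \<in> borel_measurable M" by measurable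
    show "(\<integral>\<^sup>+x. ennreal L * indicator \<Omega> x \<partial>M) < \<infinity>"
      using finite_\<Omega> by (simp add: nn_integral_cmult_indicator ennreal_mult_less_top)
    show "AE x in M. J n x \<le> ennreal L * indicator \<Omega> x" for n
      using lip_le_Lipschitz[OF L] v_zero assms(1)
      by (intro AE_I2) (auto simp: J_def indicator_def ennreal_leI)
    show "AE x in M. (\<lambda>n. J n x) \<longlonglongrightarrow> ennreal (lip M v x) * indicator {x. a < v x \<and> v x \<le> b} x"
    proof (intro AE_I2 tendsto_eventually)
      fix x
      show "\<forall>\<^sub>F n in sequentially. J n x = ennreal (lip M v x) * indicator {x. a < v x \<and> v x \<le> b} x"
      proof (cases "v x \<le> b")
        case True
        have "J n x = ennreal (lip M v x) * indicator {x. a < v x \<and> v x \<le> b} x" for n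
        proof -
          have "v x < b + 1 / real (Suc n)" using True by (rule le_less_trans) simp
          then show ?thesis using True by (simp add: J_def indicator_def)
        qed
        then show ?thesis by simp
      next
        case False
        then have "0 < v x - b" by simp
        then have ev: "\<forall>\<^sub>F n in sequentially. 1 / real (Suc n) < v x - b"
          using LIMSEQ_inverse_real_of_nat by (intro order_tendstoD(2)) (auto simp: inverse_eq_divide)
        then show ?thesis
          by eventually_elim (use False in \<open>simp add: J_def indicator_def\<close>)
      qed
    qed
    show "(\<lambda>x. ennreal (lip M v x) * indicator {x. a < v x \<and> v x \<le> b} x) \<in> borel_measurable M"
      unfolding indicator_def by measurable
  qed measurable
  have "(\<integral>\<^sup>+t. ennreal (C * superlevel t powr ((N - 1) / N)) * indicator {a<..<b} t \<partial>lborel)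
      \<le> (\<integral>\<^sup>+t. liminf (\<lambda>n. I n t * indicator {a<..<b} t) \<partial>lborel)"
  proof (rule nn_integral_mono)
    fix t
    show "ennreal (C * superlevel t powr ((N - 1) / N)) * indicator {a<..<b} t \<le> liminf (\<lambda>n. I n t * indicator {a<..<b} t)"
      using isoperimetric_level[of t] assms by (cases "t \<in> {a<..<b}") (auto simp: I_def)
  qed
  also have "\<dots> \<le> liminf (\<lambda>n. \<integral>\<^sup>+t. I n t * indicator {a<..<b} t \<partial>lborel)"
    by (rule nn_integral_liminf) measurable
  also have "\<dots> \<le> liminf (\<lambda>n. \<integral>\<^sup>+x. J n x \<partial>M)"
    using step by (intro Liminf_mono always_eventually allI)
  also have "\<dots> = (\<integral>\<^sup>+x. ennreal (lip M v x) * indicator {x. a < v x \<and> v x \<le> b} x \<partial>M)"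
    by (rule lim_imp_Liminf[OF sequentially_bot J_lim])
  finally show ?thesis .
qed

end

section \<open>Densities on the levels\<close>

text \<open>Both measures \<open>\<Phi> dt\<close> and the image of \<open>g dR\<close> under \<open>v\<close> live on the levels; the former is dominated by
  the latter, hence has a density \<open>f\<close> with respect to the image of \<open>R\<close>. Testing the domination with
  \<open>f powr (p - 1)\<close> and applying Young's inequality compares the \<open>p\<close>-energies.\<close>

lemma level_density:
  fixes R :: "'a measure" and v g :: "'a \<Rightarrow> real" and \<Phi> :: "real \<Rightarrow> real"
  assumes "finite_measure R" and [measurable]: "v \<in> borel_measurable R" "g \<in> borel_measurable R"
    and g: "\<And>x. 0 \<le> g x" "\<And>x. x \<in> space R \<Longrightarrow> g x \<le> L" and "0 \<le> L"
    and [measurable]: "\<Phi> \<in> borel_measurable borel"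
    and \<Phi>: "\<And>t. 0 \<le> \<Phi> t" "\<And>t. \<Phi> t \<le> B" "\<And>t. S \<le> t \<Longrightarrow> \<Phi> t = 0"
    and coarea: "\<And>a b. 0 \<le> a \<Longrightarrow> a < b \<Longrightarrow>
      (\<integral>\<^sup>+t. ennreal (\<Phi> t) * indicator {a<..<b} t \<partial>lborel) \<le> (\<integral>\<^sup>+x. ennreal (g x) * indicator {x. a < v x \<and> v x \<le> b} x \<partial>R)"
    and "1 < p"
  obtains f where "f \<in> borel_measurable borel" "\<And>t. 0 \<le> f t" "\<And>t. f t \<le> L"
    "\<And>h. h \<in> borel_measurable borel \<Longrightarrow>
      (\<integral>\<^sup>+t. h t * (ennreal (\<Phi> t) * indicator {0<..} t) \<partial>lborel) = (\<integral>\<^sup>+t. h t * ennreal (f t) \<partial>distr R borel v)"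
    "(\<integral>\<^sup>+t. ennreal (f t powr p) \<partial>distr R borel v) \<le> (\<integral>\<^sup>+x. ennreal (g x powr p) \<partial>R)"
proof -
  interpret R: finite_measure R by fact
  define \<mu> where "\<mu> = distr R borel v"
  define \<nu> where "\<nu> = distr (density R g) borel v"
  \<comment> \<open>The coarea hypothesis concerns levels from 0 upwards, so the measure is cut to
    positive levels. An interval reaching below 0 is then treated by replacing its left end by
    0.\<close>
  define \<phi> where "\<phi> t = ennreal (\<Phi> t) * indicator {0<..} t" for t
  have [measurable]: "\<phi> \<in> borel_measurable borel" unfolding \<phi>_def[abs_def] by measurable
  define \<kappa> where "\<kappa> = density lborel \<phi>"
  have sets: "sets \<mu> = sets borel" "sets \<nu> = sets borel" "sets \<kappa> = sets borel"
    by (simp_all add: \<mu>_def \<nu>_def \<kappa>_def)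
  have space: "space \<mu> = UNIV" "space \<nu> = UNIV" "space \<kappa> = UNIV"
    by (simp_all add: \<mu>_def \<nu>_def \<kappa>_def)
  interpret \<mu>: finite_measure \<mu>
    unfolding \<mu>_def by (rule R.finite_measure_distr) simp
  have em\<nu>: "emeasure \<nu> A = (\<integral>\<^sup>+x. ennreal (g x) * indicator A (v x) \<partial>R)" if "A \<in> sets borel" for A
    unfolding \<nu>_def using that
    by (subst emeasure_distr) (auto simp: emeasure_density intro!: nn_integral_cong split: split_indicator)
  have em\<kappa>: "emeasure \<kappa> A = (\<integral>\<^sup>+t. \<phi> t * indicator A t \<partial>lborel)" if "A \<in> sets borel" for A
    unfolding \<kappa>_def using that by (simp add: emeasure_density)
  have em\<mu>: "emeasure \<mu> A = (\<integral>\<^sup>+x. indicator A (v x) \<partial>R)" if "A \<in> sets borel" for A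
    unfolding \<mu>_def using that by (subst nn_integral_distr[of v R borel, symmetric]) auto
  have \<nu>\<mu>: "emeasure \<nu> A \<le> ennreal L * emeasure \<mu> A" if "A \<in> sets borel" for A
    unfolding em\<nu>[OF that] em\<mu>[OF that] using that g
    by (subst nn_integral_cmult[symmetric]) (auto intro!: nn_integral_mono mult_right_mono ennreal_leI)
  have "finite_measure \<nu>"
  proof (rule finite_measureI)
    have "emeasure \<nu> UNIV \<le> ennreal L * emeasure \<mu> UNIV" by (rule \<nu>\<mu>) simp
    also have "\<dots> < \<infinity>" by (simp add: less_top[symmetric] ennreal_mult_eq_top_iff)
    finally show "emeasure \<nu> (space \<nu>) \<noteq> \<infinity>" by (simp add: space)
  qed
  then interpret \<nu>: finite_borel_measure \<nu>
    by (intro finite_borel_measure.intro finite_borel_measure_axioms.intro) (simp_all add: sets)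
  have "finite_measure \<kappa>"
  proof (rule finite_measureI)
    have "emeasure \<kappa> UNIV \<le> (\<integral>\<^sup>+t. ennreal B * indicator {0..S} t \<partial>lborel)"
      unfolding em\<kappa>[OF space_in_borel]
    proof (rule nn_integral_mono)
      fix t
      show "\<phi> t * indicator UNIV t \<le> ennreal B * indicator {0..S} t"
        using \<Phi>(2)[of t] \<Phi>(3)[of t] by (cases "S \<le> t") (auto simp: \<phi>_def indicator_def ennreal_leI)
    qed
    also have "\<dots> < \<infinity>" by (simp add: nn_integral_cmult_indicator ennreal_mult_less_top emeasure_lborel_Icc_eq)
    finally show "emeasure \<kappa> (space \<kappa>) \<noteq> \<infinity>" by (simp add: space)
  qed
  then interpret \<kappa>: finite_borel_measure \<kappa>
    by (intro finite_borel_measure.intro finite_borel_measure_axioms.intro) (simp_all add: sets)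
  have Ioc: "emeasure \<kappa> {a<..b} \<le> emeasure \<nu> {a<..b}" if "a < b" for a b
  proof (cases "0 < b")
    case False
    then have "emeasure \<kappa> {a<..b} = (\<integral>\<^sup>+t. 0 \<partial>(lborel :: real measure))"
      unfolding em\<kappa>[OF greaterThanAtMost_borel] by (intro nn_integral_cong) (auto simp: \<phi>_def indicator_def)
    then show ?thesis by simp
  next
    case True
    have "emeasure \<kappa> {a<..b} = (\<integral>\<^sup>+t. ennreal (\<Phi> t) * indicator {max a 0<..<b} t \<partial>lborel)"
      unfolding em\<kappa>[OF greaterThanAtMost_borel]
      by (intro nn_integral_cong_AE, use AE_lborel_singleton[of b] in eventually_elim) (auto simp: \<phi>_def indicator_def)
    also have "\<dots> \<le> (\<integral>\<^sup>+x. ennreal (g x) * indicator {x. max a 0 < v x \<and> v x \<le> b} x \<partial>R)"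
      using that True by (intro coarea) auto
    also have "\<dots> \<le> emeasure \<nu> {a<..b}"
      unfolding em\<nu>[OF greaterThanAtMost_borel] by (intro nn_integral_mono) (auto simp: indicator_def)
    finally show ?thesis .
  qed
  have \<kappa>\<nu>: "emeasure \<kappa> A \<le> emeasure \<nu> A" if "A \<in> sets borel" for A
    by (rule emeasure_le_of_Ioc[OF \<kappa>.finite_borel_measure_axioms \<nu>.finite_borel_measure_axioms Ioc that])
  have le: "\<kappa> \<le> \<nu>"
    using \<kappa>\<nu> by (simp add: le_measure sets)
  have ac: "absolutely_continuous \<mu> \<kappa>"
    unfolding absolutely_continuous_def
  proof
    fix A assume "A \<in> null_sets \<mu>"
    then have A: "A \<in> sets borel" "emeasure \<mu> A = 0" by (auto simp: null_sets_def sets)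
    have "emeasure \<kappa> A \<le> ennreal L * emeasure \<mu> A" using \<kappa>\<nu>[OF A(1)] \<nu>\<mu>[OF A(1)] by (rule order_trans)
    then show "A \<in> null_sets \<kappa>" using A by (simp add: null_sets_def sets)
  qed
  define F where "F = RN_deriv \<mu> \<kappa>"
  have F_meas [measurable]: "F \<in> borel_measurable borel"
    using borel_measurable_RN_deriv[of \<mu> \<kappa>] unfolding F_def measurable_cong_sets[OF sets(1) refl] .
  have densF: "density \<mu> F = \<kappa>"
    unfolding F_def using ac sets by (intro \<mu>.density_RN_deriv) auto
  \<comment> \<open>From \<open>\<kappa> \<le> \<nu> \<le> L \<mu>\<close>: integrating the excess
    of \<open>F\<close> over \<open>L\<close> on the set where it is positive gives 0.\<close>
  have F_le: "AE t in \<mu>. F t \<le> ennreal L"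
  proof -
    have FA: "F \<in> borel_measurable \<mu>" using F_meas unfolding measurable_cong_sets[OF sets(1) refl] .
    let ?A = "{t. ennreal L < F t}"
    have A: "?A \<in> sets borel" using F_meas by measurable
    have int: "(\<integral>\<^sup>+t. F t * indicator ?A t \<partial>\<mu>) = emeasure \<kappa> ?A"
      using A FA by (subst densF[symmetric]) (simp add: emeasure_density sets)
    have "(\<integral>\<^sup>+t. (F t - ennreal L) * indicator ?A t \<partial>\<mu>) = (\<integral>\<^sup>+t. F t * indicator ?A t - ennreal L * indicator ?A t \<partial>\<mu>)"
      by (intro nn_integral_cong) (auto simp: indicator_def)
    also have "\<dots> = (\<integral>\<^sup>+t. F t * indicator ?A t \<partial>\<mu>) - (\<integral>\<^sup>+t. ennreal L * indicator ?A t \<partial>\<mu>)"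
    proof (rule nn_integral_diff)
      show "(\<integral>\<^sup>+t. ennreal L * indicator ?A t \<partial>\<mu>) \<noteq> \<infinity>"
        using A \<mu>.emeasure_finite[of ?A] by (simp add: nn_integral_cmult_indicator sets ennreal_mult_eq_top_iff)
    qed (use FA A in \<open>auto simp: sets indicator_def\<close>)
    also have "\<dots> = emeasure \<kappa> ?A - ennreal L * emeasure \<mu> ?A"
      unfolding int using A by (simp add: nn_integral_cmult_indicator sets)
    also have "\<dots> = 0"
      using order_trans[OF \<kappa>\<nu>[OF A] \<nu>\<mu>[OF A]] by (intro diff_eq_0_ennreal) (auto simp: less_top[symmetric])
    finally have "AE t in \<mu>. (F t - ennreal L) * indicator ?A t = 0"
      using FA A by (subst (asm) nn_integral_0_iff_AE) (auto simp: sets)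
    then show ?thesis
      by eventually_elim (auto simp: indicator_def not_less[symmetric] dest: ennreal_minus_eq_0 split: if_splits)
  qed
  \<comment> \<open>Truncation at every point gives a real function with
    \<open>0 \<le> f t \<le> L\<close> everywhere, not only almost everywhere; the later primitives
    require this.\<close>
  define f where "f t = enn2real (min (F t) (ennreal L))" for t
  have f_meas [measurable]: "f \<in> borel_measurable borel" unfolding f_def[abs_def] by measurable
  have f: "0 \<le> f t" "f t \<le> L" for t
    using enn2real_mono[of "min (F t) (ennreal L)" "ennreal L"] \<open>0 \<le> L\<close> by (auto simp: f_def)
  have fF: "AE t in \<mu>. F t = ennreal (f t)"
    using F_le
  proof eventually_elim
    case (elim t)
    then have "F t < top" using le_less_trans[OF elim ennreal_less_top] by simp
    then show ?case using elim by (simp add: f_def min_absorb1)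
  qed
  have sub: "(\<integral>\<^sup>+t. h t * \<phi> t \<partial>lborel) = (\<integral>\<^sup>+t. h t * ennreal (f t) \<partial>\<mu>)" "(\<integral>\<^sup>+t. h t \<partial>\<kappa>) = (\<integral>\<^sup>+t. h t * ennreal (f t) \<partial>\<mu>)"
    if h: "h \<in> borel_measurable borel" for h
  proof -
    have "(\<integral>\<^sup>+t. h t \<partial>\<kappa>) = (\<integral>\<^sup>+t. F t * h t \<partial>\<mu>)"
      using h F_meas unfolding densF[symmetric]
      by (subst nn_integral_density) (simp_all add: measurable_cong_sets[OF sets(1) refl])
    also have "\<dots> = (\<integral>\<^sup>+t. h t * ennreal (f t) \<partial>\<mu>)"
      by (intro nn_integral_cong_AE, use fF in eventually_elim) (simp add: mult.commute)
    finally show *: "(\<integral>\<^sup>+t. h t \<partial>\<kappa>) = (\<integral>\<^sup>+t. h t * ennreal (f t) \<partial>\<mu>)" .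
    have "(\<integral>\<^sup>+t. h t \<partial>\<kappa>) = (\<integral>\<^sup>+t. h t * \<phi> t \<partial>lborel)"
      using h unfolding \<kappa>_def by (subst nn_integral_density) (simp_all add: mult.commute)
    then show "(\<integral>\<^sup>+t. h t * \<phi> t \<partial>lborel) = (\<integral>\<^sup>+t. h t * ennreal (f t) \<partial>\<mu>)" using * by simp
  qed
  have split: "ennreal ((1 - 1 / p) * a + 1 / p * b) = ennreal (1 - 1 / p) * ennreal a + ennreal (1 / p) * ennreal b"
    if "0 \<le> a" "0 \<le> b" for a b
  proof -
    have c: "0 \<le> 1 - 1 / p" "0 \<le> 1 / p" using \<open>1 < p\<close> by auto
    have "ennreal ((1 - 1 / p) * a + 1 / p * b) = ennreal ((1 - 1 / p) * a) + ennreal (1 / p * b)"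
      using c that by (intro ennreal_plus mult_nonneg_nonneg)
    then show ?thesis by (simp only: ennreal_mult[OF c(1) that(1)] ennreal_mult[OF c(2) that(2)])
  qed
  let ?X = "\<integral>\<^sup>+t. ennreal (f t powr p) \<partial>\<mu>" and ?Y = "\<integral>\<^sup>+x. ennreal (g x powr p) \<partial>R"
  have X_R: "?X = (\<integral>\<^sup>+x. ennreal (f (v x) powr p) \<partial>R)"
    unfolding \<mu>_def by (rule nn_integral_distr) measurable
  have "?X = (\<integral>\<^sup>+t. ennreal (f t powr (p - 1)) * ennreal (f t) \<partial>\<mu>)"
  proof (rule nn_integral_cong)
    fix t
    have "f t powr p = f t powr (p - 1) * f t"
      using powr_mult_base[of "f t" "p - 1"] f(1)[of t] by (simp add: mult.commute)
    then show "ennreal (f t powr p) = ennreal (f t powr (p - 1)) * ennreal (f t)"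
      using f(1)[of t] by (simp add: ennreal_mult)
  qed
  also have "\<dots> = (\<integral>\<^sup>+t. ennreal (f t powr (p - 1)) \<partial>\<kappa>)"
    by (rule sub(2)[symmetric]) measurable
  also have "\<dots> \<le> (\<integral>\<^sup>+t. ennreal (f t powr (p - 1)) \<partial>\<nu>)"
    using le sets by (intro nn_integral_mono_measure) auto
  also have "\<dots> = (\<integral>\<^sup>+x. ennreal (f (v x) powr (p - 1)) \<partial>density R g)"
    unfolding \<nu>_def by (rule nn_integral_distr) measurable
  also have "\<dots> = (\<integral>\<^sup>+x. ennreal (g x) * ennreal (f (v x) powr (p - 1)) \<partial>R)"
    by (rule nn_integral_density) measurable
  also have "\<dots> \<le> (\<integral>\<^sup>+x. ennreal (1 - 1 / p) * ennreal (f (v x) powr p) + ennreal (1 / p) * ennreal (g x powr p) \<partial>R)"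
  proof (rule nn_integral_mono)
    fix x
    have "ennreal (g x) * ennreal (f (v x) powr (p - 1)) = ennreal (f (v x) powr (p - 1) * g x)"
      using g(1)[of x] by (simp add: ennreal_mult mult.commute)
    also have "\<dots> \<le> ennreal ((1 - 1 / p) * f (v x) powr p + 1 / p * g x powr p)"
      using f g(1) \<open>1 < p\<close> by (intro ennreal_leI powr_young) auto
    also have "\<dots> = ennreal (1 - 1 / p) * ennreal (f (v x) powr p) + ennreal (1 / p) * ennreal (g x powr p)"
      by (rule split) auto
    finally show "ennreal (g x) * ennreal (f (v x) powr (p - 1)) \<le> ennreal (1 - 1 / p) * ennreal (f (v x) powr p) + ennreal (1 / p) * ennreal (g x powr p)" .
  qed
  also have "\<dots> = ennreal (1 - 1 / p) * ?X + ennreal (1 / p) * ?Y"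
    unfolding X_R by (simp add: nn_integral_add nn_integral_cmult)
  finally have XY: "?X \<le> ennreal (1 - 1 / p) * ?X + ennreal (1 / p) * ?Y" .
  \<comment> \<open>Finiteness of \<open>?X\<close>, from the bound \<open>L\<close> and the finite
    total mass, is what permits absorbing \<open>(1 - 1 / p) * ?X\<close> into the left
    side.\<close>
  have "?X \<le> (\<integral>\<^sup>+t. ennreal (L powr p) \<partial>\<mu>)"
    using f \<open>1 < p\<close> by (intro nn_integral_mono ennreal_leI powr_mono2) auto
  also have "\<dots> < \<infinity>" by (simp add: less_top[symmetric] ennreal_mult_eq_top_iff)
  finally obtain X where X: "0 \<le> X" "?X = ennreal X" by (cases ?X) auto
  have "?X \<le> ?Y"
  proof (cases ?Y)
    case (real Y)
    have "ennreal X \<le> ennreal ((1 - 1 / p) * X + 1 / p * Y)"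
      using XY unfolding X(2) real(2) split[OF X(1) real(1)] .
    moreover have "0 \<le> (1 - 1 / p) * X + 1 / p * Y" using X real \<open>1 < p\<close> by simp
    ultimately have "X \<le> (1 - 1 / p) * X + 1 / p * Y" by (simp add: ennreal_le_iff)
    then have "X \<le> Y" using \<open>1 < p\<close> by (simp add: field_simps)
    then show ?thesis using X real by (simp add: ennreal_leI)
  qed simp
  then show thesis
    using that[of f] f f_meas sub(1) unfolding \<phi>_def \<mu>_def by simp
qed

section \<open>The rearrangement\<close>

locale rearrangement = metric_measure M for M :: "'a::polish_space measure" +
  fixes \<Omega> :: "'a set" and N r :: real
  assumes open_\<Omega>: "open \<Omega>" and finite_\<Omega>: "emeasure M \<Omega> < \<infinity>" and N: "1 < N" and r: "0 \<le> r"
    and volume: "emeasure (m0 N) {0..r} = emeasure M \<Omega>"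
begin

abbreviation \<omega> :: real where "\<omega> \<equiv> unit_ball_vol N"

abbreviation weight :: "real \<Rightarrow> real" where "weight t \<equiv> N * \<omega> * t powr (N - 1)"

abbreviation D :: "real measure" where "D \<equiv> restrict_space (m0 N) {0..r}"

abbreviation R :: "'a measure" where "R \<equiv> restrict_space M \<Omega>"

lemma \<omega>_pos [simp]: "0 < \<omega>" using N by simp

lemma \<omega>_nonneg [simp]: "0 \<le> \<omega>" using \<omega>_pos by (rule less_imp_le)

lemma \<omega>_nonzero [simp]: "\<omega> \<noteq> 0" using \<omega>_pos by (rule less_imp_neq[THEN not_sym])

lemma space_D [simp]: "space D = {0..r}" by (auto simp: m0_def space_restrict_space)

lemma sets_D: "sets D = sets (restrict_space borel {0..r})"
proof -
  have "sets D = sets (restrict_space (restrict_space borel {0..}) {0..r})"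
    by (rule sets_restrict_space_cong) (simp add: m0_def sets_restrict_space_cong[OF sets_lborel])
  then show ?thesis by (simp add: sets_restrict_restrict_space Int_absorb1)
qed

lemma sets_D_iff: "A \<in> sets D \<longleftrightarrow> A \<in> sets borel \<and> A \<subseteq> {0..r}"
  unfolding sets_D by (subst sets_restrict_space_iff) auto

lemma borel_measurable_D: "f \<in> borel_measurable borel \<Longrightarrow> f \<in> borel_measurable D"
  unfolding measurable_cong_sets[OF sets_D refl] by (rule measurable_restrict_space1)

sublocale D: borel_carrier D
  by standard (simp only: space_D sets_D)

section \<open>Integration on the weighted interval\<close>

lemma nn_integral_D:
  assumes "h \<in> borel_measurable D"
  shows "(\<integral>\<^sup>+x. h x \<partial>D) = (\<integral>\<^sup>+x. h x * (ennreal (weight x) * indicator {0..r} x) \<partial>lborel)"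
proof -
  have D: "D = density (restrict_space lborel {0..r}) (\<lambda>x. ennreal (weight x))"
  proof (rule measure_eqI)
    show "sets D = sets (density (restrict_space lborel {0..r}) (\<lambda>x. ennreal (weight x)))"
      by (simp only: sets_D sets_density sets_restrict_space_cong[OF sets_lborel])
    fix A assume "A \<in> sets D"
    then have A: "A \<in> sets borel" "A \<subseteq> {0..r}"
      by (simp_all only: sets_D_iff)
    then have A1: "A \<in> sets (restrict_space lborel {0..})" "A \<in> sets (restrict_space lborel {0..r})"
      by (auto simp: sets_restrict_space intro!: image_eqI[of _ _ A])
    have "emeasure D A = emeasure (m0 N) A"
      using A A1 by (intro emeasure_restrict_space) (auto simp: m0_def space_restrict_space sets_restrict_space intro!: image_eqI[of _ _ "{0..r}"])
    also have "\<dots> = (\<integral>\<^sup>+x. ennreal (weight x) * indicator A x * indicator {0..} x \<partial>lborel)"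
      unfolding m0_def using A1 by (subst emeasure_density) (auto simp: nn_integral_restrict_space intro!: measurable_restrict_space1)
    also have "\<dots> = (\<integral>\<^sup>+x. ennreal (weight x) * indicator A x * indicator {0..r} x \<partial>lborel)"
      using A(2) by (intro nn_integral_cong) (auto simp: indicator_def)
    also have "\<dots> = emeasure (density (restrict_space lborel {0..r}) (\<lambda>x. ennreal (weight x))) A"
      using A1 by (subst emeasure_density) (auto simp: nn_integral_restrict_space intro!: measurable_restrict_space1)
    finally show "emeasure D A = emeasure (density (restrict_space lborel {0..r}) (\<lambda>x. ennreal (weight x))) A" .
  qed
  have "h \<in> borel_measurable (restrict_space lborel {0..r})"
    using assms by (simp add: measurable_cong_sets[OF sets_D refl] measurable_cong_sets[OF sets_restrict_space_cong[OF sets_lborel] refl])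
  then have "(\<integral>\<^sup>+x. h x \<partial>D) = (\<integral>\<^sup>+x. ennreal (weight x) * h x \<partial>restrict_space lborel {0..r})"
    unfolding D by (intro nn_integral_density) (auto intro!: measurable_restrict_space1)
  then show ?thesis
    by (simp add: nn_integral_restrict_space ac_simps)
qed

lemma AE_D_neq: "AE x in D. x \<noteq> c"
proof -
  have "{c} \<inter> {0..r} \<in> sets D" by (simp add: sets_D_iff)
  moreover have "emeasure D ({c} \<inter> {0..r}) = 0"
  proof -
    have "emeasure D ({c} \<inter> {0..r}) = (\<integral>\<^sup>+x. indicator ({c} \<inter> {0..r}) x \<partial>D)"
      by (rule nn_integral_indicator[symmetric]) (simp add: sets_D_iff)
    also have "\<dots> = (\<integral>\<^sup>+x. indicator ({c} \<inter> {0..r}) x * (ennreal (weight x) * indicator {0..r} x) \<partial>lborel)"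
      by (rule nn_integral_D) (auto intro!: borel_measurable_D)
    also have "\<dots> = (\<integral>\<^sup>+(x::real). 0 \<partial>lborel)"
      by (intro nn_integral_cong_AE, use AE_lborel_singleton[of c] in eventually_elim) (auto simp: indicator_def)
    finally show ?thesis by simp
  qed
  ultimately have "{c} \<inter> {0..r} \<in> null_sets D" by auto
  then show ?thesis by (rule AE_I') auto
qed

lemma emeasure_D_Icc:
  assumes "0 \<le> x" "x \<le> r"
  shows "emeasure D {0..x} = ennreal (\<omega> * x powr N)"
proof -
  have "emeasure D {0..x} = (\<integral>\<^sup>+y. indicator {0..x} y \<partial>D)"
    by (rule nn_integral_indicator[symmetric]) (use assms in \<open>simp add: sets_D_iff\<close>)
  also have "\<dots> = (\<integral>\<^sup>+y. indicator {0..x} y * (ennreal (weight y) * indicator {0..r} y) \<partial>lborel)"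
    by (rule nn_integral_D) (auto intro!: borel_measurable_D)
  also have "\<dots> = (\<integral>\<^sup>+y. ennreal (weight y) * indicator {0..x} y \<partial>lborel)"
    using assms by (intro nn_integral_cong) (auto simp: indicator_def)
  also have "\<dots> = ennreal (\<omega> * x powr N)"
  proof (rule nn_integral_has_integral_lebesgue')
    have "((\<lambda>y. y powr (N - 1)) has_integral x powr N / N) {0..x}"
      using has_integral_powr_from_0[of "N - 1" x] N assms by simp
    from has_integral_mult_right[OF this, of "N * \<omega>"]
    show "(weight has_integral \<omega> * x powr N) {0..x}" using N by (simp add: mult.assoc)
  qed (use N \<omega>_pos in auto)
  finally show ?thesis .
qed

lemma volume_r: "emeasure M \<Omega> = ennreal (\<omega> * r powr N)"
proof -
  have "emeasure (m0 N) {0..r} = emeasure D {0..r}"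
    by (rule emeasure_restrict_space[symmetric]) (auto simp: m0_def space_restrict_space sets_restrict_space intro!: image_eqI[of _ _ "{0..r}"])
  then show ?thesis using emeasure_D_Icc[of r] r volume by simp
qed

lemma finite_D: "finite_measure D"
  using emeasure_D_Icc[of r] r by (intro finite_measureI) simp

section \<open>Volumes of superlevel sets and the real-valued rearrangement\<close>

lemma \<Omega>_sets: "\<Omega> \<in> sets M" using open_\<Omega> by (simp add: sets_M)

lemma space_R [simp]: "space R = \<Omega>" by (simp add: space_restrict_space)

lemma emeasure_R: "A \<subseteq> \<Omega> \<Longrightarrow> emeasure R A = emeasure M A"
  using \<Omega>_sets by (intro emeasure_restrict_space) auto

lemma finite_R: "finite_measure R"
  using emeasure_R[of \<Omega>] finite_\<Omega> by (intro finite_measureI) simp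

lemma borel_measurable_R: "u \<in> borel_measurable M \<Longrightarrow> u \<in> borel_measurable R"
  by (rule measurable_restrict_space1)

lemma level_sets:
  fixes u :: "'a \<Rightarrow> real"
  assumes [measurable]: "u \<in> borel_measurable M"
  shows "{x \<in> \<Omega>. t < u x} \<in> sets M"
proof -
  have "{x \<in> space M. t < u x} \<in> sets M"
    by measurable
  then have "\<Omega> \<inter> {x \<in> space M. t < u x} \<in> sets M"
    by (rule sets.Int[OF \<Omega>_sets])
  then show ?thesis by (simp add: Int_def)
qed

lemma emeasure_level:
  assumes "u \<in> borel_measurable M"
  shows "emeasure M {x \<in> \<Omega>. t < u x} = ennreal (level_measure M \<Omega> u t)"
proof -
  have "emeasure M {x \<in> \<Omega>. t < u x} \<le> emeasure M \<Omega>"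
    using \<Omega>_sets by (intro emeasure_mono) auto
  then show ?thesis
    unfolding level_measure_def using finite_\<Omega> by (intro emeasure_eq_ennreal_measure) (auto simp: top_unique)
qed

lemma level_mono:
  assumes "v \<in> borel_measurable M" "u \<in> borel_measurable M" "s \<le> t" "\<And>x. x \<in> \<Omega> \<Longrightarrow> u x \<le> v x"
  shows "level_measure M \<Omega> u t \<le> level_measure M \<Omega> v s"
proof -
  have "emeasure M {x \<in> \<Omega>. t < u x} \<le> emeasure M {x \<in> \<Omega>. s < v x}"
    using assms level_sets[OF assms(1)] by (intro emeasure_mono) (auto intro: le_less_trans[THEN less_le_trans])
  then show ?thesis
    using assms by (simp add: emeasure_level ennreal_le_iff level_measure_def)
qed

lemma level_le: "u \<in> borel_measurable M \<Longrightarrow> level_measure M \<Omega> u t \<le> \<omega> * r powr N"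
  using emeasure_mono[of "{x \<in> \<Omega>. t < u x}" \<Omega> M] \<Omega>_sets \<omega>_pos
  by (auto simp: emeasure_level volume_r ennreal_le_iff)

text \<open>The set \<open>{u > t}\<close> is the increasing union of the sets
  \<open>{u > t + 1 / Suc n}\<close>, so a strict lower bound on its volume persists at a slightly
  higher level.\<close>

lemma level_right_cont:
  assumes u: "u \<in> borel_measurable M" and s: "s < level_measure M \<Omega> u t" "0 \<le> s"
  obtains t' where "t < t'" "s < level_measure M \<Omega> u t'"
proof -
  let ?A = "\<lambda>n. {x \<in> \<Omega>. t + 1 / real (Suc n) < u x}"
  have UN: "(\<Union>n. ?A n) = {x \<in> \<Omega>. t < u x}"
  proof (intro equalityI subsetI)
    fix x assume "x \<in> {x \<in> \<Omega>. t < u x}"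
    then have x: "x \<in> \<Omega>" "0 < u x - t" by auto
    from nat_approx_posE[OF x(2)] obtain n where "1 / real (Suc n) < u x - t" .
    then show "x \<in> (\<Union>n. ?A n)" using x by (auto intro!: exI[of _ n])
  next
    fix x assume "x \<in> (\<Union>n. ?A n)"
    then obtain n where n: "x \<in> \<Omega>" "t + 1 / real (Suc n) < u x" by blast
    have "0 < 1 / real (Suc n)" by simp
    with n(2) have "t < u x" by linarith
    then show "x \<in> {x \<in> \<Omega>. t < u x}" using n(1) by simp
  qed
  have "incseq ?A"
  proof (rule incseq_SucI, intro subsetI)
    fix n x assume "x \<in> ?A n"
    moreover have "1 / real (Suc (Suc n)) \<le> 1 / real (Suc n)" by (simp add: field_simps)
    ultimately show "x \<in> ?A (Suc n)" by (simp del: of_nat_Suc)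
  qed
  then have "(SUP n. emeasure M (?A n)) = emeasure M {x \<in> \<Omega>. t < u x}"
    unfolding UN[symmetric] using level_sets[OF u] by (intro SUP_emeasure_incseq) auto
  then have "ennreal s < (SUP n. emeasure M (?A n))"
    using s by (simp add: emeasure_level[OF u] ennreal_lessI)
  then obtain n where "ennreal s < emeasure M (?A n)"
    by (auto simp: less_SUP_iff)
  then have "s < level_measure M \<Omega> u (t + 1 / real (Suc n))"
    using s by (simp add: emeasure_level[OF u] ennreal_less_iff)
  then show thesis by (intro that[of "t + 1 / real (Suc n)"]) auto
qed

text \<open>Continuity from above, available because \<Omega> has finite measure. It makes the
  rearrangement finite at every positive radius, even for unbounded \<open>u\<close>.\<close>

lemma level_tendsto_0:
  assumes u: "u \<in> borel_measurable M" and "0 < s"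
  obtains t where "0 \<le> t" "level_measure M \<Omega> u t < s"
proof -
  let ?A = "\<lambda>n. {x \<in> \<Omega>. real n < u x}"
  have "(\<lambda>n. emeasure M (?A n)) \<longlonglongrightarrow> emeasure M (\<Inter>n. ?A n)"
    using level_sets[OF u] by (intro Lim_emeasure_decseq) (auto simp: decseq_def emeasure_level[OF u])
  moreover have "(\<Inter>n. ?A n) = {}"
  proof (intro equalityI subsetI)
    fix x assume "x \<in> (\<Inter>n. ?A n)"
    then have "real n < u x" for n by blast
    moreover obtain n where "u x < real n" using reals_Archimedean2 by blast
    ultimately show "x \<in> {}" using less_asym by blast
  qed simp
  ultimately have "\<forall>\<^sub>F n in sequentially. emeasure M (?A n) < ennreal s"
    using \<open>0 < s\<close> by (intro order_tendstoD(2)) auto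
  then obtain n where "emeasure M (?A n) < ennreal s"
    using eventually_happens'[OF sequentially_bot] by blast
  then have "level_measure M \<Omega> u (real n) < s"
    by (simp add: emeasure_level[OF u] ennreal_less_iff level_measure_def)
  then show thesis by (intro that[of "real n"]) auto
qed

text \<open>It avoids extended values. It agrees with \<open>euclidean_rearrangement\<close> at
  positive radii, and the value 0 elsewhere concerns only a null set of the interval.\<close>

definition rearr :: "('a \<Rightarrow> real) \<Rightarrow> real \<Rightarrow> real" where
  "rearr u x = (if 0 < x then Inf {t. 0 \<le> t \<and> level_measure M \<Omega> u t < \<omega> * x powr N} else 0)"

context
  fixes u :: "'a \<Rightarrow> real"
  assumes u [measurable]: "u \<in> borel_measurable M"
begin

lemma rearr_set:
  assumes "0 < x"
  shows "{t. 0 \<le> t \<and> level_measure M \<Omega> u t < \<omega> * x powr N} \<noteq> {}" "bdd_below {t. 0 \<le> t \<and> level_measure M \<Omega> u t < \<omega> * x powr N}"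
proof -
  have "0 < \<omega> * x powr N" using \<omega>_pos assms by simp
  from level_tendsto_0[OF u this] show "{t. 0 \<le> t \<and> level_measure M \<Omega> u t < \<omega> * x powr N} \<noteq> {}" by blast
  show "bdd_below {t. 0 \<le> t \<and> level_measure M \<Omega> u t < \<omega> * x powr N}" by (rule bdd_belowI[of _ 0]) auto
qed

lemma rearr_pos_eq: "0 < x \<Longrightarrow> rearr u x = Inf {t. 0 \<le> t \<and> level_measure M \<Omega> u t < \<omega> * x powr N}"
  by (simp add: rearr_def)

lemma rearr_nonneg: "0 \<le> rearr u x"
  unfolding rearr_def using rearr_set[of x] by (auto intro!: cInf_greatest)

text \<open>With \<open>rearr_greaterD\<close> this inverts the level function: strict in one
  direction, weak in the other. Nothing is claimed when \<open>\<omega> * x powr N\<close> equals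
  the level volume; for each level this is a single radius, a null set. Strictness of the conclusion
  comes from right continuity.\<close>

lemma rearr_greater: "0 < x \<Longrightarrow> \<omega> * x powr N < level_measure M \<Omega> u t \<Longrightarrow> t < rearr u x"
proof -
  assume x: "0 < x" and less: "\<omega> * x powr N < level_measure M \<Omega> u t"
  have "0 \<le> \<omega> * x powr N" using \<omega>_pos by simp
  from level_right_cont[OF u less this] obtain t' where t': "t < t'" "\<omega> * x powr N < level_measure M \<Omega> u t'" .
  have "t' \<le> rearr u x"
    unfolding rearr_pos_eq[OF x]
  proof (rule cInf_greatest[OF rearr_set(1)[OF x]])
    fix a assume "a \<in> {t. 0 \<le> t \<and> level_measure M \<Omega> u t < \<omega> * x powr N}"
    then show "t' \<le> a" using level_mono[OF u u, of a t'] t'(2) by (cases "t' \<le> a") auto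
  qed
  then show "t < rearr u x" using t'(1) by simp
qed

lemma rearr_greaterD: "0 < x \<Longrightarrow> 0 \<le> t \<Longrightarrow> t < rearr u x \<Longrightarrow> \<omega> * x powr N \<le> level_measure M \<Omega> u t"
proof (rule ccontr)
  assume x: "0 < x" and "0 \<le> t" "t < rearr u x" "\<not> \<omega> * x powr N \<le> level_measure M \<Omega> u t"
  moreover from this have "rearr u x \<le> t"
    unfolding rearr_pos_eq[OF x] using rearr_set(2) by (intro cInf_lower) auto
  ultimately show False by simp
qed

lemma rearr_antimono:
  assumes "0 < x" "x \<le> y"
  shows "rearr u y \<le> rearr u x"
proof -
  have y: "0 < y" using assms by simp
  have le: "\<omega> * x powr N \<le> \<omega> * y powr N" using N assms by (intro mult_left_mono powr_mono2) auto
  have "{t. 0 \<le> t \<and> level_measure M \<Omega> u t < \<omega> * x powr N} \<subseteq> {t. 0 \<le> t \<and> level_measure M \<Omega> u t < \<omega> * y powr N}"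
    using less_le_trans[OF _ le] by blast
  then show ?thesis
    unfolding rearr_pos_eq[OF assms(1)] rearr_pos_eq[OF y]
    by (rule cInf_superset_mono[OF rearr_set(1)[OF assms(1)] rearr_set(2)[OF y]])
qed

lemma euclidean_rearrangement_eq:
  assumes "0 < x"
  shows "euclidean_rearrangement N M \<Omega> u x = rearr u x"
proof -
  let ?A = "{t. 0 \<le> t \<and> level_measure M \<Omega> u t < \<omega> * x powr N}"
  have pos: "0 < \<omega> * x powr N" using \<omega>_pos assms by simp
  have "{ereal t | t. 0 \<le> t \<and> emeasure M {x \<in> \<Omega>. u x > t} < ennreal (\<omega> * x powr N)} = ereal ` ?A"
    by (auto simp: emeasure_level[OF u] ennreal_less_iff level_measure_def)
  moreover have "Inf (ereal ` ?A) = ereal (Inf ?A)"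
  proof (rule ereal_Inf'[symmetric])
    show "bdd_below ?A" "?A \<noteq> {}" using rearr_set[OF assms] by auto
  qed
  ultimately show ?thesis
    using pos unfolding euclidean_rearrangement_def decreasing_rearrangement_def rearr_pos_eq[OF assms]
    by (simp only: less_imp_neq[THEN not_sym] if_False real_of_ereal.simps)
qed

lemma rearr_measurable [measurable]: "rearr u \<in> borel_measurable borel"
proof -
  have "mono_on {0<..} (\<lambda>x. - rearr u x)"
    by (auto simp: mono_on_def intro: rearr_antimono)
  then have "(\<lambda>x. - rearr u x) \<in> borel_measurable (restrict_space borel {0<..})"
    by (rule borel_measurable_mono_on_fnc)
  then have "rearr u \<in> borel_measurable (restrict_space borel {0<..})"
    using borel_measurable_uminus_eq by blast
  then have "(\<lambda>x. indicator {0<..} x * rearr u x) \<in> borel_measurable borel"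
    by (subst (asm) borel_measurable_restrict_space_iff) (auto simp: mult.commute)
  moreover have "(\<lambda>x. indicator {0<..} x * rearr u x) = rearr u"
    by (auto simp: fun_eq_iff rearr_def)
  ultimately show ?thesis by simp
qed

end

end

section \<open>Equimeasurability, continuity and the integral formula for the rearrangement\<close>

context rearrangement
begin

lemma rearr_mono:
  assumes "f \<in> borel_measurable M" "g \<in> borel_measurable M" "\<And>x. x \<in> \<Omega> \<Longrightarrow> f x \<le> g x"
  shows "rearr f x \<le> rearr g x"
proof (cases "0 < x")
  case True
  have "{t. 0 \<le> t \<and> level_measure M \<Omega> g t < \<omega> * x powr N} \<subseteq> {t. 0 \<le> t \<and> level_measure M \<Omega> f t < \<omega> * x powr N}"
    using level_mono[OF assms(2,1) order_refl assms(3)] by (auto intro: le_less_trans)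
  then show ?thesis
    unfolding rearr_pos_eq[OF assms(1) True] rearr_pos_eq[OF assms(2) True]
    by (rule cInf_superset_mono[OF rearr_set(1)[OF assms(2) True] rearr_set(2)[OF assms(1) True]])
qed (simp add: rearr_def)

text \<open>For \<open>t \<ge> 0\<close> the set where \<open>rearr u\<close> exceeds
  \<open>t\<close> is, up to the radii 0 and \<open>\<rho>\<close>, the ball
  \<open>[0,\<rho>]\<close> whose volume is that of \<open>{u > t}\<close>. For negative
  \<open>t\<close> both sides are the total volumes, equal by the choice of \<open>r\<close>.
  Positive parts appear because the infimum runs over nonnegative levels.\<close>

lemma distr_rearr:
  assumes u [measurable]: "u \<in> borel_measurable M"
  shows "distr D borel (rearr u) = distr R borel (\<lambda>x. max 0 (u x))"
proof -
  interpret D: finite_measure D by (rule finite_D)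
  have mD: "rearr u \<in> borel_measurable D" by (rule borel_measurable_D[OF rearr_measurable[OF u]])
  have mR: "(\<lambda>x. max 0 (u x)) \<in> borel_measurable R" by (intro borel_measurable_R) measurable
  have tail: "emeasure D (rearr u -` {t<..} \<inter> space D) = emeasure R ((\<lambda>x. max 0 (u x)) -` {t<..} \<inter> space R)" for t
  proof (cases "t < 0")
    case True
    then have "rearr u -` {t<..} = UNIV" "(\<lambda>x. max 0 (u x)) -` {t<..} = UNIV"
      using less_le_trans[OF True rearr_nonneg[OF u]] by auto
    then show ?thesis
      using emeasure_D_Icc[of r] r emeasure_R[of \<Omega>] volume_r by simp
  next
    case False
    define l where "l = level_measure M \<Omega> u t"
    have l: "0 \<le> l" "l \<le> \<omega> * r powr N" using level_le[OF u] by (auto simp: l_def level_measure_def)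
    define \<rho> where "\<rho> = (l / \<omega>) powr (1 / N)"
    have \<rho>N: "\<omega> * \<rho> powr N = l" using l \<omega>_pos N by (simp add: \<rho>_def powr_powr)
    have \<rho>: "0 \<le> \<rho>" by (simp add: \<rho>_def)
    have \<rho>r: "\<rho> \<le> r"
    proof -
      have "\<rho> \<le> (r powr N) powr (1 / N)"
        unfolding \<rho>_def using l \<omega>_pos N by (intro powr_mono2) (auto simp: field_simps)
      then show ?thesis using r N by (simp add: powr_powr)
    qed
    have less: "x powr N < y powr N" if "0 \<le> x" "x < y" for x y :: real
      using that N by (intro powr_less_mono2) auto
    have "emeasure D (rearr u -` {t<..} \<inter> space D) = emeasure D {0..\<rho>}"
    proof (rule emeasure_eq_AE)
      show "AE x in D. x \<in> rearr u -` {t<..} \<inter> space D \<longleftrightarrow> x \<in> {0..\<rho>}"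
        using AE_D_neq[of 0] AE_D_neq[of \<rho>] AE_space
      proof eventually_elim
        case (elim x)
        then have x: "0 < x" "x \<le> r" by auto
        show ?case
        proof (cases "x < \<rho>")
          case True
          then have "\<omega> * x powr N < level_measure M \<Omega> u t"
            using mult_strict_left_mono[OF less[of x \<rho>] \<omega>_pos] x \<rho>N by (simp add: l_def[symmetric])
          then show ?thesis using True rearr_greater[OF u x(1)] x by simp
        next
          case False
          then have "\<rho> < x" using elim by simp
          then have "\<omega> * \<rho> powr N < \<omega> * x powr N" using less[of \<rho> x] \<rho> \<omega>_pos by simp
          then have "level_measure M \<Omega> u t < \<omega> * x powr N" by (simp add: \<rho>N l_def)
          then have "\<not> t < rearr u x" using rearr_greaterD[OF u x(1), of t] \<open>\<not> t < 0\<close> by auto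
          then show ?thesis using \<open>\<rho> < x\<close> by simp
        qed
      qed
      show "rearr u -` {t<..} \<inter> space D \<in> sets D" by (rule measurable_sets[OF mD]) simp
      show "{0..\<rho>} \<in> sets D" using \<rho>r by (simp add: sets_D_iff)
    qed
    also have "\<dots> = ennreal l" using emeasure_D_Icc[OF \<rho> \<rho>r] \<rho>N by simp
    also have "(\<lambda>x. max 0 (u x)) -` {t<..} \<inter> space R = {x \<in> \<Omega>. t < u x}" using False by auto
    then have "ennreal l = emeasure R ((\<lambda>x. max 0 (u x)) -` {t<..} \<inter> space R)"
      by (simp add: emeasure_R emeasure_level[OF u] l_def)
    finally show ?thesis .
  qed
  show ?thesis
  proof (rule measure_eqI_lessThan)
    fix t :: real
    show "emeasure (distr D borel (rearr u)) {t<..} < \<infinity>"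
      using mD D.emeasure_finite by (simp add: emeasure_distr less_top[symmetric])
    show "emeasure (distr D borel (rearr u)) {t<..} = emeasure (distr R borel (\<lambda>x. max 0 (u x))) {t<..}"
      using tail mD mR by (simp add: emeasure_distr)
  qed auto
qed

lemma nn_integral_rearr:
  assumes u [measurable]: "u \<in> borel_measurable M" and h: "h \<in> borel_measurable borel"
  shows "(\<integral>\<^sup>+x. h (rearr u x) \<partial>D) = (\<integral>\<^sup>+x. h (max 0 (u x)) \<partial>R)"
proof -
  have mD: "rearr u \<in> borel_measurable D" by (rule borel_measurable_D[OF rearr_measurable[OF u]])
  have mR: "(\<lambda>x. max 0 (u x)) \<in> borel_measurable R" by (intro borel_measurable_R) measurable
  have "(\<integral>\<^sup>+x. h (rearr u x) \<partial>D) = (\<integral>\<^sup>+t. h t \<partial>distr D borel (rearr u))"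
    by (rule nn_integral_distr[OF mD, symmetric]) (simp add: h)
  also have "\<dots> = (\<integral>\<^sup>+x. h (max 0 (u x)) \<partial>R)"
    unfolding distr_rearr[OF u] by (rule nn_integral_distr[OF mR]) (simp add: h)
  finally show ?thesis .
qed

text \<open>Write \<open>2 max(a, b) = \<bar>a - b\<bar> + a + b\<close> and use that the rearrangement of the maximum dominates both
  rearrangements, while all the integrals are preserved.\<close>

lemma rearr_contraction:
  assumes f [measurable]: "f \<in> borel_measurable M" and g [measurable]: "g \<in> borel_measurable M" and "1 \<le> p"
    and fin: "(\<integral>\<^sup>+x. ennreal (max 0 (f x) powr p) \<partial>R) < \<infinity>" "(\<integral>\<^sup>+x. ennreal (max 0 (g x) powr p) \<partial>R) < \<infinity>"
  shows "Lp_integral D p (\<lambda>x. rearr f x - rearr g x) \<le> (\<integral>\<^sup>+x. ennreal \<bar>max 0 (f x) powr p - max 0 (g x) powr p\<bar> \<partial>R)"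
proof -
  define h where "h x = max (f x) (g x)" for x
  have h [measurable]: "h \<in> borel_measurable M" unfolding h_def[abs_def] by measurable
  note [measurable] = borel_measurable_D[OF rearr_measurable[OF f]] borel_measurable_D[OF rearr_measurable[OF g]]
    borel_measurable_D[OF rearr_measurable[OF h]] borel_measurable_R[OF f] borel_measurable_R[OF g] borel_measurable_R[OF h]
  have fh: "rearr f x \<le> rearr h x" "rearr g x \<le> rearr h x" for x
    by (rule rearr_mono[OF f h], simp add: h_def, rule rearr_mono[OF g h], simp add: h_def)
  let ?A = "\<integral>\<^sup>+x. ennreal \<bar>rearr f x powr p - rearr g x powr p\<bar> \<partial>D"
  let ?B = "\<integral>\<^sup>+x. ennreal \<bar>max 0 (f x) powr p - max 0 (g x) powr p\<bar> \<partial>R"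
  let ?S = "(\<integral>\<^sup>+x. ennreal (max 0 (f x) powr p) \<partial>R) + (\<integral>\<^sup>+x. ennreal (max 0 (g x) powr p) \<partial>R)"
  have eq: "(\<integral>\<^sup>+x. ennreal (rearr w x powr p) \<partial>D) = (\<integral>\<^sup>+x. ennreal (max 0 (w x) powr p) \<partial>R)"
    if "w \<in> borel_measurable M" for w
    using nn_integral_rearr[OF that, of "\<lambda>t. ennreal (t powr p)"] by simp
  have max_eq: "ennreal \<bar>a - b\<bar> + (ennreal a + ennreal b) = 2 * ennreal (max a b)" if "0 \<le> a" "0 \<le> b" for a b :: real
  proof -
    have "ennreal \<bar>a - b\<bar> + (ennreal a + ennreal b) = ennreal (2 * max a b)"
      using that by (simp add: ennreal_plus[symmetric] max_def abs_if del: ennreal_plus)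
    also have "\<dots> = 2 * ennreal (max a b)" using that by (subst ennreal_mult) auto
    finally show ?thesis .
  qed
  have "?A + ?S = (\<integral>\<^sup>+x. ennreal \<bar>rearr f x powr p - rearr g x powr p\<bar> + (ennreal (rearr f x powr p) + ennreal (rearr g x powr p)) \<partial>D)"
    by (simp add: nn_integral_add eq[OF f] eq[OF g])
  also have "\<dots> \<le> (\<integral>\<^sup>+x. 2 * ennreal (rearr h x powr p) \<partial>D)"
  proof (rule nn_integral_mono)
    fix x
    have "max (rearr f x powr p) (rearr g x powr p) \<le> rearr h x powr p"
      using fh[of x] rearr_nonneg[OF f, of x] rearr_nonneg[OF g, of x] \<open>1 \<le> p\<close> by (auto intro!: powr_mono2)
    then have "2 * ennreal (max (rearr f x powr p) (rearr g x powr p)) \<le> 2 * ennreal (rearr h x powr p)"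
      by (intro mult_left_mono ennreal_leI) auto
    then show "ennreal \<bar>rearr f x powr p - rearr g x powr p\<bar> + (ennreal (rearr f x powr p) + ennreal (rearr g x powr p)) \<le> 2 * ennreal (rearr h x powr p)"
      by (subst max_eq) auto
  qed
  also have "\<dots> = 2 * (\<integral>\<^sup>+x. ennreal (max 0 (h x) powr p) \<partial>R)"
    by (simp add: nn_integral_cmult eq[OF h])
  also have "\<dots> = (\<integral>\<^sup>+x. 2 * ennreal (max 0 (h x) powr p) \<partial>R)"
    by (simp add: nn_integral_cmult)
  also have "\<dots> = (\<integral>\<^sup>+x. ennreal \<bar>max 0 (f x) powr p - max 0 (g x) powr p\<bar> + (ennreal (max 0 (f x) powr p) + ennreal (max 0 (g x) powr p)) \<partial>R)"
  proof (rule nn_integral_cong)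
    fix x
    have "max 0 (h x) powr p = max (max 0 (f x) powr p) (max 0 (g x) powr p)"
    proof (cases "max 0 (f x) \<le> max 0 (g x)")
      case True
      then have "max 0 (f x) powr p \<le> max 0 (g x) powr p" using \<open>1 \<le> p\<close> by (intro powr_mono2) auto
      moreover have "max 0 (h x) = max 0 (g x)" using True by (auto simp: h_def max_def split: if_splits)
      ultimately show ?thesis by (simp add: max_def)
    next
      case False
      then have "max 0 (g x) powr p \<le> max 0 (f x) powr p" using \<open>1 \<le> p\<close> by (intro powr_mono2) auto
      moreover have "max 0 (h x) = max 0 (f x)" using False by (auto simp: h_def max_def split: if_splits)
      ultimately show ?thesis by (simp add: max_def)
    qed
    then show "2 * ennreal (max 0 (h x) powr p) = ennreal \<bar>max 0 (f x) powr p - max 0 (g x) powr p\<bar> + (ennreal (max 0 (f x) powr p) + ennreal (max 0 (g x) powr p))"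
      by (subst max_eq) auto
  qed
  also have "\<dots> = ?B + ?S"
    by (simp add: nn_integral_add)
  finally have "?A + ?S \<le> ?B + ?S" .
  moreover have "?S < top" using fin by simp
  \<comment> \<open>The common summand \<open>?S\<close> can be cancelled in \<open>ennreal\<close>
    since it is finite.\<close>
  ultimately have "?A \<le> ?B"
    by (auto simp: add.commute[of _ ?S] ennreal_add_left_cancel_le)
  moreover have "Lp_integral D p (\<lambda>x. rearr f x - rearr g x) \<le> ?A"
    unfolding Lp_integral_def
    using powr_abs_diff_le[OF rearr_nonneg[OF f] rearr_nonneg[OF g] \<open>1 \<le> p\<close>] by (intro nn_integral_mono ennreal_leI)
  ultimately show ?thesis by simp
qed

lemma level_measurable:
  assumes v: "v \<in> borel_measurable M"
  shows "level_measure M \<Omega> v \<in> borel_measurable borel"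
proof -
  have "mono (\<lambda>t. - level_measure M \<Omega> v t)"
    by (intro monoI) (simp add: level_mono[OF v v])
  then have "(\<lambda>t. - level_measure M \<Omega> v t) \<in> borel_measurable borel" by (rule borel_measurable_mono)
  then show ?thesis by simp
qed

text \<open>Levels on which the rearrangement has a plateau carry no density \<open>f\<close>; at all other points \<open>y\<close> the
  superlevel set of the level \<open>rearr v y\<close> has exactly the volume of the ball of radius \<open>y\<close>.\<close>

lemma rearr_formula:
  assumes v [measurable]: "v \<in> borel_measurable M" and "\<And>x. 0 \<le> v x" and "0 < C"
    and [measurable]: "f \<in> borel_measurable borel" and f: "\<And>t. 0 \<le> f t"
    and dens: "\<And>h. h \<in> borel_measurable borel \<Longrightarrow>
      (\<integral>\<^sup>+t. h t * (ennreal (C * level_measure M \<Omega> v t powr ((N - 1) / N)) * indicator {0<..} t) \<partial>lborel)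
        = (\<integral>\<^sup>+t. h t * ennreal (f t) \<partial>distr R borel v)"
    and x: "0 < x" "x \<le> r"
  shows "ennreal (rearr v x - rearr v r) =
    (\<integral>\<^sup>+y. ennreal (f (rearr v y) / (C / (N * \<omega> powr (1 / N)))) * indicator {x..r} y \<partial>lborel)"
proof -
  define V where "V = rearr v"
  define c where "c = C / (N * \<omega> powr (1 / N))"
  define \<Phi> where "\<Phi> t = C * level_measure M \<Omega> v t powr ((N - 1) / N)" for t
  have c: "0 < c" using \<open>0 < C\<close> N \<omega>_pos by (simp add: c_def)
  have mV [measurable]: "V \<in> borel_measurable borel" unfolding V_def by (rule rearr_measurable[OF v])
  have mVD: "V \<in> borel_measurable D" by (rule borel_measurable_D) measurable
  have m\<Phi> [measurable]: "\<Phi> \<in> borel_measurable borel"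
    unfolding \<Phi>_def[abs_def] using level_measurable[OF v] by measurable
  have "distr R borel v = distr D borel V"
    unfolding V_def using distr_rearr[OF v] assms(2) by (simp add: max_absorb2)
  then have dens': "(\<integral>\<^sup>+t. h t * (ennreal (\<Phi> t) * indicator {0<..} t) \<partial>lborel) = (\<integral>\<^sup>+y. h (V y) * ennreal (f (V y)) \<partial>D)"
    if [measurable]: "h \<in> borel_measurable borel" for h
  proof -
    have "(\<integral>\<^sup>+t. h t * ennreal (f t) \<partial>distr D borel V) = (\<integral>\<^sup>+y. h (V y) * ennreal (f (V y)) \<partial>D)"
      by (rule nn_integral_distr[OF mVD]) simp
    then show ?thesis using dens[OF that] \<open>distr R borel v = distr D borel V\<close> by (simp add: \<Phi>_def)
  qed
  have anti: "V z \<le> V y" if "0 < y" "y \<le> z" for y z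
    unfolding V_def by (rule rearr_antimono[OF v that])
  \<comment> \<open>A single level is Lebesgue null, so testing \<open>dens'\<close> with
    \<open>indicator {t}\<close> shows that \<open>f t\<close> times the weighted measure of
    \<open>{V = t}\<close> is 0. If \<open>V\<close> equals \<open>t\<close> on an interval, that
    measure is positive and \<open>f t = 0\<close>.\<close>
  have plateau: "f t = 0" if yz: "0 \<le> y" "y < z" "z \<le> r" and t: "\<And>q. y < q \<Longrightarrow> q < z \<Longrightarrow> V q = t" for y z t
  proof -
    have "(\<integral>\<^sup>+s. indicator {t} s * (ennreal (\<Phi> s) * indicator {0<..} s) \<partial>lborel) = (\<integral>\<^sup>+(s::real). 0 \<partial>lborel)"
      by (intro nn_integral_cong_AE, use AE_lborel_singleton[of t] in eventually_elim) (auto simp: indicator_def)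
    then have zero: "(\<integral>\<^sup>+q. indicator {t} (V q) * ennreal (f (V q)) \<partial>D) = 0"
      using dens'[of "indicator {t}"] by simp
    have "(\<integral>\<^sup>+q. indicator {t} (V q) * ennreal (f (V q)) \<partial>D) = 0 \<longleftrightarrow>
        (AE q in lborel. indicator {t} (V q) * ennreal (f (V q)) * (ennreal (weight q) * indicator {0..r} q) = 0)"
      by (subst nn_integral_D, intro borel_measurable_D, measurable, subst nn_integral_0_iff_AE, measurable)
    then have AE: "AE q in lborel. indicator {t} (V q) * ennreal (f (V q)) * (ennreal (weight q) * indicator {0..r} q) = 0"
      using zero by simp
    show ?thesis
    proof (rule ccontr)
      assume "f t \<noteq> 0"
      then have "0 < f t" using f[of t] by simp
      have "AE q in lborel. q \<notin> {y<..<z}"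
        using AE
      proof eventually_elim
        case (elim q)
        show ?case
        proof
          assume q: "q \<in> {y<..<z}"
          then have "V q = t" "q \<noteq> 0" "q \<in> {0..r}"
            using t yz by auto
          then show False using elim \<open>0 < f t\<close> N \<omega>_pos[unfolded not_le[symmetric]] by (auto simp: ennreal_mult_eq_top_iff ennreal_eq_0_iff mult_le_0_iff)
        qed
      qed
      then have "{y<..<z} \<in> null_sets lborel" by (subst AE_iff_null_sets) auto
      then show False using yz by (simp add: null_sets_def)
    qed
  qed
  have level_eq: "level_measure M \<Omega> v (V y) = \<omega> * y powr N" if y: "0 < y" "y \<le> r" "f (V y) \<noteq> 0" for y
  proof (rule antisym)
    show "level_measure M \<Omega> v (V y) \<le> \<omega> * y powr N"
      using rearr_greater[OF v y(1), of "V y"] unfolding V_def by (meson less_irrefl not_le)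
    show "\<omega> * y powr N \<le> level_measure M \<Omega> v (V y)"
    proof (rule ccontr)
      let ?l = "level_measure M \<Omega> v (V y)"
      assume "\<not> ?thesis"
      then have l: "?l < \<omega> * y powr N" by simp
      \<comment> \<open>The radius of the ball of volume \<open>?l\<close>. At radii between
        \<open>\<rho>\<close> and \<open>y\<close> the value of \<open>V\<close> cannot exceed
        \<open>V y\<close>, since the superlevel set of \<open>V y\<close> is too small, nor be
        below it, by monotonicity: this is a plateau.\<close>
      define \<rho> where "\<rho> = (?l / \<omega>) powr (1 / N)"
      have "0 \<le> ?l" by (simp add: level_measure_def)
      then have \<rho>N: "\<omega> * \<rho> powr N = ?l" using \<omega>_pos N by (simp add: \<rho>_def powr_powr)
      have "\<rho> < (y powr N) powr (1 / N)"
        unfolding \<rho>_def using l \<omega>_pos N \<open>0 \<le> ?l\<close> by (intro powr_less_mono2) (auto simp: field_simps)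
      then have "\<rho> < y" using y N by (simp add: powr_powr)
      have "f (V y) = 0"
      proof (rule plateau[OF _ \<open>\<rho> < y\<close> y(2)])
        show "0 \<le> \<rho>" by (simp add: \<rho>_def)
        fix q assume q: "\<rho> < q" "q < y"
        then have "0 < q" using \<open>0 \<le> \<rho>\<close> by simp
        have "\<omega> * \<rho> powr N < \<omega> * q powr N"
          using q \<open>0 \<le> \<rho>\<close> N \<omega>_pos by (intro mult_strict_left_mono powr_less_mono2) auto
        then have "\<not> V y < V q"
          using rearr_greaterD[OF v \<open>0 < q\<close>, of "V y"] rearr_nonneg[OF v] \<rho>N by (auto simp: V_def)
        then show "V q = V y" using anti[OF \<open>0 < q\<close>, of y] q by simp
      qed
      then show False using y by simp
    qed
  qed
  \<comment> \<open>The origin of the constant: \<open>C\<close> times the volume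
    \<open>\<omega> * y powr N\<close> raised to \<open>(N - 1) / N\<close> is \<open>c\<close>
    times the weight of the interval at \<open>y\<close>.\<close>
  have \<Phi>_eq: "\<Phi> (V y) = c * weight y" if y: "0 < y" "y \<le> r" "f (V y) \<noteq> 0" for y
  proof -
    have "\<Phi> (V y) = C * (\<omega> powr ((N - 1) / N) * y powr (N - 1))"
      unfolding \<Phi>_def level_eq[OF y] using y N \<omega>_pos by (simp add: powr_mult powr_powr)
    also have "\<omega> powr ((N - 1) / N) = \<omega> / \<omega> powr (1 / N)"
      using N \<omega>_pos by (simp add: diff_divide_distrib powr_diff)
    finally show ?thesis using N by (simp add: c_def)
  qed
  define a b where "a = V r" and "b = V x"
  have ab: "0 \<le> a" "a \<le> b" unfolding a_def b_def using anti[OF x] rearr_nonneg[OF v] by (simp_all add: V_def)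
  have \<Phi>_pos: "0 < \<Phi> t" if "a < t" "t < b" for t
  proof -
    have "\<omega> * x powr N \<le> level_measure M \<Omega> v t"
      using rearr_greaterD[OF v x(1), of t] that ab by (simp add: b_def V_def)
    moreover have "0 < \<omega> * x powr N" using x \<omega>_pos by simp
    ultimately have "0 < level_measure M \<Omega> v t" by linarith
    then show ?thesis using \<open>0 < C\<close> by (simp add: \<Phi>_def)
  qed
  \<comment> \<open>Testing with the inverse of \<open>\<Phi>\<close> on \<open>(a,b)\<close> gives
    \<open>b - a\<close> on the side of the levels. On the side of radii, \<open>\<Phi>_eq\<close>
    cancels the weight and leaves \<open>f (V y) / c\<close>.\<close>
  define h where "h t = ennreal (1 / \<Phi> t) * indicator {a<..<b} t" for t
  have h [measurable]: "h \<in> borel_measurable borel" unfolding h_def[abs_def] by measurable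
  have "ennreal (b - a) = (\<integral>\<^sup>+t. indicator {a<..<b} t \<partial>lborel)" using ab by simp
  also have "\<dots> = (\<integral>\<^sup>+t. h t * (ennreal (\<Phi> t) * indicator {0<..} t) \<partial>lborel)"
  proof (rule nn_integral_cong)
    fix t
    show "indicator {a<..<b} t = h t * (ennreal (\<Phi> t) * indicator {0<..} t)"
    proof (cases "t \<in> {a<..<b}")
      case True
      then have "0 < \<Phi> t" "0 < t" using \<Phi>_pos ab by auto
      then have "ennreal (1 / \<Phi> t) * ennreal (\<Phi> t) = 1" by (subst ennreal_mult[symmetric]) auto
      then show ?thesis using True \<open>0 < t\<close> by (simp add: h_def)
    qed (simp add: h_def)
  qed
  also have "\<dots> = (\<integral>\<^sup>+y. h (V y) * ennreal (f (V y)) \<partial>D)" by (rule dens'[OF h])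
  also have "\<dots> = (\<integral>\<^sup>+y. h (V y) * ennreal (f (V y)) * (ennreal (weight y) * indicator {0..r} y) \<partial>lborel)"
    by (rule nn_integral_D, intro borel_measurable_D) measurable
  also have "\<dots> = (\<integral>\<^sup>+y. ennreal (f (V y) / c) * indicator {x..r} y \<partial>lborel)"
  proof (intro nn_integral_cong_AE, use AE_lborel_singleton[of 0] AE_lborel_singleton[of x] AE_lborel_singleton[of r] in eventually_elim)
    case (elim y)
    show ?case
    proof (cases "y \<in> {0..r} \<and> f (V y) \<noteq> 0")
      case False
      then show ?thesis using x by (auto simp: indicator_def)
    next
      case True
      then have y: "0 < y" "y < r" "f (V y) \<noteq> 0" using elim by auto
      show ?thesis
      proof (cases "x < y")
        case False
        then have "b \<le> V y" using anti[OF y(1), of x] by (simp add: b_def)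
        then show ?thesis using False elim by (simp add: h_def)
      next
        case True
        \<comment> \<open>If \<open>V y\<close> were one of the end values \<open>a\<close> and
          \<open>b\<close>, monotonicity would make \<open>V\<close> constant on
          \<open>(y,r)\<close> or on \<open>(x,y)\<close>, and by \<open>plateau\<close> the density
          would vanish at that value.\<close>
        have "V y \<noteq> a"
        proof
          assume eq: "V y = a"
          have "f a = 0"
            by (rule plateau[of y r]) (use y anti[of y] anti[of _ r] eq in \<open>auto simp: a_def intro!: antisym\<close>)
          then show False using y eq by simp
        qed
        moreover have "V y \<noteq> b"
        proof
          assume eq: "V y = b"
          have "f b = 0"
            by (rule plateau[of x y]) (use x y True anti[of x] anti[of _ y] eq in \<open>auto simp: b_def intro!: antisym\<close>)
          then show False using y eq by simp
        qed
        moreover have "a \<le> V y" "V y \<le> b" using anti[of y r] anti[of x y] x y True by (simp_all add: a_def b_def)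
        ultimately have V: "V y \<in> {a<..<b}" by auto
        have w: "0 < weight y" using y N \<omega>_pos by simp
        have "h (V y) * ennreal (f (V y)) * ennreal (weight y) = ennreal (1 / (c * weight y) * f (V y) * weight y)"
          using V \<Phi>_eq[of y] y w c f[of "V y"] by (simp add: h_def ennreal_mult[symmetric] del: times_divide_eq_left)
        also have "1 / (c * weight y) * f (V y) * weight y = f (V y) / c" using c N y by (simp add: field_simps)
        finally show ?thesis using y True by simp
      qed
    qed
  qed
  finally show ?thesis unfolding a_def b_def V_def c_def .
qed

end

section \<open>Approximation of primitives\<close>

lemma AE_lborel_negligible:
  fixes Z :: "real set"
  assumes "negligible Z"
  shows "AE x in lborel. x \<notin> Z"
  using assms by (simp add: negligible_iff_null_sets AE_not_in flip: AE_completion_iff[of _ lborel])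

lemma integral_Icc_bounds:
  fixes k :: "real \<Rightarrow> real"
  assumes "continuous_on UNIV k" "a \<le> b" "\<And>z. 0 \<le> k z" "\<And>z. z \<in> {a..b} \<Longrightarrow> k z \<le> m"
  shows "0 \<le> integral {a..b} k" "integral {a..b} k \<le> m * (b - a)"
proof -
  have int: "k integrable_on {a..b}"
    using assms(1) by (intro integrable_continuous_interval) (auto intro: continuous_on_subset)
  show "0 \<le> integral {a..b} k"
    by (rule Henstock_Kurzweil_Integration.integral_nonneg[OF int]) (simp add: assms)
  have "integral {a..b} k \<le> integral {a..b} (\<lambda>_. m)"
    by (rule integral_le[OF int]) (use assms in auto)
  then show "integral {a..b} k \<le> m * (b - a)" using assms(2) by (simp add: mult.commute)
qed

context rearrangement
begin

text \<open>For a continuous density the slope is bounded by \<open>k x\<close> at every point, as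
  \<open>k \<le> k x + e\<close> near \<open>x\<close>. For a density that is merely measurable such
  a bound would require Lebesgue differentiation, hence the detour through continuous
  approximations.\<close>

lemma primitive_Lip:
  fixes k :: "real \<Rightarrow> real" and q B x :: real
  assumes k: "continuous_on UNIV k" "\<And>z. 0 \<le> k z" "\<And>z. k z \<le> B"
  defines "w \<equiv> \<lambda>x. q + integral {x..r} k"
  shows "w \<in> Lip D" "x \<in> {0..r} \<Longrightarrow> lip D w x \<le> k x"
proof -
  have int: "k integrable_on {a..b}" for a b
    using k(1) by (intro integrable_continuous_interval) (auto intro: continuous_on_subset)
  have diff: "w x - w y = integral {x..y} k" if "x \<le> y" "y \<le> r" for x y
    using Henstock_Kurzweil_Integration.integral_combine[OF that int] by (simp add: w_def)
  have bound: "\<bar>w x - w y\<bar> \<le> m * \<bar>x - y\<bar>"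
    if "x \<le> r" "y \<le> r" "\<And>z. z \<in> {min x y..max x y} \<Longrightarrow> k z \<le> m" for x y m
  proof (cases "x \<le> y")
    case True
    then show ?thesis
      using diff[OF True that(2)] integral_Icc_bounds[OF k(1) True k(2), of m] that(3) by (simp add: min_def max_def)
  next
    case False
    then show ?thesis
      using diff[of y x] integral_Icc_bounds[OF k(1) _ k(2), of y x m] that by (simp add: min_def max_def abs_minus_commute)
  qed
  show "w \<in> Lip D"
  proof (rule Lip_I)
    fix x y assume "x \<in> space D" "y \<in> space D"
    then show "\<bar>w x - w y\<bar> \<le> B * dist x y"
      unfolding dist_real_def by (intro bound k(3)) simp_all
  qed
  show "lip D w x \<le> k x" if x: "x \<in> {0..r}"
  proof (rule field_le_epsilon)
    fix e :: real assume "0 < e"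
    have "isCont k x" using k(1) by (simp add: continuous_on_eq_continuous_at)
    then have "\<exists>d>0. \<forall>z. \<bar>z - x\<bar> < d \<longrightarrow> \<bar>k z - k x\<bar> < e"
      using \<open>0 < e\<close> unfolding continuous_at_real_range by simp
    then obtain d where d: "0 < d" "\<forall>z. \<bar>z - x\<bar> < d \<longrightarrow> \<bar>k z - k x\<bar> < e" by (elim exE conjE)
    show "lip D w x \<le> k x + e"
    proof (rule lip_le)
      show "0 \<le> k x + e" using k(2)[of x] \<open>0 < e\<close> by simp
      show "\<forall>\<^sub>F y in at x within space D. \<bar>w y - w x\<bar> \<le> (k x + e) * dist x y"
        unfolding eventually_at
      proof (intro exI[of _ d] conjI ballI impI)
        fix y assume "y \<in> space D" "y \<noteq> x \<and> dist y x < d"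
        then have y: "y \<le> r" "\<bar>y - x\<bar> < d" by (auto simp: dist_real_def)
        have "k z \<le> k x + e" if "z \<in> {min y x..max y x}" for z
        proof -
          have "\<bar>z - x\<bar> < d" using that y(2) by (auto simp: min_def max_def split: if_splits)
          then have "\<bar>k z - k x\<bar> < e" using d(2) by simp
          then show ?thesis by linarith
        qed
        then show "\<bar>w y - w x\<bar> \<le> (k x + e) * dist x y"
          using bound[of y x "k x + e"] x y by (simp add: dist_real_def abs_minus_commute)
      qed (rule d)
    qed
  qed
qed

text \<open>A measurable \<open>G\<close> is an almost everywhere limit of continuous functions.
  Clipped to the range of \<open>G\<close>, these converge in \<open>L\<^sup>1\<close> on the
  interval, so their primitives converge uniformly to \<open>V\<close> at positive radii, and by
  dominated convergence their energies converge too.\<close>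

lemma primitive_approx:
  assumes [measurable]: "V \<in> borel_measurable borel" "G \<in> borel_measurable borel"
    and V: "\<And>x. 0 < x \<Longrightarrow> x \<le> r \<Longrightarrow> V r \<le> V x"
      "\<And>x. 0 < x \<Longrightarrow> x \<le> r \<Longrightarrow> ennreal (V x - V r) = (\<integral>\<^sup>+y. ennreal (G y) * indicator {x..r} y \<partial>lborel)"
    and G: "\<And>y. 0 \<le> G y" "\<And>y. G y \<le> B" and "1 < p" "0 < \<epsilon>"
  obtains w where "w \<in> Lp D p \<inter> Lip D" "Lp_integral D p (\<lambda>x. w x - V x) \<le> ennreal \<epsilon>"
    "Lp_integral D p (lip D w) \<le> Lp_integral D p G + ennreal \<epsilon>"
proof -
  have B: "0 \<le> B" using G(1,2)[of 0] by linarith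
  have "G \<in> borel_measurable lebesgue" by (rule measurable_completion) simp
  then have "G measurable_on UNIV"
    by (rule lebesgue_measurable_imp_measurable_on_real) simp
  then obtain Z g where Z: "negligible Z" and g: "\<forall>n. continuous_on UNIV (g n)" "\<forall>x. x \<notin> Z \<longrightarrow> (\<lambda>n. g n x) \<longlonglongrightarrow> (if x \<in> UNIV then G x else 0)"
    unfolding measurable_on_def by blast
  define k where "k n x = min B (max 0 (g n x))" for n :: nat and x :: real
  have k: "continuous_on UNIV (k n)" "0 \<le> k n z" "k n z \<le> B" for n z
    using g(1) B unfolding k_def by (auto intro!: continuous_intros)
  have [measurable]: "k n \<in> borel_measurable borel" for n
    using k(1) by (rule borel_measurable_continuous_onI)
  have k_lim: "AE x in lborel. (\<lambda>n. k n x) \<longlonglongrightarrow> G x"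
    using AE_lborel_negligible[OF Z]
  proof eventually_elim
    case (elim x)
    then have "(\<lambda>n. k n x) \<longlonglongrightarrow> min B (max 0 (G x))"
      unfolding k_def using g(2) by (intro tendsto_intros) auto
    then show ?case using G[of x] by (simp add: min_absorb2 max_absorb2)
  qed
  define \<delta> where "\<delta> n = (\<integral>\<^sup>+y. ennreal \<bar>k n y - G y\<bar> * indicator {0..r} y \<partial>lborel)" for n
  have "\<delta> \<longlonglongrightarrow> (\<integral>\<^sup>+(y::real). 0 \<partial>lborel)"
    unfolding \<delta>_def
  proof (rule nn_integral_dominated_convergence[where w = "\<lambda>y. ennreal B * indicator {0..r} y"])
    show "(\<integral>\<^sup>+y. ennreal B * indicator {0..r} y \<partial>lborel) < \<infinity>"
      by (simp add: nn_integral_cmult_indicator ennreal_mult_less_top emeasure_lborel_Icc_eq)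
    show "AE y in lborel. ennreal \<bar>k n y - G y\<bar> * indicator {0..r} y \<le> ennreal B * indicator {0..r} y" for n
    proof (intro AE_I2 mult_right_mono ennreal_leI)
      fix y show "\<bar>k n y - G y\<bar> \<le> B" using k(2,3)[of n y] G[of y] by linarith
    qed simp
    show "AE y in lborel. (\<lambda>n. ennreal \<bar>k n y - G y\<bar> * indicator {0..r} y) \<longlonglongrightarrow> 0"
      using k_lim
    proof eventually_elim
      case (elim y)
      then have "(\<lambda>n. ennreal \<bar>k n y - G y\<bar>) \<longlonglongrightarrow> ennreal \<bar>G y - G y\<bar>"
        by (intro tendsto_ennrealI tendsto_intros)
      then show ?case by (cases "y \<in> {0..r}") auto
    qed
  qed measurable
  then have \<delta>_lim: "\<delta> \<longlonglongrightarrow> 0" by simp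
  have wt_fin: "(\<integral>\<^sup>+x. ennreal (weight x) * indicator {0..r} x \<partial>lborel) < \<infinity>"
  proof -
    have "(\<integral>\<^sup>+x. ennreal (weight x) * indicator {0..r} x \<partial>lborel) = emeasure D {0..r}"
      using nn_integral_D[of "\<lambda>_. 1"] by simp
    then show ?thesis using emeasure_D_Icc[of r] r by simp
  qed
  have "(\<lambda>n. Lp_integral D p (k n)) \<longlonglongrightarrow> Lp_integral D p G"
  proof -
    have eq: "Lp_integral D p h = (\<integral>\<^sup>+x. ennreal (\<bar>h x\<bar> powr p) * (ennreal (weight x) * indicator {0..r} x) \<partial>lborel)"
      if [measurable]: "h \<in> borel_measurable borel" for h
      unfolding Lp_integral_def by (rule nn_integral_D, intro borel_measurable_D) measurable
    show ?thesis
      unfolding eq[OF \<open>G \<in> borel_measurable borel\<close>] eq[OF \<open>k _ \<in> borel_measurable borel\<close>]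
    proof (rule nn_integral_dominated_convergence[where w = "\<lambda>x. ennreal (B powr p) * (ennreal (weight x) * indicator {0..r} x)"])
      show "(\<integral>\<^sup>+x. ennreal (B powr p) * (ennreal (weight x) * indicator {0..r} x) \<partial>lborel) < \<infinity>"
        using wt_fin by (subst nn_integral_cmult) (auto simp: ennreal_mult_less_top)
      show "AE x in lborel. ennreal (\<bar>k n x\<bar> powr p) * (ennreal (weight x) * indicator {0..r} x) \<le> ennreal (B powr p) * (ennreal (weight x) * indicator {0..r} x)" for n
        using k(2,3) \<open>1 < p\<close> by (intro AE_I2 mult_right_mono ennreal_leI powr_mono2) auto
      show "AE x in lborel. (\<lambda>n. ennreal (\<bar>k n x\<bar> powr p) * (ennreal (weight x) * indicator {0..r} x)) \<longlonglongrightarrow> ennreal (\<bar>G x\<bar> powr p) * (ennreal (weight x) * indicator {0..r} x)"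
        using k_lim
      proof eventually_elim
        case (elim x)
        have "(\<lambda>n. ennreal (\<bar>k n x\<bar> powr p)) \<longlonglongrightarrow> ennreal (\<bar>G x\<bar> powr p)"
          using elim \<open>1 < p\<close> by (intro tendsto_ennrealI tendsto_powr' tendsto_intros) auto
        then have "(\<lambda>n. (ennreal (weight x) * indicator {0..r} x) * ennreal (\<bar>k n x\<bar> powr p)) \<longlonglongrightarrow> (ennreal (weight x) * indicator {0..r} x) * ennreal (\<bar>G x\<bar> powr p)"
          by (intro ennreal_tendsto_cmult) (auto simp: indicator_def)
        then show ?case by (simp only: mult.commute)
      qed
    qed measurable
  qed
  moreover have G_fin: "Lp_integral D p G < \<infinity>"
  proof -
    have "Lp_integral D p G \<le> (\<integral>\<^sup>+x. ennreal (B powr p) \<partial>D)"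
      unfolding Lp_integral_def using G \<open>1 < p\<close> by (intro nn_integral_mono ennreal_leI powr_mono2) auto
    also have "\<dots> < \<infinity>" using emeasure_D_Icc[of r] r by (simp add: ennreal_mult_less_top)
    finally show ?thesis .
  qed
  ultimately have "\<forall>\<^sub>F n in sequentially. Lp_integral D p (k n) < Lp_integral D p G + ennreal \<epsilon>"
    using \<open>0 < \<epsilon>\<close> by (intro order_tendstoD(2)) (auto simp: ennreal_add_left_cancel_less less_top)
  moreover
  \<comment> \<open>A uniform error \<open>\<eta>\<close> on total volume
    \<open>\<omega> * r powr N\<close> costs at most \<open>\<epsilon>\<close> in p-th power. The
    added 1 covers the degenerate interval \<open>r = 0\<close>.\<close>
  define \<eta> where "\<eta> = (\<epsilon> / (\<omega> * r powr N + 1)) powr (1 / p)"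
  have vol: "0 < \<omega> * r powr N + 1" by (simp add: add_nonneg_pos)
  have \<eta>: "0 < \<eta>" "\<eta> powr p * (\<omega> * r powr N) \<le> \<epsilon>"
  proof -
    show "0 < \<eta>" using \<open>0 < \<epsilon>\<close> vol by (simp add: \<eta>_def)
    have "\<eta> powr p = \<epsilon> / (\<omega> * r powr N + 1)" using \<open>0 < \<epsilon>\<close> vol \<open>1 < p\<close> by (simp add: \<eta>_def powr_powr)
    then have "\<eta> powr p * (\<omega> * r powr N + 1) = \<epsilon>" using vol by simp
    moreover have "\<eta> powr p * (\<omega> * r powr N) \<le> \<eta> powr p * (\<omega> * r powr N + 1)" by (intro mult_left_mono) auto
    ultimately show "\<eta> powr p * (\<omega> * r powr N) \<le> \<epsilon>" by simp
  qed
  have "\<forall>\<^sub>F n in sequentially. \<delta> n < ennreal \<eta>"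
    using \<eta>(1) by (rule ennreal_tendsto_0D[OF \<delta>_lim])
  ultimately have "\<forall>\<^sub>F n in sequentially. Lp_integral D p (k n) < Lp_integral D p G + ennreal \<epsilon> \<and> \<delta> n < ennreal \<eta>"
    by eventually_elim simp
  then obtain n where n: "Lp_integral D p (k n) < Lp_integral D p G + ennreal \<epsilon>" "\<delta> n < ennreal \<eta>"
    using eventually_happens'[OF sequentially_bot] by blast
  define w where "w x = V r + integral {x..r} (k n)" for x
  have w: "w \<in> Lip D" "\<And>x. x \<in> {0..r} \<Longrightarrow> lip D w x \<le> k n x"
    using primitive_Lip(1)[OF k, where q = "V r"] primitive_Lip(2)[OF k, where q = "V r"] by (simp_all add: w_def[abs_def])
  have wm: "w \<in> borel_measurable D" by (rule D.Lip_measurable[OF w(1)])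
  have close: "\<bar>w x - V x\<bar> \<le> \<eta>" if x: "0 < x" "x \<le> r" for x
  proof -
    define a where "a = integral {x..r} (k n)"
    define b where "b = V x - V r"
    have a0: "0 \<le> a" unfolding a_def using integral_Icc_bounds(1)[OF k(1) x(2) k(2) k(3)] .
    have b0: "0 \<le> b" using V(1)[OF x] by (simp add: b_def)
    have a: "ennreal a = (\<integral>\<^sup>+y. ennreal (k n y) * indicator {x..r} y \<partial>lborel)"
    proof -
      have "k n integrable_on {x..r}"
        using k(1) by (intro integrable_continuous_interval) (auto intro: continuous_on_subset)
      then have "(k n has_integral a) {x..r}" unfolding a_def by (rule integrable_integral)
      from nn_integral_has_integral_lebesgue'[OF k(2) this] show ?thesis by simp
    qed
    have b: "ennreal b = (\<integral>\<^sup>+y. ennreal (G y) * indicator {x..r} y \<partial>lborel)"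
      unfolding b_def by (rule V(2)[OF x])
    have cmp: "(\<integral>\<^sup>+y. ennreal (h y) * indicator {x..r} y \<partial>lborel) \<le> (\<integral>\<^sup>+y. ennreal (h' y) * indicator {x..r} y \<partial>lborel) + \<delta> n"
      if [measurable]: "h \<in> borel_measurable borel" "h' \<in> borel_measurable borel" and h: "\<And>y. 0 \<le> h' y" "\<And>y. h y \<le> h' y + \<bar>k n y - G y\<bar>" for h h'
    proof -
      have "(\<integral>\<^sup>+y. ennreal (h y) * indicator {x..r} y \<partial>lborel)
        \<le> (\<integral>\<^sup>+y. ennreal (h' y) * indicator {x..r} y + ennreal \<bar>k n y - G y\<bar> * indicator {0..r} y \<partial>lborel)"
      proof (rule nn_integral_mono)
        fix y
        have "ennreal (h y) \<le> ennreal (h' y) + ennreal \<bar>k n y - G y\<bar>"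
          using h[of y] by (simp add: ennreal_plus[symmetric] ennreal_leI del: ennreal_plus)
        then show "ennreal (h y) * indicator {x..r} y \<le> ennreal (h' y) * indicator {x..r} y + ennreal \<bar>k n y - G y\<bar> * indicator {0..r} y"
          using x by (auto simp: indicator_def)
      qed
      also have "\<dots> = (\<integral>\<^sup>+y. ennreal (h' y) * indicator {x..r} y \<partial>lborel) + \<delta> n"
        unfolding \<delta>_def by (rule nn_integral_add) measurable
      finally show ?thesis .
    qed
    have "ennreal a \<le> ennreal b + \<delta> n" "ennreal b \<le> ennreal a + \<delta> n"
      unfolding a b
      by (rule cmp, measurable, rule G, linarith, rule cmp, measurable, rule k, linarith)
    then have "ennreal a \<le> ennreal b + ennreal \<eta>" "ennreal b \<le> ennreal a + ennreal \<eta>"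
      using n(2) by (auto elim!: order_trans intro!: add_left_mono)
    then have "a \<le> b + \<eta>" "b \<le> a + \<eta>"
      using a0 b0 \<eta>(1) by (simp_all add: ennreal_plus[symmetric] del: ennreal_plus)
    then show ?thesis by (simp add: w_def a_def b_def)
  qed
  have "Lp_integral D p (\<lambda>x. w x - V x) \<le> (\<integral>\<^sup>+x. ennreal (\<eta> powr p) \<partial>D)"
    unfolding Lp_integral_def
  proof (intro nn_integral_mono_AE, use AE_D_neq[of 0] AE_space in eventually_elim)
    case (elim x)
    then show ?case using close[of x] \<open>1 < p\<close> by (intro ennreal_leI powr_mono2) auto
  qed
  also have "\<dots> = ennreal (\<eta> powr p * (\<omega> * r powr N))"
    using emeasure_D_Icc[of r] r by (simp add: ennreal_mult)
  also have "\<dots> \<le> ennreal \<epsilon>" using \<eta>(2) by (rule ennreal_leI)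
  finally have 1: "Lp_integral D p (\<lambda>x. w x - V x) \<le> ennreal \<epsilon>" .
  have "Lp_integral D p (lip D w) \<le> Lp_integral D p (k n)"
    using w(2) k(2) \<open>1 < p\<close> by (intro Lp_integral_mono) auto
  also have "\<dots> \<le> Lp_integral D p G + ennreal \<epsilon>" using n(1) by simp
  finally have 2: "Lp_integral D p (lip D w) \<le> Lp_integral D p G + ennreal \<epsilon>" .
  have "w \<in> Lp D p"
  proof -
    obtain L where L: "0 \<le> L" "\<And>x y. x \<in> space D \<Longrightarrow> y \<in> space D \<Longrightarrow> \<bar>w x - w y\<bar> \<le> L * dist x y"
      using Lip_E[OF w(1)] by blast
    have "Lp_integral D p w \<le> (\<integral>\<^sup>+x. ennreal ((\<bar>w r\<bar> + L * r) powr p) \<partial>D)"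
      unfolding Lp_integral_def
    proof (rule nn_integral_mono)
      fix x assume "x \<in> space D"
      then have "\<bar>w x - w r\<bar> \<le> L * dist x r" "dist x r \<le> r" using L(2)[of x r] r by (auto simp: dist_real_def)
      moreover from this(2) have "L * dist x r \<le> L * r" using L(1) by (rule mult_left_mono)
      ultimately have "\<bar>w x\<bar> \<le> \<bar>w r\<bar> + L * r" by linarith
      then show "ennreal (\<bar>w x\<bar> powr p) \<le> ennreal ((\<bar>w r\<bar> + L * r) powr p)"
        using \<open>1 < p\<close> by (intro ennreal_leI powr_mono2) auto
    qed
    also have "\<dots> < \<infinity>" using emeasure_D_Icc[of r] r by (simp add: ennreal_mult_less_top)
    finally show ?thesis using wm by (simp add: Lp_iff)
  qed
  then show thesis using that[OF _ 1 2] w(1) by simp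
qed

end

section \<open>The Polya-Szego inequality\<close>

lemma Cheeger_cong_AE:
  assumes "AE x in M. f x = g x"
  shows "Cheeger M p f = Cheeger M p g"
proof -
  have "Lp_integral M p (\<lambda>x. h x - f x) = Lp_integral M p (\<lambda>x. h x - g x)" for h
    unfolding Lp_integral_def by (intro nn_integral_cong_AE, use assms in eventually_elim) simp
  then show ?thesis by (simp add: Cheeger_def Lp_tendsto_iff)
qed

locale isoperimetric_rearrangement = rearrangement M \<Omega> N r
  for M :: "'a::polish_space measure" and \<Omega> N r +
  fixes C :: real
  assumes C: "0 < C"
    and isoperimetric_ineq:
      "\<And>E. E \<in> sets M \<Longrightarrow> E \<subseteq> \<Omega> \<Longrightarrow> ennreal (C * measure M E powr ((N - 1) / N)) \<le> Per M E"
begin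

abbreviation c :: real where "c \<equiv> C / (N * \<omega> powr (1 / N))"

lemma c_pos: "0 < c" using C N by simp

text \<open>The rearrangement has the bounded density \<open>G = f (rearr v) / c\<close>, up to
  sign. Equimeasurability carries the p-energy of \<open>f (rearr v)\<close> back to the levels of
  \<open>v\<close>, where \<open>level_density\<close> bounds it by the energy of the slope;
  division by \<open>c\<close> produces \<open>c powr (- p)\<close>.\<close>

lemma rearr_Lip_approx:
  assumes v: "v \<in> Lip M" "\<And>x. 0 \<le> v x" "\<And>x. v x \<le> S" "\<And>x. x \<notin> \<Omega> \<Longrightarrow> v x = 0" and "1 < p" "0 < \<epsilon>"
  obtains w where "w \<in> Lp D p \<inter> Lip D" "Lp_integral D p (\<lambda>x. w x - rearr v x) \<le> ennreal \<epsilon>"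
    "Lp_integral D p (lip D w) \<le> ennreal (c powr (- p)) * Lp_integral M p (lip M v) + ennreal \<epsilon>"
proof -
  interpret v: isoperimetric_Lip M \<Omega> N C v S
    by unfold_locales (use open_\<Omega> finite_\<Omega> N C isoperimetric_ineq v in auto)
  have vm [measurable]: "v \<in> borel_measurable M" by (rule v.v_measurable)
  define \<Phi> where "\<Phi> t = C * level_measure M \<Omega> v t powr ((N - 1) / N)" for t
  obtain L where L: "0 \<le> L" "\<And>x y. x \<in> space M \<Longrightarrow> y \<in> space M \<Longrightarrow> \<bar>v x - v y\<bar> \<le> L * dist x y"
    using Lip_E[OF v(1)] by blast
  obtain f where fm [measurable]: "f \<in> borel_measurable borel" and f0: "\<And>t. 0 \<le> f t" and fL: "\<And>t. f t \<le> L"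
    and dens: "\<And>h. h \<in> borel_measurable borel \<Longrightarrow>
      (\<integral>\<^sup>+t. h t * (ennreal (\<Phi> t) * indicator {0<..} t) \<partial>lborel) = (\<integral>\<^sup>+t. h t * ennreal (f t) \<partial>distr R borel v)"
    and energy: "(\<integral>\<^sup>+t. ennreal (f t powr p) \<partial>distr R borel v) \<le> (\<integral>\<^sup>+x. ennreal (lip M v x powr p) \<partial>R)"
  \<comment> \<open>The measure \<open>\<Phi> dt\<close> is finite: its density is bounded in terms
    of the volume of \<Omega> and vanishes above the bound \<open>S\<close> of
    \<open>v\<close>.\<close>
  proof (rule level_density[of R v "lip M v" L \<Phi> "C * (\<omega> * r powr N) powr ((N - 1) / N)" S p])
    show "finite_measure R" by (rule finite_R)
    show "v \<in> borel_measurable R" "lip M v \<in> borel_measurable R"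
      by (intro borel_measurable_R vm v.lip_v_measurable)+
    show "lip M v x \<le> L" for x by (rule lip_le_Lipschitz[OF L]) simp_all
    show "\<Phi> \<in> borel_measurable borel"
      unfolding \<Phi>_def[abs_def] using level_measurable[OF vm] by measurable
    show "0 \<le> \<Phi> t" for t using C by (simp add: \<Phi>_def)
    show "\<Phi> t \<le> C * (\<omega> * r powr N) powr ((N - 1) / N)" for t
      unfolding \<Phi>_def using C N level_le[OF vm]
      by (intro mult_left_mono powr_mono2) (auto simp: level_measure_def)
    show "\<Phi> t = 0" if "S \<le> t" for t
    proof -
      have "{x \<in> \<Omega>. t < v x} = {}" using v(3) that by (auto simp: not_less intro: order_trans)
      then have "level_measure M \<Omega> v t = 0" unfolding level_measure_def by (simp only: measure_empty)
      then show ?thesis by (simp add: \<Phi>_def)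
    qed
    show "(\<integral>\<^sup>+t. ennreal (\<Phi> t) * indicator {a<..<b} t \<partial>lborel)
        \<le> (\<integral>\<^sup>+x. ennreal (lip M v x) * indicator {x. a < v x \<and> v x \<le> b} x \<partial>R)" if "0 \<le> a" "a < b" for a b
    proof -
      have "(\<integral>\<^sup>+x. ennreal (lip M v x) * indicator {x. a < v x \<and> v x \<le> b} x \<partial>R)
          = (\<integral>\<^sup>+x. ennreal (lip M v x) * indicator {x. a < v x \<and> v x \<le> b} x \<partial>M)"
        using \<Omega>_sets v(4) that by (subst nn_integral_restrict_space) (auto intro!: nn_integral_cong simp: indicator_def)
      then show ?thesis using v.isoperimetric_coarea[OF that] by (simp add: \<Phi>_def)
    qed
  qed (use L(1) \<open>1 < p\<close> in auto)
  have rm [measurable]: "rearr v \<in> borel_measurable borel" by (rule rearr_measurable[OF vm])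
  define G where "G y = f (rearr v y) / c" for y
  have [measurable]: "G \<in> borel_measurable borel" unfolding G_def[abs_def] by measurable
  have formula: "ennreal (rearr v x - rearr v r) = (\<integral>\<^sup>+y. ennreal (G y) * indicator {x..r} y \<partial>lborel)" if "0 < x" "x \<le> r" for x
    unfolding G_def by (rule rearr_formula[OF vm v(2) C fm f0 dens[unfolded \<Phi>_def] that])
  obtain w where w: "w \<in> Lp D p \<inter> Lip D" "Lp_integral D p (\<lambda>x. w x - rearr v x) \<le> ennreal \<epsilon>"
    "Lp_integral D p (lip D w) \<le> Lp_integral D p G + ennreal \<epsilon>"
  proof (rule primitive_approx[of "rearr v" G "L / c" p \<epsilon>])
    show "rearr v r \<le> rearr v x" if "0 < x" "x \<le> r" for x by (rule rearr_antimono[OF vm that])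
    show "0 \<le> G y" for y unfolding G_def by (intro divide_nonneg_pos f0 c_pos)
    show "G y \<le> L / c" for y unfolding G_def by (intro divide_right_mono fL less_imp_le[OF c_pos])
  qed (use formula \<open>1 < p\<close> \<open>0 < \<epsilon>\<close> in auto)
  have "Lp_integral D p G = (\<integral>\<^sup>+y. ennreal (c powr (- p)) * ennreal (f (rearr v y) powr p) \<partial>D)"
    unfolding Lp_integral_def
  proof (rule nn_integral_cong)
    fix y
    have "\<bar>G y\<bar> powr p = c powr (- p) * f (rearr v y) powr p"
    proof -
      have "\<bar>G y\<bar> = f (rearr v y) / c"
        unfolding G_def by (intro abs_of_nonneg divide_nonneg_pos f0 c_pos)
      then show ?thesis
        by (simp only: powr_divide powr_minus divide_inverse[of "_ powr _"] mult.commute)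
    qed
    then show "ennreal (\<bar>G y\<bar> powr p) = ennreal (c powr (- p)) * ennreal (f (rearr v y) powr p)"
      by (simp add: ennreal_mult)
  qed
  also have "\<dots> = ennreal (c powr (- p)) * (\<integral>\<^sup>+y. ennreal (f (rearr v y) powr p) \<partial>D)"
    by (rule nn_integral_cmult) (intro borel_measurable_D, measurable)
  also have "(\<integral>\<^sup>+y. ennreal (f (rearr v y) powr p) \<partial>D) = (\<integral>\<^sup>+t. ennreal (f t powr p) \<partial>distr D borel (rearr v))"
    by (rule nn_integral_distr[symmetric]) (auto intro: borel_measurable_D)
  also have "distr D borel (rearr v) = distr R borel v"
    using distr_rearr[OF vm] v(2) by (simp add: max_absorb2)
  finally have "Lp_integral D p G \<le> ennreal (c powr (- p)) * (\<integral>\<^sup>+x. ennreal (lip M v x powr p) \<partial>R)"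
    using energy by (simp add: mult_left_mono)
  also have "(\<integral>\<^sup>+x. ennreal (lip M v x powr p) \<partial>R) \<le> Lp_integral M p (lip M v)"
    unfolding Lp_integral_def using \<Omega>_sets
    by (subst nn_integral_restrict_space) (auto intro!: nn_integral_mono simp: indicator_def)
  finally have "Lp_integral D p G \<le> ennreal (c powr (- p)) * Lp_integral M p (lip M v)"
    by (simp add: mult_left_mono)
  then have "Lp_integral D p (lip D w) \<le> ennreal (c powr (- p)) * Lp_integral M p (lip M v) + ennreal \<epsilon>"
    using w(3) by (elim order_trans) (intro add_right_mono)
  then show thesis using that w(1,2) by simp
qed

text \<open>One sequence serves both sides. The approximations \<open>v n\<close> are minimizing for
  \<open>u\<close>, and their slopes vanish off \<Omega>, which localizes the minimal gradient. On
  the interval, \<open>w n\<close> approximates \<open>rearr (v n)\<close> up to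
  \<open>1 / Suc n\<close>, so it converges to \<open>rearr u\<close> with energies bounded in the
  limit by \<open>c powr (- p) * Cheeger M p u\<close>.\<close>

lemma polya_szego:
  assumes u: "u \<in> W1p_0 M p \<Omega>" and nonneg: "AE x in M. 0 \<le> u x" and "1 < p"
  shows "rearr u \<in> Lp D p"
    and "Cheeger D p (rearr u) \<le> ennreal (c powr (- p)) * Cheeger M p u"
    and "Cheeger M p u \<le> (\<integral>\<^sup>+x\<in>\<Omega>. ennreal (minimal_weak_upper_gradient M p u x powr p) \<partial>M)"
proof -
  have uW: "u \<in> W1p M p" using u by (simp add: W1p_0_def)
  then have um [measurable]: "u \<in> borel_measurable M" and uLp: "u \<in> Lp M p" and uC: "Cheeger M p u < \<infinity>"
    by (simp_all add: W1p_def Lp_iff)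
  define P where "P n v S \<longleftrightarrow> v \<in> Lip M \<and> (\<forall>x. 0 \<le> v x) \<and> (\<forall>x. v x \<le> S) \<and> (\<forall>x. x \<notin> \<Omega> \<longrightarrow> v x = 0) \<and>
      (\<forall>x. x \<notin> \<Omega> \<longrightarrow> lip M v x = 0) \<and> Lp_integral M p (\<lambda>x. v x - u x) \<le> ennreal (1 / real (Suc n)) \<and>
      Lp_integral M p (lip M v) \<le> Cheeger M p u + ennreal (1 / real (Suc n))" for n v S
  have "\<forall>n. \<exists>v S. P n v S"
  proof
    fix n :: nat
    have "0 < 1 / real (Suc n)" by simp
    then show "\<exists>v S. P n v S"
      by (rule W1p_0_Lipschitz_approx[OF u nonneg open_\<Omega> \<open>1 < p\<close>])
        (unfold P_def, intro exI conjI allI impI; assumption)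
  qed
  then obtain v S where vS: "\<forall>n. P n (v n) (S n)"
    by (auto simp only: choice_iff)
  then have v: "v n \<in> Lip M" "0 \<le> v n x" "v n x \<le> S n" "x \<notin> \<Omega> \<Longrightarrow> v n x = 0" "x \<notin> \<Omega> \<Longrightarrow> lip M (v n) x = 0"
    and vu: "Lp_integral M p (\<lambda>x. v n x - u x) \<le> ennreal (1 / real (Suc n))"
    and lipv: "Lp_integral M p (lip M (v n)) \<le> Cheeger M p u + ennreal (1 / real (Suc n))" for n x
    by (simp_all add: P_def)
  have vm [measurable]: "v n \<in> borel_measurable M" for n by (rule Lip_measurable[OF v(1)])
  have small: "(\<lambda>n. ennreal (1 / real (Suc n))) \<longlonglongrightarrow> 0"
  proof -
    have "(\<lambda>n. ennreal (1 / real (Suc n))) \<longlonglongrightarrow> ennreal 0"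
      using LIMSEQ_inverse_real_of_nat by (intro tendsto_ennrealI) (simp add: inverse_eq_divide)
    then show ?thesis by simp
  qed
  have v_lim: "Lp_tendsto M p v u"
    unfolding Lp_tendsto_iff by (rule tendsto_sandwich[OF _ _ tendsto_const small]) (simp_all add: vu del: of_nat_Suc)
  have vLp: "v n \<in> Lp M p" for n
  proof -
    have "Lp_integral M p (\<lambda>x. v n x - u x) < \<infinity>" using le_less_trans[OF vu ennreal_less_top] by simp
    moreover have "\<bar>v n x\<bar> \<le> \<bar>v n x - u x\<bar> + \<bar>u x\<bar>" for x using abs_triangle_ineq[of "v n x - u x" "u x"] by simp
    ultimately have "Lp_integral M p (v n) < \<infinity>"
      using Lp_integral_add_finite[of "\<lambda>x. v n x - u x" M u p "v n"] uLp \<open>1 < p\<close> by (simp add: Lp_iff)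
    then show ?thesis by (simp add: Lp_iff)
  qed
  have min: "minimizing M p v u"
  proof (rule minimizingI[OF _ v_lim uC])
    show "v n \<in> Lp M p \<inter> Lip M" for n using vLp v(1) by simp
    fix e :: real assume "0 < e"
    from ennreal_tendsto_0D[OF small this]
    show "\<forall>\<^sub>F n in sequentially. Lp_integral M p (lip M (v n)) \<le> Cheeger M p u + ennreal e"
      by eventually_elim (rule order_trans[OF lipv add_left_mono], rule less_imp_le)
  qed
  show "Cheeger M p u \<le> (\<integral>\<^sup>+x\<in>\<Omega>. ennreal (minimal_weak_upper_gradient M p u x powr p) \<partial>M)"
    by (rule minimal_weak_upper_gradient_local[OF uW \<open>1 < p\<close> min \<Omega>_sets]) (simp add: v(5))
  have R_le: "(\<integral>\<^sup>+x. ennreal (h x) \<partial>R) \<le> (\<integral>\<^sup>+x. ennreal (h' x) \<partial>M)" if "AE x in M. h x = h' x" for h h'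
  proof -
    have "(\<integral>\<^sup>+x. ennreal (h x) \<partial>R) = (\<integral>\<^sup>+x. ennreal (h x) * indicator \<Omega> x \<partial>M)"
      using \<Omega>_sets by (intro nn_integral_restrict_space) simp
    also have "\<dots> \<le> (\<integral>\<^sup>+x. ennreal (h' x) \<partial>M)"
      by (intro nn_integral_mono_AE, use that in eventually_elim) (simp add: indicator_def)
    finally show ?thesis .
  qed
  have fin: "(\<integral>\<^sup>+x. ennreal (max 0 (h x) powr p) \<partial>R) < \<infinity>" if h: "h \<in> Lp M p" "AE x in M. 0 \<le> h x" for h
  proof -
    have "(\<integral>\<^sup>+x. ennreal (max 0 (h x) powr p) \<partial>R) \<le> (\<integral>\<^sup>+x. ennreal (\<bar>h x\<bar> powr p) \<partial>M)"
      by (rule R_le, use h(2) in eventually_elim) (simp add: max_absorb2)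
    also have "\<dots> < \<infinity>" using h(1) by (simp add: Lp_iff Lp_integral_def)
    finally show ?thesis .
  qed
  have v0: "AE x in M. 0 \<le> v n x" for n using v(2) by simp
  have rm [measurable]: "rearr u \<in> borel_measurable D" "rearr (v n) \<in> borel_measurable D" for n
    by (intro borel_measurable_D rearr_measurable um vm)+
  have "Lp_integral D p (rearr u) = (\<integral>\<^sup>+x. ennreal (max 0 (u x) powr p) \<partial>R)"
    using nn_integral_rearr[OF um, of "\<lambda>t. ennreal (\<bar>t\<bar> powr p)"] by (simp add: Lp_integral_def)
  then show "rearr u \<in> Lp D p"
    using fin[OF uLp nonneg] rm by (simp add: Lp_iff)
  \<comment> \<open>The rearrangement is not treated as an \<open>L\<^sup>p\<close> contraction:
    \<open>L\<^sup>p\<close> convergence is weakened to \<open>L\<^sup>1\<close> convergence of p-th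
    powers, carried to the interval by \<open>rearr_contraction\<close>.\<close>
  have r_lim: "Lp_tendsto D p (\<lambda>n. rearr (v n)) (rearr u)"
    unfolding Lp_tendsto_iff
  proof (rule tendsto_sandwich[OF _ _ tendsto_const Lp_tendsto_powr_diff[OF v_lim uLp]])
    show "\<forall>\<^sub>F n in sequentially. Lp_integral D p (\<lambda>x. rearr (v n) x - rearr u x)
        \<le> (\<integral>\<^sup>+x. ennreal \<bar>\<bar>v n x\<bar> powr p - \<bar>u x\<bar> powr p\<bar> \<partial>M)"
    proof (intro always_eventually allI)
      fix n
      have "Lp_integral D p (\<lambda>x. rearr (v n) x - rearr u x) \<le> (\<integral>\<^sup>+x. ennreal \<bar>max 0 (v n x) powr p - max 0 (u x) powr p\<bar> \<partial>R)"
        using \<open>1 < p\<close> by (intro rearr_contraction vm um fin vLp uLp v0 nonneg) simp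
      also have "\<dots> \<le> (\<integral>\<^sup>+x. ennreal \<bar>\<bar>v n x\<bar> powr p - \<bar>u x\<bar> powr p\<bar> \<partial>M)"
        by (rule R_le, use nonneg v0[of n] in eventually_elim) (simp add: max_absorb2)
      finally show "Lp_integral D p (\<lambda>x. rearr (v n) x - rearr u x) \<le> (\<integral>\<^sup>+x. ennreal \<bar>\<bar>v n x\<bar> powr p - \<bar>u x\<bar> powr p\<bar> \<partial>M)" .
    qed
  qed (use \<open>1 < p\<close> in simp_all)
  define Q where "Q n w \<longleftrightarrow> w \<in> Lp D p \<inter> Lip D \<and> Lp_integral D p (\<lambda>x. w x - rearr (v n) x) \<le> ennreal (1 / real (Suc n)) \<and>
    Lp_integral D p (lip D w) \<le> ennreal (c powr (- p)) * Lp_integral M p (lip M (v n)) + ennreal (1 / real (Suc n))" for n w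
  have "\<exists>w. Q n w" for n
  proof (rule rearr_Lip_approx[where v = "v n" and S = "S n" and p = p and \<epsilon> = "1 / real (Suc n)"])
    fix w assume w: "w \<in> Lp D p \<inter> Lip D" "Lp_integral D p (\<lambda>x. w x - rearr (v n) x) \<le> ennreal (1 / real (Suc n))"
      "Lp_integral D p (lip D w) \<le> ennreal (c powr (- p)) * Lp_integral M p (lip M (v n)) + ennreal (1 / real (Suc n))"
    show ?thesis unfolding Q_def by (intro exI[of _ w] conjI w)
  qed (simp_all add: v \<open>1 < p\<close> del: of_nat_Suc)
  then have "\<exists>w. \<forall>n. Q n (w n)" by (intro choice allI)
  then obtain w where w_all: "\<forall>n. Q n (w n)" ..
  then have w: "w n \<in> Lp D p \<inter> Lip D" and wv: "Lp_integral D p (\<lambda>x. w n x - rearr (v n) x) \<le> ennreal (1 / real (Suc n))"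
    and lipw: "Lp_integral D p (lip D (w n)) \<le> ennreal (c powr (- p)) * Lp_integral M p (lip M (v n)) + ennreal (1 / real (Suc n))" for n
    by (simp_all add: Q_def)
  have [measurable]: "w n \<in> borel_measurable D" for n using w[of n] by (simp add: Lp_iff)
  have "Lp_tendsto D p (\<lambda>n x. w n x - rearr (v n) x) (\<lambda>x. 0)"
    unfolding Lp_tendsto_iff
    by (rule tendsto_sandwich[OF _ _ tendsto_const small]) (simp_all add: wv del: of_nat_Suc)
  from this r_lim have w_lim: "Lp_tendsto D p w (rearr u)"
  proof (rule Lp_tendsto_comb)
    fix n
    have "\<bar>w n x - rearr u x\<bar> \<le> \<bar>w n x - rearr (v n) x - 0\<bar> + \<bar>rearr (v n) x - rearr u x\<bar>" for x
      using abs_triangle_ineq[of "w n x - rearr (v n) x" "rearr (v n) x - rearr u x"] by simp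
    then show "AE x in D. \<bar>w n x - rearr u x\<bar> \<le> \<bar>w n x - rearr (v n) x - 0\<bar> + \<bar>rearr (v n) x - rearr u x\<bar>" by simp
  qed (use \<open>1 < p\<close> in \<open>simp_all\<close>)
  let ?E = "\<lambda>n. ennreal (c powr (- p)) * Lp_integral M p (lip M (v n)) + ennreal (1 / real (Suc n))"
  have "?E \<longlonglongrightarrow> ennreal (c powr (- p)) * Cheeger M p u + 0"
    using min small by (intro tendsto_add ennreal_tendsto_cmult) (simp_all add: minimizing_def)
  then have lim: "liminf ?E = ennreal (c powr (- p)) * Cheeger M p u"
    using lim_imp_Liminf[OF sequentially_bot] by simp
  have "Cheeger D p (rearr u) \<le> liminf (\<lambda>n. Lp_integral D p (lip D (w n)))"
    by (rule Cheeger_le_liminf[OF w w_lim])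
  also have "\<dots> \<le> liminf ?E"
    using lipw by (intro Liminf_mono always_eventually allI)
  finally show "Cheeger D p (rearr u) \<le> ennreal (c powr (- p)) * Cheeger M p u"
    by (simp only: lim)
qed

end

theorem theorem3p6:
  fixes M :: "'a::polish_space measure" and \<Omega> :: "'a set" and K N' N C p r :: real
  assumes "metric_measure_space M"
    and "1 < N'" and "CD K N' M"
    and "open \<Omega>" and "emeasure M \<Omega> < \<infinity>"
    and "1 < N" and "0 < C"
    and "\<forall>E\<in>sets M. E \<subseteq> \<Omega> \<longrightarrow> Per M E \<ge> ennreal (C * measure M E powr ((N - 1) / N))"
    and "0 \<le> r" and "emeasure (m0 N) {0..r} = emeasure M \<Omega>"
    and "1 < p"
  shows "\<forall>u\<in>W1p_0 M p \<Omega>. (AE x in M. 0 \<le> u x) \<longrightarrow>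
      euclidean_rearrangement N M \<Omega> u \<in> W1p (restrict_space (m0 N) {0..r}) p \<and>
      (\<integral>\<^sup>+x\<in>\<Omega>. ennreal (minimal_weak_upper_gradient M p u x powr p) \<partial>M)
        \<ge> ennreal ((C / (N * unit_ball_vol N powr (1 / N))) powr p) *
           (\<integral>\<^sup>+x. ennreal (minimal_weak_upper_gradient (restrict_space (m0 N) {0..r}) p
                      (euclidean_rearrangement N M \<Omega> u) x powr p)
              \<partial>restrict_space (m0 N) {0..r})"
proof (intro ballI impI)
  fix u assume u: "u \<in> W1p_0 M p \<Omega>" and nonneg: "AE x in M. 0 \<le> u x"
  interpret isoperimetric_rearrangement M \<Omega> N r C
    by unfold_locales (use assms in simp_all)
  have um: "u \<in> borel_measurable M" and uC: "Cheeger M p u < \<infinity>"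
    using u by (simp_all add: W1p_0_def W1p_def Lp_iff)
  define U where "U = euclidean_rearrangement N M \<Omega> u"
  note ps = polya_szego[OF u nonneg \<open>1 < p\<close>]
  have U_eq: "U x = rearr u x" if "0 < x" for x
    unfolding U_def by (rule euclidean_rearrangement_eq[OF um that])
  have U_AE: "AE x in D. U x = rearr u x"
    using AE_D_neq[of 0] AE_space by eventually_elim (auto intro: U_eq)
  have Um: "U \<in> borel_measurable D"
  proof -
    \<comment> \<open>At 0 the rearrangement is the essential supremum (or 0 if that is infinite),
      where \<open>rearr\<close> has the value 0; measurability needs this point patched.\<close>
    have "(\<lambda>x. if x = 0 then U 0 else rearr u x) \<in> borel_measurable borel"
      using rearr_measurable[OF um] by measurable
    then have "(\<lambda>x. if x = 0 then U 0 else rearr u x) \<in> borel_measurable D" by (rule borel_measurable_D)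
    then show ?thesis by (rule measurable_cong[THEN iffD1, rotated]) (auto simp: U_eq)
  qed
  have "Lp_integral D p U = Lp_integral D p (rearr u)"
    unfolding Lp_integral_def by (intro nn_integral_cong_AE, use U_AE in eventually_elim) simp
  then have ULp: "U \<in> Lp D p" using ps(1) Um by (simp add: Lp_iff)
  have U_le: "Cheeger D p U \<le> ennreal (c powr (- p)) * Cheeger M p u"
    using ps(2) Cheeger_cong_AE[OF U_AE] by simp
  also have "\<dots> < \<infinity>" using uC by (simp add: ennreal_mult_less_top)
  finally have UW: "U \<in> W1p D p" using ULp by (simp add: W1p_def)
  let ?G = "minimal_weak_upper_gradient D p U"
  have "(\<integral>\<^sup>+x. ennreal (?G x powr p) \<partial>D) = Cheeger D p U"
    using D.minimal_weak_upper_gradient[OF UW \<open>1 < p\<close>] by (simp add: weak_upper_gradient_def Lp_integral_def)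
  \<comment> \<open>The factor \<open>c powr p\<close> undoes \<open>c powr (- p)\<close>, leaving
    \<open>Cheeger M p u\<close>, which the localized gradient over \<Omega> dominates.\<close>
  then have "ennreal (c powr p) * (\<integral>\<^sup>+x. ennreal (?G x powr p) \<partial>D) \<le> ennreal (c powr p) * (ennreal (c powr (- p)) * Cheeger M p u)"
    using U_le by (simp add: mult_left_mono)
  also have "\<dots> = Cheeger M p u"
  proof -
    have "c powr p * c powr (- p) = 1" using C N by (simp add: powr_add[symmetric])
    then have "ennreal (c powr p) * ennreal (c powr (- p)) = 1" by (simp add: ennreal_mult[symmetric])
    then show ?thesis by (simp add: mult.assoc[symmetric])
  qed
  also note ps(3)
  finally show "euclidean_rearrangement N M \<Omega> u \<in> W1p D p \<and>
      (\<integral>\<^sup>+x\<in>\<Omega>. ennreal (minimal_weak_upper_gradient M p u x powr p) \<partial>M)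
        \<ge> ennreal (c powr p) * (\<integral>\<^sup>+x. ennreal (minimal_weak_upper_gradient D p (euclidean_rearrangement N M \<Omega> u) x powr p) \<partial>D)"
    using UW unfolding U_def by simp
qed

end
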